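(* Let $(N,g_N)$ be a Riemannian manifold, let $m\in\mathbb{N}$ and $p\in[1,+\infty)$ be such that $1\le 2p<m$, and let $r>0$. If $N$ has at least one nontrivial bounded geodesic, then there exists $u\in\dot W^{2,p}(\mathbb{B}^m_r,N)\cap L^\infty(\mathbb{B}^m_r,N)$ such that $$\int_{\mathbb{B}^m_r}|Tu|^{2p}_{g_m^*\otimes g_N}=+\infty.$$
   Context: $\mathbb{B}^m_r$ is the open ball of radius $r$ centred at $0$ in $\mathbb{R}^m$ with the Euclidean metric $g_m$. Riemannian manifolds are smooth, Hausdorff with a countable basis, and carry their Levi-Civita connections. A nontrivial bounded geodesic is a nonconstant geodesic $\gamma\colon\mathbb{R}\to N$ (defined on all of $\mathbb{R}$) whose image is bounded for the geodesic distance $d_N$. Write $M=\mathbb{B}^m_r$. Colocal weak differentiability: a measurable $u\colon M\to N$ between manifolds is colocally weakly differentiable if $f\circ u$ is weakly differentiable for every $f\in C^1_c(N,\mathbb{R})$; its colocal weak derivative is the a.e. unique measurable bundle morphism $Tu\colon TM\to TN$ covering $u$ with $T(f\circ u)=Tf\circ Tu$ a.e. for all such $f$. $T^*M\otimes TN$ is the vector bundle over $M\times N$ with fibres $\mathcal{L}(T_xM,T_yN)$ and $Tu$ is regarded as a measurable map $M\to T^*M\otimes TN$. $u$ is twice colocally weakly differentiable if $u$ and $Tu\colon M\to T^*M\otimes TN$ are colocally weakly differentiable; $T^2u\colon TM\to T(T^*M\otimes TN)$ is the colocal weak derivative of $Tu$. $K\colon T(T^*M\otimes TN)\to T^*M\otimes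 TN$ is the connection map induced by the Levi-Civita connections of $M$ and $N$, and $D_K(Tu)=K\circ T^2u$, so $D_K(Tu)(x)\colon T_xM\times T_xM\to T_{u(x)}N$ is bilinear. Norms: $|\xi|^2_{g_m^*\otimes g_N}=\sum_ig_N(\xi[e_i],\xi[e_i])$ and $|\zeta|^2_{g_m^*\otimes g_m^*\otimes g_N}=\sum_{i,j}g_N(\zeta(e_i,e_j),\zeta(e_i,e_j))$, $(e_i)$ orthonormal. $\dot W^{2,p}(M,N)$ is the set of twice colocally weakly differentiable $u$ with $|D_K(Tu)|_{g_m^*\otimes g_m^*\otimes g_N}\in L^p(M)$. $L^\infty(M,N)$ is the set of measurable $u\colon M\to N$ with $\operatorname{ess\,sup}\{d_N(u(x),u(y)):x,y\in M\}<+\infty$. *)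

theory Defs
  imports "HOL-Analysis.Analysis"
begin

section \<open>Maps of class \<open>C\<^sup>k\<close> between Euclidean spaces\<close>

text \<open>Meant for open sets \<open>S\<close>. In a finite-dimensional space continuity of all the directional
  derivatives \<open>x \<mapsto> Df(x)[v]\<close> is continuity of \<open>Df\<close>.\<close>

primrec Ck_on :: "nat \<Rightarrow> ('a::euclidean_space \<Rightarrow> 'b::real_normed_vector) \<Rightarrow> 'a set \<Rightarrow> bool" where
  "Ck_on 0 f S \<longleftrightarrow> continuous_on S f"
| "Ck_on (Suc k) f S \<longleftrightarrow>
     (\<forall>x\<in>S. f differentiable (at x)) \<and> (\<forall>v. Ck_on k (\<lambda>x. frechet_derivative f (at x) v) S)"

definition smooth_on :: "('a::euclidean_space \<Rightarrow> 'b::real_normed_vector) \<Rightarrow> 'a set \<Rightarrow> bool" where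
  "smooth_on f S \<longleftrightarrow> (\<forall>k. Ck_on k f S)"


section \<open>Smooth manifolds\<close>

text \<open>A manifold is given by an atlas. A chart is a pair of its domain and its coordinate map (whose
  values off the domain are irrelevant); the underlying set is the union of the chart domains,
  and its topology is the one induced by the atlas.\<close>

type_synonym ('a, 'e) chart = "'a set \<times> ('a \<Rightarrow> 'e)"
type_synonym ('a, 'e) atlas = "('a, 'e) chart set"

definition mcarrier :: "('a, 'e) atlas \<Rightarrow> 'a set" where
  "mcarrier N = (\<Union>c\<in>N. fst c)"

definition chart_image :: "('a, 'e) chart \<Rightarrow> 'e set" where
  "chart_image c = snd c ` fst c"

definition chart_inv :: "('a, 'e) chart \<Rightarrow> 'e \<Rightarrow> 'a" where
  "chart_inv c = inv_into (fst c) (snd c)"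

definition transition :: "('a, 'e) chart \<Rightarrow> ('a, 'e) chart \<Rightarrow> 'e \<Rightarrow> 'e" where
  "transition c c' = snd c' \<circ> chart_inv c"

definition mtopology :: "('a, 'e::topological_space) atlas \<Rightarrow> 'a topology" where
  "mtopology N = topology (\<lambda>W. W \<subseteq> mcarrier N \<and> (\<forall>c\<in>N. open (snd c ` (fst c \<inter> W))))"

locale smooth_manifold =
  fixes N :: "('a, 'e::euclidean_space) atlas"
  assumes chart_inj: "c \<in> N \<Longrightarrow> inj_on (snd c) (fst c)"
    and chart_open: "c \<in> N \<Longrightarrow> open (chart_image c)"
    and overlap_open: "c \<in> N \<Longrightarrow> c' \<in> N \<Longrightarrow> open (snd c ` (fst c \<inter> fst c'))"
    and transition_smooth:
      "c \<in> N \<Longrightarrow> c' \<in> N \<Longrightarrow> smooth_on (transition c c') (snd c ` (fst c \<inter> fst c'))"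
    and hausdorff: "Hausdorff_space (mtopology N)"
    and countable_basis: "second_countable (mtopology N)"

definition charts_at :: "('a, 'e) atlas \<Rightarrow> 'a \<Rightarrow> ('a, 'e) chart set" where
  "charts_at N y = {c \<in> N. y \<in> fst c}"

text \<open>A tangent vector at \<open>y\<close> is the family of its coordinates in the charts around \<open>y\<close>, which
  transform by the derivatives of the transition maps (and are \<open>0\<close> for all other charts). The
  linear structure of a tangent space is the one of the coordinates.\<close>

type_synonym ('a, 'e) tangent = "('a, 'e) chart \<Rightarrow> 'e"

definition tangent_space :: "('a, 'e::euclidean_space) atlas \<Rightarrow> 'a \<Rightarrow> ('a, 'e) tangent set" where
  "tangent_space N y =
     {v. (\<forall>c\<in>charts_at N y. \<forall>c'\<in>charts_at N y.
            v c' = frechet_derivative (transition c c') (at (snd c y)) (v c)) \<and>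
         (\<forall>c. c \<notin> charts_at N y \<longrightarrow> v c = 0)}"

text \<open>The tangent vector at \<open>y\<close> with coordinates \<open>w\<close> in the chart \<open>c\<close>.\<close>

definition tangent_vector ::
    "('a, 'e::euclidean_space) atlas \<Rightarrow> ('a, 'e) chart \<Rightarrow> 'a \<Rightarrow> 'e \<Rightarrow> ('a, 'e) tangent" where
  "tangent_vector N c y w = (\<lambda>c'. if c' \<in> charts_at N y
     then frechet_derivative (transition c c') (at (snd c y)) w else 0)"

text \<open>\<open>C\<^sup>1\<^sub>c(N, \<real>)\<close>, and the differential at \<open>y\<close> of such a function (which does not depend on the
  selected chart).\<close>

definition C1_compact_support :: "('a, 'e::euclidean_space) atlas \<Rightarrow> ('a \<Rightarrow> real) \<Rightarrow> bool" where
  "C1_compact_support N f \<longleftrightarrow>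
     (\<forall>c\<in>N. Ck_on 1 (f \<circ> chart_inv c) (chart_image c)) \<and>
     (\<exists>K. compactin (mtopology N) K \<and> (\<forall>y\<in>mcarrier N - K. f y = 0))"

definition mdifferential ::
    "('a, 'e::euclidean_space) atlas \<Rightarrow> ('a \<Rightarrow> real) \<Rightarrow> 'a \<Rightarrow> ('a, 'e) tangent \<Rightarrow> real" where
  "mdifferential N f y v = (let c = (SOME c. c \<in> charts_at N y)
     in frechet_derivative (f \<circ> chart_inv c) (at (snd c y)) (v c))"


section \<open>Riemannian manifolds\<close>

type_synonym ('a, 'e) metric = "'a \<Rightarrow> ('a, 'e) tangent \<Rightarrow> ('a, 'e) tangent \<Rightarrow> real"

definition local_metric ::
    "('a, 'e::euclidean_space) atlas \<Rightarrow> ('a, 'e) metric \<Rightarrow> ('a, 'e) chart \<Rightarrow> 'e \<Rightarrow> 'e \<Rightarrow> 'e \<Rightarrow> real" where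
  "local_metric N g c z v w =
     g (chart_inv c z) (tangent_vector N c (chart_inv c z) v) (tangent_vector N c (chart_inv c z) w)"

locale riemannian_manifold = smooth_manifold N
  for N :: "('a, 'e::euclidean_space) atlas" +
  fixes g :: "('a, 'e) metric"
  assumes metric_bilinear: "c \<in> N \<Longrightarrow> z \<in> chart_image c \<Longrightarrow> bilinear (local_metric N g c z)"
    and metric_symmetric: "c \<in> N \<Longrightarrow> z \<in> chart_image c \<Longrightarrow>
      local_metric N g c z v w = local_metric N g c z w v"
    and metric_positive: "c \<in> N \<Longrightarrow> z \<in> chart_image c \<Longrightarrow> v \<noteq> 0 \<Longrightarrow> 0 < local_metric N g c z v v"
    and metric_smooth: "c \<in> N \<Longrightarrow> smooth_on (\<lambda>z. local_metric N g c z v w) (chart_image c)"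

text \<open>In a chart an affine connection is \<open>\<nabla>\<^sub>w V = DV[w] + \<Gamma>(w, V)\<close>; it is torsion-free if and only
  if \<open>\<Gamma>\<close> is symmetric. The Levi-Civita connection is the unique torsion-free connection that is
  compatible with the metric; existence and uniqueness are \<open>ex1_levi_civita_form\<close> below.\<close>

definition is_levi_civita_form :: "('a, 'e::euclidean_space) atlas \<Rightarrow> ('a, 'e) metric \<Rightarrow>
    ('a, 'e) chart \<Rightarrow> 'e \<Rightarrow> ('e \<Rightarrow> 'e \<Rightarrow> 'e) \<Rightarrow> bool" where
  "is_levi_civita_form N g c z \<Gamma> \<longleftrightarrow>
     bilinear \<Gamma> \<and> (\<forall>v w. \<Gamma> v w = \<Gamma> w v) \<and>
     (\<forall>w v v'. frechet_derivative (\<lambda>z. local_metric N g c z v v') (at z) w =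
        local_metric N g c z (\<Gamma> w v) v' + local_metric N g c z v (\<Gamma> w v'))"

definition levi_civita_form ::
    "('a, 'e::euclidean_space) atlas \<Rightarrow> ('a, 'e) metric \<Rightarrow> ('a, 'e) chart \<Rightarrow> 'e \<Rightarrow> 'e \<Rightarrow> 'e \<Rightarrow> 'e" where
  "levi_civita_form N g c z = (THE \<Gamma>. is_levi_civita_form N g c z \<Gamma>)"


subsection \<open>Geodesic distance and geodesics\<close>

definition velocity ::
    "('a, 'e::euclidean_space) atlas \<Rightarrow> (real \<Rightarrow> 'a) \<Rightarrow> real \<Rightarrow> ('a, 'e) tangent" where
  "velocity N \<gamma> t = (\<lambda>c. if c \<in> charts_at N (\<gamma> t) then vector_derivative (snd c \<circ> \<gamma>) (at t) else 0)"

text \<open>The convention is that of the library's \<open>piecewise_C1_differentiable_on\<close>.\<close>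

definition piecewise_C1_curve :: "('a, 'e::euclidean_space) atlas \<Rightarrow> (real \<Rightarrow> 'a) \<Rightarrow> bool" where
  "piecewise_C1_curve N \<gamma> \<longleftrightarrow>
     continuous_map (top_of_set {0..1}) (mtopology N) \<gamma> \<and>
     (\<exists>S. finite S \<and>
        (\<forall>c\<in>N. (snd c \<circ> \<gamma>) C1_differentiable_on {t \<in> {0..1} - S. \<gamma> t \<in> fst c}))"

definition curve_length ::
    "('a, 'e::euclidean_space) atlas \<Rightarrow> ('a, 'e) metric \<Rightarrow> (real \<Rightarrow> 'a) \<Rightarrow> ennreal" where
  "curve_length N g \<gamma> =
     (\<integral>\<^sup>+t\<in>{0..1}. ennreal (sqrt (g (\<gamma> t) (velocity N \<gamma> t) (velocity N \<gamma> t))) \<partial>lebesgue)"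

text \<open>The distance is \<open>\<infinity>\<close> between different connected components.\<close>

definition geodesic_dist ::
    "('a, 'e::euclidean_space) atlas \<Rightarrow> ('a, 'e) metric \<Rightarrow> 'a \<Rightarrow> 'a \<Rightarrow> ennreal" where
  "geodesic_dist N g y y' =
     (INF \<gamma> \<in> {\<gamma>. piecewise_C1_curve N \<gamma> \<and> \<gamma> 0 = y \<and> \<gamma> 1 = y'}. curve_length N g \<gamma>)"

definition geodesic :: "('a, 'e::euclidean_space) atlas \<Rightarrow> ('a, 'e) metric \<Rightarrow> (real \<Rightarrow> 'a) \<Rightarrow> bool" where
  "geodesic N g \<gamma> \<longleftrightarrow>
     continuous_map euclideanreal (mtopology N) \<gamma> \<and>
     (\<forall>c\<in>N. smooth_on (snd c \<circ> \<gamma>) {t. \<gamma> t \<in> fst c} \<and>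
        (\<forall>t. \<gamma> t \<in> fst c \<longrightarrow>
           vector_derivative (\<lambda>s. vector_derivative (snd c \<circ> \<gamma>) (at s)) (at t)
           + levi_civita_form N g c (snd c (\<gamma> t))
               (vector_derivative (snd c \<circ> \<gamma>) (at t)) (vector_derivative (snd c \<circ> \<gamma>) (at t)) = 0))"

definition nontrivial_bounded_geodesic ::
    "('a, 'e::euclidean_space) atlas \<Rightarrow> ('a, 'e) metric \<Rightarrow> (real \<Rightarrow> 'a) \<Rightarrow> bool" where
  "nontrivial_bounded_geodesic N g \<gamma> \<longleftrightarrow>
     geodesic N g \<gamma> \<and> (\<exists>s t. \<gamma> s \<noteq> \<gamma> t) \<and>
     (\<exists>C::real. \<forall>s t. geodesic_dist N g (\<gamma> s) (\<gamma> t) \<le> ennreal C)"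


section \<open>The bundle \<open>T\<^sup>*M \<otimes> TN\<close>\<close>

text \<open>From here on \<open>M\<close> is an open subset \<open>\<Omega>\<close> of \<open>\<real>\<^sup>m\<close> with the Euclidean metric, with
  \<open>T\<^sub>xM = \<real>\<^sup>m\<close>. The fibre of the bundle over \<open>(x, y)\<close> is \<open>\<L>(\<real>\<^sup>m, T\<^sub>yN)\<close>. A chart \<open>c\<close> of \<open>N\<close>
  induces a bundle chart, in which \<open>\<xi>\<close> is represented by the tuple of the coordinates of
  \<open>\<xi>[e\<^sub>1], \<dots>, \<xi>[e\<^sub>m]\<close>.\<close>

definition tangent_hom ::
    "('a, 'e::euclidean_space) atlas \<Rightarrow> 'a \<Rightarrow> (real^'m \<Rightarrow> ('a, 'e) tangent) set" where
  "tangent_hom N y =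
     {\<xi>. (\<forall>h. \<xi> h \<in> tangent_space N y) \<and> (\<forall>c\<in>charts_at N y. linear (\<lambda>h. \<xi> h c))}"

type_synonym ('m, 'a, 'e) hom_point = "(real^'m) \<times> 'a \<times> (real^'m \<Rightarrow> ('a, 'e) tangent)"
type_synonym ('m, 'e) hom_model = "(real^'m) \<times> 'e \<times> ('e^'m)"

definition hom_chart :: "(real^'m) set \<Rightarrow> ('a, 'e::euclidean_space) atlas \<Rightarrow> ('a, 'e) chart \<Rightarrow>
    (('m, 'a, 'e) hom_point, ('m, 'e) hom_model) chart" where
  "hom_chart \<Omega> N c =
     ({(x, y, \<xi>). x \<in> \<Omega> \<and> y \<in> fst c \<and> \<xi> \<in> tangent_hom N y},
      \<lambda>(x, y, \<xi>). (x, snd c y, \<chi> i. \<xi> (axis i 1) c))"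

definition hom_bundle :: "(real^'m) set \<Rightarrow> ('a, 'e::euclidean_space) atlas \<Rightarrow>
    (('m, 'a, 'e) hom_point, ('m, 'e) hom_model) atlas" where
  "hom_bundle \<Omega> N = hom_chart \<Omega> N ` N"

text \<open>The connection map \<open>K\<close> at the point \<open>(x, y, \<xi>)\<close> of the bundle. In a bundle chart, a tangent
  vector \<open>\<zeta>\<close> with coordinates \<open>(x', y', \<xi>')\<close> is mapped to \<open>k \<mapsto> \<xi>'[k] + \<Gamma>(y', \<xi>[k])\<close>, that is, the
  covariant derivative of a section along a curve with velocity \<open>\<zeta>\<close>. The further term
  \<open>- \<xi>[\<Gamma>\<^sub>M(x', k)]\<close> vanishes as \<open>M\<close> is flat.\<close>

definition connection_map :: "(real^'m) set \<Rightarrow> ('a, 'e::euclidean_space) atlas \<Rightarrow> ('a, 'e) metric \<Rightarrow>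
    ('m, 'a, 'e) hom_point \<Rightarrow> (('m, 'a, 'e) hom_point, ('m, 'e) hom_model) tangent \<Rightarrow>
    real^'m \<Rightarrow> ('a, 'e) tangent" where
  "connection_map \<Omega> N g = (\<lambda>(x, y, \<xi>) \<zeta> k c.
     if c \<in> charts_at N y
     then (case \<zeta> (hom_chart \<Omega> N c) of (x', y', \<xi>') \<Rightarrow>
             (\<Sum>i\<in>UNIV. (k $ i) *\<^sub>R (\<xi>' $ i)) + levi_civita_form N g c (snd c y) y' (\<xi> k c))
     else 0)"

definition hom_norm ::
    "('a, 'e) metric \<Rightarrow> 'a \<Rightarrow> (real^'m \<Rightarrow> ('a, 'e) tangent) \<Rightarrow> real" where
  "hom_norm g y \<xi> = sqrt (\<Sum>e\<in>Basis. g y (\<xi> e) (\<xi> e))"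

definition bihom_norm ::
    "('a, 'e) metric \<Rightarrow> 'a \<Rightarrow> (real^'m \<Rightarrow> real^'m \<Rightarrow> ('a, 'e) tangent) \<Rightarrow> real" where
  "bihom_norm g y \<zeta> = sqrt (\<Sum>e\<in>Basis. \<Sum>e'\<in>Basis. g y (\<zeta> e e') (\<zeta> e e'))"


section \<open>Colocal weak differentiability\<close>

definition locally_integrable_on :: "('b::euclidean_space) set \<Rightarrow> ('b \<Rightarrow> real) \<Rightarrow> bool" where
  "locally_integrable_on \<Omega> h \<longleftrightarrow> (\<forall>K. compact K \<and> K \<subseteq> \<Omega> \<longrightarrow> set_integrable lebesgue K h)"

definition test_function :: "('b::euclidean_space) set \<Rightarrow> ('b \<Rightarrow> real) \<Rightarrow> bool" where
  "test_function \<Omega> \<phi> \<longleftrightarrow>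
     smooth_on \<phi> UNIV \<and> (\<exists>K. compact K \<and> K \<subseteq> \<Omega> \<and> (\<forall>x. x \<notin> K \<longrightarrow> \<phi> x = 0))"

definition has_weak_derivative ::
    "('b::euclidean_space) set \<Rightarrow> ('b \<Rightarrow> real) \<Rightarrow> ('b \<Rightarrow> 'b \<Rightarrow> real) \<Rightarrow> bool" where
  "has_weak_derivative \<Omega> h D \<longleftrightarrow>
     locally_integrable_on \<Omega> h \<and> (\<forall>x\<in>\<Omega>. linear (D x)) \<and>
     (\<forall>v. locally_integrable_on \<Omega> (\<lambda>x. D x v)) \<and>
     (\<forall>\<phi> v. test_function \<Omega> \<phi> \<longrightarrow>
        (LINT x:\<Omega>|lebesgue. h x * frechet_derivative \<phi> (at x) v)
        = - (LINT x:\<Omega>|lebesgue. D x v * \<phi> x))"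

definition weakly_differentiable :: "('b::euclidean_space) set \<Rightarrow> ('b \<Rightarrow> real) \<Rightarrow> bool" where
  "weakly_differentiable \<Omega> h \<longleftrightarrow> (\<exists>D. has_weak_derivative \<Omega> h D)"

definition measurable_into ::
    "('b::euclidean_space) set \<Rightarrow> ('a, 'e::euclidean_space) atlas \<Rightarrow> ('b \<Rightarrow> 'a) \<Rightarrow> bool" where
  "measurable_into \<Omega> N u \<longleftrightarrow>
     (\<forall>x\<in>\<Omega>. u x \<in> mcarrier N) \<and>
     (\<forall>W. openin (mtopology N) W \<longrightarrow> {x \<in> \<Omega>. u x \<in> W} \<in> sets lebesgue)"

definition colocally_weakly_differentiable ::
    "('b::euclidean_space) set \<Rightarrow> ('a, 'e::euclidean_space) atlas \<Rightarrow> ('b \<Rightarrow> 'a) \<Rightarrow> bool" where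
  "colocally_weakly_differentiable \<Omega> N u \<longleftrightarrow>
     measurable_into \<Omega> N u \<and> (\<forall>f. C1_compact_support N f \<longrightarrow> weakly_differentiable \<Omega> (f \<circ> u))"

text \<open>\<open>T\<close> as a measurable section of \<open>T\<^sup>*M \<otimes> TN\<close> along \<open>u\<close>.\<close>

definition hom_lift :: "(real^'m \<Rightarrow> 'a) \<Rightarrow> (real^'m \<Rightarrow> real^'m \<Rightarrow> ('a, 'e) tangent) \<Rightarrow>
    real^'m \<Rightarrow> ('m, 'a, 'e) hom_point" where
  "hom_lift u T x = (x, u x, T x)"

text \<open>The colocal weak derivative is determined only up to sets of measure zero, hence a relation.
  Membership of \<open>hom_lift u T x\<close> in the bundle makes \<open>T x\<close> a linear map \<open>\<real>\<^sup>m \<rightarrow> T\<^bsub>u(x)\<^esub>N\<close>.\<close>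

definition is_colocal_weak_derivative :: "(real^'m) set \<Rightarrow> ('a, 'e::euclidean_space) atlas \<Rightarrow>
    (real^'m \<Rightarrow> 'a) \<Rightarrow> (real^'m \<Rightarrow> real^'m \<Rightarrow> ('a, 'e) tangent) \<Rightarrow> bool" where
  "is_colocal_weak_derivative \<Omega> N u T \<longleftrightarrow>
     measurable_into \<Omega> (hom_bundle \<Omega> N) (hom_lift u T) \<and>
     (\<forall>f. C1_compact_support N f \<longrightarrow>
        has_weak_derivative \<Omega> (f \<circ> u) (\<lambda>x v. mdifferential N f (u x) (T x v)))"


section \<open>Second-order Sobolev space and essentially bounded maps\<close>

text \<open>\<open>D_K \<Omega> N g u T T2 x h k\<close> is \<open>D\<^sub>K(Tu)(x)[h, k]\<close> for \<open>T = Tu\<close> and \<open>T2 = T\<^sup>2u\<close>.\<close>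

definition D_K :: "(real^'m) set \<Rightarrow> ('a, 'e::euclidean_space) atlas \<Rightarrow> ('a, 'e) metric \<Rightarrow>
    (real^'m \<Rightarrow> 'a) \<Rightarrow> (real^'m \<Rightarrow> real^'m \<Rightarrow> ('a, 'e) tangent) \<Rightarrow>
    (real^'m \<Rightarrow> real^'m \<Rightarrow> (('m, 'a, 'e) hom_point, ('m, 'e) hom_model) tangent) \<Rightarrow>
    real^'m \<Rightarrow> real^'m \<Rightarrow> real^'m \<Rightarrow> ('a, 'e) tangent" where
  "D_K \<Omega> N g u T T2 x h k = connection_map \<Omega> N g (hom_lift u T x) (T2 x h) k"

definition W2_dot :: "real \<Rightarrow> (real^'m) set \<Rightarrow> ('a, 'e::euclidean_space) atlas \<Rightarrow> ('a, 'e) metric \<Rightarrow>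
    (real^'m \<Rightarrow> 'a) set" where
  "W2_dot p \<Omega> N g = {u.
     colocally_weakly_differentiable \<Omega> N u \<and>
     (\<exists>T T2. is_colocal_weak_derivative \<Omega> N u T \<and>
        colocally_weakly_differentiable \<Omega> (hom_bundle \<Omega> N) (hom_lift u T) \<and>
        is_colocal_weak_derivative \<Omega> (hom_bundle \<Omega> N) (hom_lift u T) T2 \<and>
        integrable (lebesgue_on \<Omega>)
          (\<lambda>x. bihom_norm g (u x) (D_K \<Omega> N g u T T2 x) powr p))}"

definition L_infinity :: "(real^'m) set \<Rightarrow> ('a, 'e::euclidean_space) atlas \<Rightarrow> ('a, 'e) metric \<Rightarrow>
    (real^'m \<Rightarrow> 'a) set" where
  "L_infinity \<Omega> N g = {u. measurable_into \<Omega> N u \<and>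
     (\<exists>C::real. AE z in lebesgue. z \<in> \<Omega> \<times> \<Omega> \<longrightarrow>
        geodesic_dist N g (u (fst z)) (u (snd z)) \<le> ennreal C)}"


section \<open>The implicit definitions are meaningful\<close>

lemma (in smooth_manifold) openin_mtopology:
  "openin (mtopology N) W \<longleftrightarrow> W \<subseteq> mcarrier N \<and> (\<forall>c\<in>N. open (snd c ` (fst c \<inter> W)))"
proof -
  have inter: "snd c ` (fst c \<inter> (A \<inter> B)) = snd c ` (fst c \<inter> A) \<inter> snd c ` (fst c \<inter> B)"
    if "c \<in> N" for c A B
    using chart_inj[OF that] unfolding inj_on_def by blast
  have union: "snd c ` (fst c \<inter> \<Union>\<K>) = (\<Union>A\<in>\<K>. snd c ` (fst c \<inter> A))" for c :: "('a, 'e) chart" and \<K>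
    by blast
  have "istopology (\<lambda>W. W \<subseteq> mcarrier N \<and> (\<forall>c\<in>N. open (snd c ` (fst c \<inter> W))))"
    unfolding istopology_def
  proof (intro conjI allI impI, goal_cases)
    case (2 A B) then show ?case by (metis inter open_Int)
  next
    case (4 \<K>) then show ?case by (auto simp: union intro!: open_UN)
  qed auto
  then show ?thesis by (simp add: mtopology_def topology_inverse')
qed

lemma (in riemannian_manifold) ex1_levi_civita_form:
  assumes c: "c \<in> N" and z: "z \<in> chart_image c"
  shows "\<exists>!\<Gamma>. is_levi_civita_form N g c z \<Gamma>"
proof -
  define G where "G = local_metric N g c z"
  define A where "A w v v' = frechet_derivative (\<lambda>z. local_metric N g c z v v') (at z) w" for w v v'
  have bil: "bilinear G" unfolding G_def by (rule metric_bilinear[OF c z])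
  have sym: "G v w = G w v" for v w unfolding G_def by (rule metric_symmetric[OF c z])
  note G_simps = bilinear_ladd[OF bil] bilinear_radd[OF bil] bilinear_lmul[OF bil]
    bilinear_rmul[OF bil] bilinear_lsub[OF bil] bilinear_rsub[OF bil]
  have nondeg: "w = w'" if "\<And>v. G w v = G w' v" for w w'
  proof (rule ccontr)
    assume "w \<noteq> w'"
    then have "0 < G (w - w') (w - w')"
      unfolding G_def using metric_positive[OF c z] by simp
    then show False using that by (simp add: G_simps)
  qed
  have diff: "(\<lambda>z. local_metric N g c z v v') differentiable (at z)" for v v'
    using metric_smooth[OF c, of v v'] z unfolding smooth_on_def by (metis Ck_on.simps(2))
  have der: "((\<lambda>z. local_metric N g c z v v') has_derivative (\<lambda>w. A w v v')) (at z)" for v v'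
    using diff[of v v'] unfolding A_def by (simp add: frechet_derivative_works[symmetric] eta_contract_eq)
  have lin1: "linear (\<lambda>w. A w v v')" for v v'
    using der by (rule has_derivative_linear)
  have eqA: "A w v v' = F w"
    if "\<And>x. x \<in> chart_image c \<Longrightarrow> f x = local_metric N g c x v v'"
       "(f has_derivative F) (at z)" for f F v v' w
  proof -
    have "((\<lambda>z. local_metric N g c z v v') has_derivative F) (at z)"
      by (rule has_derivative_transform_within_open[OF that(2) chart_open[OF c] z that(1)])
    then show ?thesis using has_derivative_unique[OF der] by metis
  qed
  have A_sym: "A w v v' = A w v' v" for w v v'
    by (rule eqA[OF _ der]) (rule metric_symmetric[OF c])
  have A_add: "A w (v1 + v2) v' = A w v1 v' + A w v2 v'" for w v1 v2 v'
    by (rule eqA[OF _ has_derivative_add[OF der der]])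
      (simp add: bilinear_ladd[OF metric_bilinear[OF c]])
  have A_scale: "A w (r *\<^sub>R v1) v' = r * A w v1 v'" for w v1 r v'
    by (rule eqA[OF _ has_derivative_mult_right[OF der]])
      (simp add: bilinear_lmul[OF metric_bilinear[OF c]])
  have A_add': "A w v' (v1 + v2) = A w v' v1 + A w v' v2" for w v1 v2 v'
    using A_add A_sym by metis
  have A_scale': "A w v' (r *\<^sub>R v1) = r * A w v' v1" for w v1 r v'
    using A_scale A_sym by metis
  note A_simps = linear_add[OF lin1] linear_scale[OF lin1] A_add A_scale A_add' A_scale'
  have riesz: "\<exists>w. \<forall>v. G w v = L v" if L: "linear L" for L
  proof -
    define T where "T w = (\<Sum>b\<in>Basis. G w b *\<^sub>R b)" for w
    have linG: "linear (G w)" for w using bil unfolding bilinear_def by blast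
    have T_inner: "T w \<bullet> v = G w v" for w v
    proof -
      have "G w v = G w (\<Sum>b\<in>Basis. (v \<bullet> b) *\<^sub>R b)" by (simp add: euclidean_representation)
      also have "\<dots> = (\<Sum>b\<in>Basis. (v \<bullet> b) * G w b)"
        by (simp add: linear_sum[OF linG] linear_scale[OF linG])
      finally show ?thesis
        unfolding T_def inner_sum_left inner_scaleR_left by (simp add: inner_commute mult.commute)
    qed
    have linT: "linear T"
      unfolding T_def by (rule linearI) (simp_all add: G_simps algebra_simps sum.distrib scaleR_sum_right)
    have "inj T"
      by (rule injI, rule nondeg) (metis T_inner)
    then have "surj T" using linear_injective_imp_surjective[OF linT] by blast
    then obtain w where w: "T w = (\<Sum>b\<in>Basis. L b *\<^sub>R b)" by (metis surjD)
    have "G w v = L v" for v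
    proof -
      have "L v = L (\<Sum>b\<in>Basis. (v \<bullet> b) *\<^sub>R b)" by (simp add: euclidean_representation)
      also have "\<dots> = (\<Sum>b\<in>Basis. (v \<bullet> b) * L b)" by (simp add: linear_sum[OF L] linear_scale[OF L])
      also have "\<dots> = T w \<bullet> v" 
        unfolding w inner_sum_left inner_scaleR_left by (simp add: inner_commute mult.commute)
      finally show ?thesis by (simp add: T_inner)
    qed
    then show ?thesis by blast
  qed
  have lc: "is_levi_civita_form N g c z \<Gamma> \<longleftrightarrow> bilinear \<Gamma> \<and> (\<forall>v w. \<Gamma> v w = \<Gamma> w v) \<and>
      (\<forall>w v v'. A w v v' = G (\<Gamma> w v) v' + G v (\<Gamma> w v'))" for \<Gamma>
    unfolding is_levi_civita_form_def A_def G_def by simp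
  have "\<exists>w. \<forall>v'. G w v' = (A v w0 v' + A w0 v v' - A v' v w0) / 2" for v w0
    by (rule riesz, rule linearI) (simp_all add: A_simps field_simps)
  then obtain \<Gamma> where \<Gamma>: "G (\<Gamma> v w) v' = (A v w v' + A w v v' - A v' v w) / 2" for v w v'
    by metis
  have "is_levi_civita_form N g c z \<Gamma>"
    unfolding lc
  proof (intro conjI allI)
    show "bilinear \<Gamma>" unfolding bilinear_def
      by (intro conjI allI linearI; rule nondeg)
        (simp_all add: \<Gamma> G_simps A_simps field_simps)
    show "\<Gamma> v w = \<Gamma> w v" for v w
      by (rule nondeg) (simp add: \<Gamma> A_sym[of _ v w])
    show "A w v v' = G (\<Gamma> w v) v' + G v (\<Gamma> w v')" for w v v'
      by (simp add: sym[of v] \<Gamma> A_sym[of _ v' v] A_sym[of _ w v] A_sym[of _ w v'] field_simps)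
  qed
  moreover have "\<Delta> = \<Gamma>" if "is_levi_civita_form N g c z \<Delta>" for \<Delta>
  proof (intro ext nondeg)
    fix v w v'
    have \<Delta>: "\<And>v w. \<Delta> v w = \<Delta> w v" "\<And>w v v'. A w v v' = G (\<Delta> w v) v' + G v (\<Delta> w v')"
      using that unfolding lc by auto
    show "G (\<Delta> v w) v' = G (\<Gamma> v w) v'"
      unfolding \<Gamma> \<Delta>(2) using sym \<Delta>(1)[of v w] \<Delta>(1)[of v v'] \<Delta>(1)[of w v'] by (simp add: sym)
  qed
  ultimately show ?thesis by blast
qed

end

theory Submission
  imports Defs
begin

text \<open>Let \<open>\<gamma>\<close> be a nontrivial bounded geodesic and take \<open>u(x) = \<gamma>(\<bar>x\<bar>^(-\<alpha>))\<close> with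
  \<open>\<alpha> = m/(2p) - 1 > 0\<close>. As \<open>\<gamma>\<close> is a geodesic, of constant speed \<open>s > 0\<close>,
  \<open>\<bar>Tu\<bar> = s \<alpha> \<bar>x\<bar>^(-\<alpha>-1)\<close> and \<open>D\<^sub>K(Tu) = D\<^sup>2(\<bar>x\<bar>^(-\<alpha>)) \<otimes> \<gamma>'\<close>. Thus \<open>\<bar>Tu\<bar>^(2p)\<close> is a
  multiple of \<open>\<bar>x\<bar>^(-m)\<close>, which is not integrable, while \<open>\<bar>D\<^sub>K(Tu)\<bar>^p\<close> is a multiple of
  \<open>\<bar>x\<bar>^(-m/2-p)\<close>, which is integrable since \<open>2p < m\<close>. For \<open>f \<in> C\<^sup>1\<^sub>c(N)\<close> the weak derivative of
  \<open>f \<circ> u\<close> is obtained by dominated convergence from the smooth maps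
  \<open>x \<mapsto> \<gamma>((\<bar>x\<bar>\<^sup>2 + \<epsilon>\<^sup>2)^(-\<alpha>/2))\<close>. A compactly supported \<open>C\<^sup>1\<close> function on the bundle vanishes
  at \<open>Tu(x)\<close> for small \<open>x \<noteq> 0\<close>, because \<open>\<bar>Tu\<bar>\<close> tends to infinity at the origin; its composition with \<open>Tu\<close>
  is therefore of class \<open>C\<^sup>1\<close> after changing the value at the origin.\<close>

section \<open>Weak derivatives\<close>

text \<open>The obstacle is the quadratic term of the second derivative. With \<rho> =
  |x|^(-\<alpha>), the chart expression of the derivative of \<open>Tu\<close> contains the square
  of d\<rho> times \<gamma>''. The p-th power of that term has size |x|^(-2p(\<alpha>+1)), just as
  singular as |Tu|^(2p), so it must cancel in \<open>D_K\<close>. This is what the geodesic equation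
  achieves: \<gamma>'' is minus the Christoffel term which the connection map adds. The exponent
  makes 2p(\<alpha>+1) = m critical, while p(\<alpha>+2) = m/2 + p stays below m. It also gives
  \<alpha> + 1 = m/(2p) < m, so the gradient of \<rho> is locally integrable and the weak derivative
  of \<open>f o u\<close> has no part concentrated at the origin. As \<open>u\<close> need not have
  a limit at the origin, \<open>f o u\<close> cannot be treated as a C^1 map there. The limit
  passage needs a bound on the derivative of \<open>f o \<gamma>\<close> for all times. It comes
  from the constant speed and from the compact support of \<open>f\<close>, which bounds df in terms
  of the metric; the image of \<gamma> is bounded but need not be relatively compact.\<close>

lemma lborel_integral_translation:
  fixes f :: "'b::euclidean_space \<Rightarrow> real"
  assumes "f \<in> borel_measurable borel"
  shows "integrable lborel (\<lambda>x. f (x + a)) \<longleftrightarrow> integrable lborel f"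
    and "(LINT x|lborel. f (x + a)) = (LINT x|lborel. f x)"
proof -
  have "(\<lambda>x. x + a) = (+) a" by (auto simp: add.commute)
  then have *: "distr lborel borel (\<lambda>x. x + a) = (lborel :: 'b measure)"
    using lborel_distr_plus[of a] by simp
  show "integrable lborel (\<lambda>x. f (x + a)) \<longleftrightarrow> integrable lborel f"
    using integrable_distr_eq[of "\<lambda>x. x + a" lborel borel f] assms unfolding * by simp
  show "(LINT x|lborel. f (x + a)) = (LINT x|lborel. f x)"
    using integral_distr[of "\<lambda>x. x + a" lborel borel f] assms unfolding * by simp
qed

lemma has_derivative_imp_DERIV_line:
  fixes k :: "'b::real_normed_vector \<Rightarrow> real"
  assumes "(k has_derivative k') (at (x + t *\<^sub>R v))"
  shows "((\<lambda>s. k (x + s *\<^sub>R v)) has_real_derivative k' v) (at t)"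
proof -
  have "((\<lambda>s. x + s *\<^sub>R v) has_derivative (\<lambda>s. s *\<^sub>R v)) (at t)"
    by (auto intro!: derivative_eq_intros)
  from has_derivative_compose[OF this, of k k'] assms
  have "((\<lambda>s. k (x + s *\<^sub>R v)) has_derivative (\<lambda>s. k' (s *\<^sub>R v))) (at t)" by simp
  moreover have "k' (s *\<^sub>R v) = s * k' v" for s
    using has_derivative_linear[OF assms] by (simp add: linear_scale)
  moreover have "(*) (k' v) = (\<lambda>s. s * k' v)" by auto
  ultimately show ?thesis by (simp add: has_field_derivative_def)
qed

lemma has_derivative_0D:
  fixes F :: "'b::real_normed_vector \<Rightarrow> real"
  shows "((\<lambda>_. 0) has_derivative F) (at x) \<Longrightarrow> F v = 0"
  using has_derivative_unique[OF _ has_derivative_const] by metis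

text \<open>The integrals of the difference quotients vanish by translation invariance.\<close>

lemma integral_directional_derivative_eq_0:
  fixes k :: "'b::euclidean_space \<Rightarrow> real"
  assumes der: "\<And>x. (k has_derivative k' x) (at x)"
    and cont: "continuous_on UNIV (\<lambda>x. k' x v)"
    and K: "compact K" "\<And>x. x \<notin> K \<Longrightarrow> k x = 0"
  shows "(LINT x|lborel. k' x v) = 0"
proof -
  obtain R where R: "R > 0" "\<And>x. x \<in> K \<Longrightarrow> norm x < R"
    using compact_imp_bounded[OF K(1)] by (metis bounded_pos_less)
  have out: "k x = 0" if "norm x \<ge> R" for x
    using R(2)[of x] K(2)[of x] that by force
  have k'_out: "k' x v = 0" if "x \<notin> K" for x
  proof -
    have "((\<lambda>_. 0) has_derivative k' x) (at x)"
      by (rule has_derivative_transform_within_open[OF der, where s="- K"])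
        (use K that in \<open>auto intro: compact_imp_closed\<close>)
    then show ?thesis by (rule has_derivative_0D)
  qed
  have "compact ((\<lambda>x. k' x v) ` K)"
    by (intro compact_continuous_image continuous_on_subset[OF cont] K(1)) auto
  then obtain M where M: "M > 0" "\<And>x. x \<in> K \<Longrightarrow> \<bar>k' x v\<bar> \<le> M"
    by (force dest!: compact_imp_bounded simp: bounded_pos)
  have Mall: "\<bar>k' x v\<bar> \<le> M" for x using M k'_out[of x] by (cases "x \<in> K") auto
  have kcont: "continuous_on UNIV k"
    by (rule has_derivative_continuous_on[OF has_derivative_at_withinI[OF der]])
  have kmeas [measurable]: "k \<in> borel_measurable borel"
    using kcont by (rule borel_measurable_continuous_onI)
  have [measurable]: "(\<lambda>x. k' x v) \<in> borel_measurable borel"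
    using cont by (rule borel_measurable_continuous_onI)
  have "integrable lborel (\<lambda>x. indicator K x *\<^sub>R k x)"
    by (rule borel_integrable_compact[OF K(1) continuous_on_subset[OF kcont]]) simp
  moreover have "(\<lambda>x. indicator K x *\<^sub>R k x) = k"
    by (rule ext) (use K(2) in \<open>auto simp: indicator_def\<close>)
  ultimately have kint: "integrable lborel k" by simp
  define e :: "nat \<Rightarrow> real" where "e n = 1 / Suc n" for n
  define q where "q n x = (k (x + e n *\<^sub>R v) - k x) / e n" for n x
  have e: "0 < e n" "e n \<le> 1" for n by (auto simp: e_def)
  have e0: "e \<longlonglongrightarrow> 0" unfolding e_def by (rule LIMSEQ_Suc[OF lim_1_over_n])
  have qint: "(LINT x|lborel. q n x) = 0" for n
  proof -
    have "(LINT x|lborel. q n x) = ((LINT x|lborel. k (x + e n *\<^sub>R v)) - (LINT x|lborel. k x)) / e n"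
      unfolding q_def using kint lborel_integral_translation(1)[OF kmeas] by simp
    then show ?thesis using lborel_integral_translation(2)[OF kmeas] by simp
  qed
  have "(\<lambda>n. LINT x|lborel. q n x) \<longlonglongrightarrow> (LINT x|lborel. k' x v)"
  \<comment> \<open>Quotients with steps at most 1 vanish outside the ball of radius
    \<open>R + norm v\<close>; inside it the mean value theorem bounds them by \<open>M\<close>.
    Hence the majorant.\<close>
  proof (rule integral_dominated_convergence[where w="\<lambda>x. indicator (cball 0 (R + norm v)) x *\<^sub>R M"])
    show "integrable lborel (\<lambda>x::'b. indicator (cball 0 (R + norm v)) x *\<^sub>R M)"
      by (rule borel_integrable_compact) auto
    show "AE x in lborel. (\<lambda>n. q n x) \<longlonglongrightarrow> k' x v"
    proof (rule AE_I2)
      fix x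
      have "((\<lambda>s. k (x + s *\<^sub>R v)) has_real_derivative k' x v) (at 0)"
        by (rule has_derivative_imp_DERIV_line) (simp add: der)
      then have "((\<lambda>h. (k (x + (0 + h) *\<^sub>R v) - k (x + 0 *\<^sub>R v)) / h) \<longlongrightarrow> k' x v) (at 0)"
        unfolding DERIV_def .
      then have "((\<lambda>h. (k (x + h *\<^sub>R v) - k x) / h) \<longlongrightarrow> k' x v) (at 0)" by simp
      moreover have "filterlim e (at 0) sequentially"
        using e0 e(1) by (simp add: filterlim_at less_imp_neq[symmetric])
      ultimately show "(\<lambda>n. q n x) \<longlonglongrightarrow> k' x v"
        unfolding q_def by (rule filterlim_compose)
    qed
    show "AE x in lborel. norm (q n x) \<le> indicator (cball 0 (R + norm v)) x *\<^sub>R M" for n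
    proof (rule AE_I2)
      fix x
      show "norm (q n x) \<le> indicator (cball 0 (R + norm v)) x *\<^sub>R M"
      proof (cases "norm x \<le> R + norm v")
        case True
        have "\<exists>z. 0 < z \<and> z < e n \<and> k (x + e n *\<^sub>R v) - k (x + 0 *\<^sub>R v) = (e n - 0) * k' (x + z *\<^sub>R v) v"
          by (rule MVT2[OF e(1)]) (rule has_derivative_imp_DERIV_line[OF der])
        then obtain z where "k (x + e n *\<^sub>R v) - k (x + 0 *\<^sub>R v) = (e n - 0) * k' (x + z *\<^sub>R v) v"
          by blast
        then have "q n x = k' (x + z *\<^sub>R v) v" using e(1)[of n] by (simp add: q_def)
        then show ?thesis using True Mall by (simp add: indicator_def)
      next
        case False
        have "norm x - norm (e n *\<^sub>R v) \<le> norm (x + e n *\<^sub>R v)"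
          by (rule norm_diff_ineq)
        moreover have "norm (e n *\<^sub>R v) \<le> norm v"
          using e(1,2)[of n] by (simp add: mult_left_le_one_le)
        ultimately have "k (x + e n *\<^sub>R v) = 0" "k x = 0"
          using False norm_ge_zero[of v] by (auto intro!: out simp del: norm_ge_zero)
        then show ?thesis using False by (simp add: q_def)
      qed
    qed
    show "(q n) \<in> borel_measurable lborel" for n unfolding q_def by measurable
  qed simp
  then show ?thesis unfolding qint using LIMSEQ_unique tendsto_const by blast
qed

lemma set_integrable_lebesgue_compact:
  fixes f :: "'b::euclidean_space \<Rightarrow> real"
  assumes "compact K" "continuous_on K f"
  shows "set_integrable lebesgue K f"
proof -
  have "integrable lborel (\<lambda>x. indicator K x *\<^sub>R f x)"
    by (rule borel_integrable_compact[OF assms])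
  then show ?thesis unfolding set_integrable_def
    using integrable_completion[of "\<lambda>x. indicator K x *\<^sub>R f x" lborel] by auto
qed

lemma continuous_on_imp_locally_integrable:
  "continuous_on \<Omega> f \<Longrightarrow> locally_integrable_on \<Omega> f"
  unfolding locally_integrable_on_def
  by (auto intro!: set_integrable_lebesgue_compact intro: continuous_on_subset)

lemma test_functionE:
  assumes "test_function \<Omega> \<phi>"
  obtains K where "compact K" "K \<subseteq> \<Omega>" "\<And>x. x \<notin> K \<Longrightarrow> \<phi> x = 0"
    "\<And>x. (\<phi> has_derivative frechet_derivative \<phi> (at x)) (at x)"
    "\<And>v. continuous_on UNIV (\<lambda>x. frechet_derivative \<phi> (at x) v)"
    "\<And>x v. x \<notin> K \<Longrightarrow> frechet_derivative \<phi> (at x) v = 0"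
    "continuous_on UNIV \<phi>"
proof -
  obtain K where K: "compact K" "K \<subseteq> \<Omega>" "\<And>x. x \<notin> K \<Longrightarrow> \<phi> x = 0" and sm: "smooth_on \<phi> UNIV"
    using assms unfolding test_function_def by blast
  have "Ck_on (Suc 0) \<phi> UNIV" using sm unfolding smooth_on_def by blast
  then have d: "\<And>x. (\<phi> has_derivative frechet_derivative \<phi> (at x)) (at x)"
    "\<And>v. continuous_on UNIV (\<lambda>x. frechet_derivative \<phi> (at x) v)"
    by (auto simp: frechet_derivative_works[symmetric])
  have z: "frechet_derivative \<phi> (at x) v = 0" if "x \<notin> K" for x v
  proof -
    have "((\<lambda>_. 0) has_derivative frechet_derivative \<phi> (at x)) (at x)"
      by (rule has_derivative_transform_within_open[OF d(1), where s="- K"])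
        (use K that in \<open>auto intro: compact_imp_closed\<close>)
    then show ?thesis by (rule has_derivative_0D)
  qed
  have "continuous_on UNIV \<phi>"
    using sm unfolding smooth_on_def by (metis Ck_on.simps(1))
  with that K d z show thesis by blast
qed

text \<open>Integration by parts: the product of \<open>h\<close> and a test function, extended by
  zero, is C^1 with compact support in the whole space, so the integral of its directional
  derivative vanishes. The two summands of the product rule give the two sides of the
  identity.\<close>

lemma C1_has_weak_derivative:
  fixes h :: "'b::euclidean_space \<Rightarrow> real"
  assumes \<Omega>: "open \<Omega>" and der: "\<And>x. x \<in> \<Omega> \<Longrightarrow> (h has_derivative D x) (at x)"
    and cont: "\<And>v. continuous_on \<Omega> (\<lambda>x. D x v)"
  shows "has_weak_derivative \<Omega> h D"
  unfolding has_weak_derivative_def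
proof (intro conjI allI impI ballI)
  have hcont: "continuous_on \<Omega> h"
    by (rule has_derivative_continuous_on[OF has_derivative_at_withinI[OF der]])
  then show "locally_integrable_on \<Omega> h" by (rule continuous_on_imp_locally_integrable)
  show "linear (D x)" if "x \<in> \<Omega>" for x using der[OF that] by (rule has_derivative_linear)
  show "locally_integrable_on \<Omega> (\<lambda>x. D x v)" for v
    by (rule continuous_on_imp_locally_integrable[OF cont])
  fix \<phi> v assume "test_function \<Omega> \<phi>"
  then obtain K where K: "compact K" "K \<subseteq> \<Omega>" "\<And>x. x \<notin> K \<Longrightarrow> \<phi> x = 0"
    and d: "\<And>x. (\<phi> has_derivative frechet_derivative \<phi> (at x)) (at x)"
    and dc: "\<And>v. continuous_on UNIV (\<lambda>x. frechet_derivative \<phi> (at x) v)"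
    and dz: "\<And>x v. x \<notin> K \<Longrightarrow> frechet_derivative \<phi> (at x) v = 0"
    and pc: "continuous_on UNIV \<phi>"
    by (rule test_functionE) blast
  let ?d = "\<lambda>x. frechet_derivative \<phi> (at x)"
  define k where "k x = (if x \<in> \<Omega> then h x * \<phi> x else 0)" for x
  define k' where "k' x w = (if x \<in> \<Omega> then h x * ?d x w + D x w * \<phi> x else 0)" for x w
  have kder: "(k has_derivative k' x) (at x)" for x
  proof (cases "x \<in> \<Omega>")
    case True
    have "((\<lambda>x. h x * \<phi> x) has_derivative k' x) (at x)"
      using has_derivative_mult[OF der[OF True] d[of x]] True unfolding k'_def by simp
    then show ?thesis
      by (rule has_derivative_transform_within_open[OF _ \<Omega> True]) (simp add: k_def)
  next
    case False
    have "((\<lambda>_. 0) has_derivative k' x) (at x)" using False by (simp add: k'_def[abs_def])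
    then show ?thesis
      by (rule has_derivative_transform_within_open[where s="- K"])
        (use K False in \<open>auto intro: compact_imp_closed simp: k_def\<close>)
  qed
  \<comment> \<open>\<open>\<Omega>\<close> and \<open>- K\<close> are open and cover the space, so
    continuity on each of them is enough.\<close>
  have "continuous_on (\<Omega> \<union> - K) (\<lambda>x. k' x v)"
  proof (rule continuous_on_open_Un[OF \<Omega>])
    show "open (- K)" using K(1) compact_imp_closed by blast
    have "continuous_on \<Omega> (\<lambda>x. h x * ?d x v + D x v * \<phi> x)"
      by (intro continuous_intros hcont cont continuous_on_subset[OF dc] continuous_on_subset[OF pc]) auto
    then show "continuous_on \<Omega> (\<lambda>x. k' x v)"
      by (rule continuous_on_eq) (simp add: k'_def)
    show "continuous_on (- K) (\<lambda>x. k' x v)"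
      by (rule continuous_on_eq[of _ "\<lambda>_. 0"]) (use K dz in \<open>auto simp: k'_def\<close>)
  qed
  moreover have "\<Omega> \<union> - K = UNIV" using K(2) by auto
  ultimately have k'cont: "continuous_on UNIV (\<lambda>x. k' x v)" by simp
  have k0: "(LINT x|lborel. k' x v) = 0"
    by (rule integral_directional_derivative_eq_0[OF kder k'cont K(1)]) (simp add: k_def K(3))
  have [measurable]: "(\<lambda>x. k' x v) \<in> borel_measurable lborel"
    using k'cont by (simp add: borel_measurable_continuous_onI)
  \<comment> \<open>On the compact set \<open>K\<close> both summands are continuous, hence
    separately integrable, and the integral may be split.\<close>
  have split: "k' x v = indicator K x *\<^sub>R (h x * ?d x v) + indicator K x *\<^sub>R (D x v * \<phi> x)" for x
    using K dz by (auto simp: k'_def indicator_def)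
  have i1: "set_integrable lebesgue K (\<lambda>x. h x * ?d x v)"
    by (intro set_integrable_lebesgue_compact K continuous_intros continuous_on_subset[OF hcont]
      continuous_on_subset[OF dc]) (use K in auto)
  have i2: "set_integrable lebesgue K (\<lambda>x. D x v * \<phi> x)"
    by (intro set_integrable_lebesgue_compact K continuous_intros continuous_on_subset[OF cont]
      continuous_on_subset[OF pc]) (use K in auto)
  have "0 = (LINT x|lebesgue. k' x v)" using k0 by (simp add: integral_completion)
  also have "\<dots> = (LINT x:K|lebesgue. h x * ?d x v) + (LINT x:K|lebesgue. D x v * \<phi> x)"
    unfolding split set_lebesgue_integral_def
    by (rule Bochner_Integration.integral_add) (use i1 i2 in \<open>simp_all add: set_integrable_def\<close>)
  also have "(LINT x:K|lebesgue. h x * ?d x v) = (LINT x:\<Omega>|lebesgue. h x * ?d x v)"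
    unfolding set_lebesgue_integral_def
    by (rule Bochner_Integration.integral_cong) (use K dz in \<open>auto simp: indicator_def\<close>)
  also have "(LINT x:K|lebesgue. D x v * \<phi> x) = (LINT x:\<Omega>|lebesgue. D x v * \<phi> x)"
    unfolding set_lebesgue_integral_def
    by (rule Bochner_Integration.integral_cong) (use K dz in \<open>auto simp: indicator_def\<close>)
  finally show "(LINT x:\<Omega>|lebesgue. h x * ?d x v) = - (LINT x:\<Omega>|lebesgue. D x v * \<phi> x)" by simp
qed

section \<open>Null sets, domination and limits for weak derivatives\<close>

lemma set_lebesgue_integral_spike:
  fixes f g :: "'b::euclidean_space \<Rightarrow> real"
  assumes S: "negligible S" and eq: "\<And>x. x \<in> \<Omega> - S \<Longrightarrow> g x = f x"
  shows "(LINT x:\<Omega>|lebesgue. g x) = (LINT x:\<Omega>|lebesgue. f x)"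
proof (cases "set_integrable lebesgue \<Omega> f")
  case True
  then have "set_integrable lebesgue \<Omega> g" by (rule absolutely_integrable_spike[OF _ S eq])
  with True show ?thesis
    using integral_spike[OF S eq] by (simp add: set_lebesgue_integral_eq_integral)
next
  \<comment> \<open>Integrability passes both ways across a null set, so here both integrals take
    the default value 0.\<close>
  case False
  moreover have "set_integrable lebesgue \<Omega> f" if "set_integrable lebesgue \<Omega> g"
    using that by (rule absolutely_integrable_spike[OF _ S]) (simp add: eq)
  ultimately have "\<not> set_integrable lebesgue \<Omega> g" by blast
  with False show ?thesis
    unfolding set_lebesgue_integral_def set_integrable_def by (simp add: not_integrable_integral_eq)
qed

lemma locally_integrable_on_spike:
  assumes "locally_integrable_on \<Omega> f" "negligible S" "\<And>x. x \<in> \<Omega> - S \<Longrightarrow> g x = f x"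
  shows "locally_integrable_on \<Omega> g"
  unfolding locally_integrable_on_def
proof (intro allI impI)
  fix K assume K: "compact K \<and> K \<subseteq> \<Omega>"
  then have "set_integrable lebesgue K f" using assms(1) unfolding locally_integrable_on_def by blast
  then show "set_integrable lebesgue K g"
    by (rule absolutely_integrable_spike[OF _ assms(2)]) (use K assms(3) in auto)
qed

text \<open>Used to correct the value at the origin. Linearity is required again because the
  definition asks for it at every point of \<open>\<Omega>\<close>, also on the null set.\<close>

lemma has_weak_derivative_spike:
  assumes h: "has_weak_derivative \<Omega> h D" and S: "negligible S"
    and "\<And>x. x \<in> \<Omega> - S \<Longrightarrow> h' x = h x" "\<And>x v. x \<in> \<Omega> - S \<Longrightarrow> D' x v = D x v"
    and "\<And>x. x \<in> \<Omega> \<Longrightarrow> linear (D' x)"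
  shows "has_weak_derivative \<Omega> h' D'"
  unfolding has_weak_derivative_def
proof (intro conjI allI impI ballI)
  show "locally_integrable_on \<Omega> h'"
    by (rule locally_integrable_on_spike[OF _ S assms(3)]) (use h in \<open>simp_all add: has_weak_derivative_def\<close>)
  show "locally_integrable_on \<Omega> (\<lambda>x. D' x v)" for v
    by (rule locally_integrable_on_spike[OF _ S assms(4)]) (use h in \<open>simp_all add: has_weak_derivative_def\<close>)
  show "linear (D' x)" if "x \<in> \<Omega>" for x using assms(5) that .
  fix \<phi> v assume \<phi>: "test_function \<Omega> \<phi>"
  have "(LINT x:\<Omega>|lebesgue. h' x * frechet_derivative \<phi> (at x) v)
      = (LINT x:\<Omega>|lebesgue. h x * frechet_derivative \<phi> (at x) v)"
    by (rule set_lebesgue_integral_spike[OF S]) (simp add: assms)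
  also have "\<dots> = - (LINT x:\<Omega>|lebesgue. D x v * \<phi> x)"
    using h \<phi> by (simp add: has_weak_derivative_def)
  also have "(LINT x:\<Omega>|lebesgue. D x v * \<phi> x) = (LINT x:\<Omega>|lebesgue. D' x v * \<phi> x)"
    by (rule set_lebesgue_integral_spike[OF S]) (simp add: assms)
  finally show "(LINT x:\<Omega>|lebesgue. h' x * frechet_derivative \<phi> (at x) v)
      = - (LINT x:\<Omega>|lebesgue. D' x v * \<phi> x)" .
qed

text \<open>A function continuous off one point is Borel measurable on compact sets once its value
  there is reset to 0; the domination then gives integrability, and undoing the reset changes
  nothing.\<close>

lemma locally_integrable_on_dominated:
  fixes f :: "'b::euclidean_space \<Rightarrow> real"
  assumes cont: "continuous_on (\<Omega> - {z}) f" and G: "locally_integrable_on \<Omega> G"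
    and bd: "\<And>x. x \<in> \<Omega> - {z} \<Longrightarrow> \<bar>f x\<bar> \<le> G x"
  shows "locally_integrable_on \<Omega> f"
  unfolding locally_integrable_on_def
proof (intro allI impI)
  fix K assume K: "compact K \<and> K \<subseteq> \<Omega>"
  have G': "set_integrable lebesgue K G" using G K unfolding locally_integrable_on_def by blast
  define f' where "f' x = (if x = z then 0 else f x)" for x
  have "K - {z} \<in> sets borel" using K by (auto intro: borel_compact)
  then have "(\<lambda>x. indicat_real (K - {z}) x *\<^sub>R f x) \<in> borel_measurable borel"
    by (rule borel_measurable_continuous_on_indicator) (use K in \<open>auto intro: continuous_on_subset[OF cont]\<close>)
  moreover have "(\<lambda>x. indicat_real (K - {z}) x *\<^sub>R f x) = (\<lambda>x. indicat_real K x *\<^sub>R f' x)"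
    by (simp add: fun_eq_iff f'_def indicator_def)
  ultimately have "(\<lambda>x. indicat_real K x *\<^sub>R f' x) \<in> borel_measurable lebesgue"
    by (simp add: measurable_completion)
  then have "set_borel_measurable lebesgue K f'" by (simp add: set_borel_measurable_def)
  moreover have "AE x\<in>K in lebesgue. norm (f' x) \<le> norm (G x)"
    using K bd by (intro AE_I2 impI) (fastforce simp: f'_def)
  ultimately have "set_integrable lebesgue K f'" by (rule set_integrable_bound[OF G'])
  then show "set_integrable lebesgue K f"
    by (rule absolutely_integrable_spike[of _ _ "{z}"]) (auto simp: f'_def)
qed

text \<open>The compact support of the weight \<open>q\<close> turns the locally integrable majorant
  \<open>G\<close> into an integrable one, so dominated convergence applies to the integral over
  \<open>\<Omega>\<close>.\<close>

lemma LIMSEQ_LINT_test: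
  fixes f :: "'b::euclidean_space \<Rightarrow> real"
  assumes f: "locally_integrable_on \<Omega> f" and fn: "\<And>n. locally_integrable_on \<Omega> (fn n)"
    and G: "locally_integrable_on \<Omega> G" and S: "negligible S"
    and lim: "\<And>x. x \<in> \<Omega> - S \<Longrightarrow> (\<lambda>n. fn n x) \<longlonglongrightarrow> f x"
    and bd: "\<And>n x. x \<in> \<Omega> - S \<Longrightarrow> \<bar>fn n x\<bar> \<le> G x"
    and K: "compact K" "K \<subseteq> \<Omega>" "\<And>x. x \<notin> K \<Longrightarrow> q x = 0" and q: "continuous_on UNIV q"
  shows "(\<lambda>n. LINT x:\<Omega>|lebesgue. fn n x * q x) \<longlonglongrightarrow> (LINT x:\<Omega>|lebesgue. f x * q x)"
proof -
  have "compact (q ` K)" by (intro compact_continuous_image continuous_on_subset[OF q] K) auto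
  then obtain M where M: "M > 0" "\<And>x. x \<in> K \<Longrightarrow> \<bar>q x\<bar> \<le> M"
    by (force dest!: compact_imp_bounded simp: bounded_pos)
  have qm [measurable]: "q \<in> borel_measurable lebesgue"
    using borel_measurable_continuous_onI[OF q] by (simp add: measurable_completion)
  \<comment> \<open>Since \<open>q\<close> vanishes off \<open>K\<close>, the indicator of
    \<open>\<Omega>\<close> can be exchanged for that of \<open>K\<close>, where local integrability
    supplies measurability.\<close>
  have meas: "(\<lambda>x. indicator \<Omega> x *\<^sub>R (k x * q x)) \<in> borel_measurable lebesgue"
    if "locally_integrable_on \<Omega> k" for k
  proof -
    have "set_integrable lebesgue K k" using that K unfolding locally_integrable_on_def by blast
    then have [measurable]: "(\<lambda>x. indicator K x *\<^sub>R k x) \<in> borel_measurable lebesgue"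
      unfolding set_integrable_def by simp
    have "(\<lambda>x. (indicator K x *\<^sub>R k x) * q x) \<in> borel_measurable lebesgue" by measurable
    moreover have "(\<lambda>x. (indicator K x *\<^sub>R k x) * q x) = (\<lambda>x. indicator \<Omega> x *\<^sub>R (k x * q x))"
      using K by (fastforce simp: indicator_def fun_eq_iff)
    ultimately show ?thesis by simp
  qed
  have nS: "AE x in lebesgue. x \<notin> S"
    using S by (simp add: AE_not_in negligible_iff_null_sets)
  show ?thesis unfolding set_lebesgue_integral_def
  proof (rule integral_dominated_convergence[where w="\<lambda>x. M * (indicator K x *\<^sub>R G x)"])
    have "set_integrable lebesgue K G" using G K unfolding locally_integrable_on_def by blast
    then show "integrable lebesgue (\<lambda>x. M * (indicator K x *\<^sub>R G x))"
      unfolding set_integrable_def by simp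
    show "AE x in lebesgue. (\<lambda>n. indicator \<Omega> x *\<^sub>R (fn n x * q x)) \<longlonglongrightarrow> indicator \<Omega> x *\<^sub>R (f x * q x)"
      using nS
    proof eventually_elim
      case (elim x)
      then show ?case using lim[of x] by (cases "x \<in> \<Omega>") (auto intro!: tendsto_intros)
    qed
    show "AE x in lebesgue. norm (indicator \<Omega> x *\<^sub>R (fn n x * q x)) \<le> M * (indicator K x *\<^sub>R G x)" for n
      using nS
    proof eventually_elim
      case (elim x)
      show ?case
      proof (cases "x \<in> K")
        case True
        then have "\<bar>fn n x\<bar> * \<bar>q x\<bar> \<le> G x * M"
          using elim bd[of x n] M K(2) by (intro mult_mono) force+
        with True K show ?thesis by (auto simp: abs_mult mult.commute)
      qed (simp add: K(3))
    qed
  qed (use meas f fn in auto)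
qed

text \<open>Both sides of the integration by parts identity converge by dominated convergence, with
  the derivative of the test function as weight on the left and the test function itself on the
  right.\<close>

lemma has_weak_derivative_limit:
  fixes h :: "'b::euclidean_space \<Rightarrow> real"
  assumes hn: "\<And>n. has_weak_derivative \<Omega> (hn n) (Dn n)" and S: "negligible S"
    and h: "locally_integrable_on \<Omega> h" and D: "\<And>v. locally_integrable_on \<Omega> (\<lambda>x. D x v)"
    and lin: "\<And>x. x \<in> \<Omega> \<Longrightarrow> linear (D x)"
    and G: "locally_integrable_on \<Omega> G" "\<And>v. locally_integrable_on \<Omega> (\<lambda>x. G' v x)"
    and lim: "\<And>x. x \<in> \<Omega> - S \<Longrightarrow> (\<lambda>n. hn n x) \<longlonglongrightarrow> h x"
      "\<And>x v. x \<in> \<Omega> - S \<Longrightarrow> (\<lambda>n. Dn n x v) \<longlonglongrightarrow> D x v"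
    and bd: "\<And>n x. x \<in> \<Omega> - S \<Longrightarrow> \<bar>hn n x\<bar> \<le> G x"
      "\<And>n x v. x \<in> \<Omega> - S \<Longrightarrow> \<bar>Dn n x v\<bar> \<le> G' v x"
  shows "has_weak_derivative \<Omega> h D"
  unfolding has_weak_derivative_def
proof (intro conjI allI impI ballI h D lin)
  fix \<phi> v assume \<phi>: "test_function \<Omega> \<phi>"
  then obtain K where K: "compact K" "K \<subseteq> \<Omega>" "\<And>x. x \<notin> K \<Longrightarrow> \<phi> x = 0"
    and dc: "\<And>v. continuous_on UNIV (\<lambda>x. frechet_derivative \<phi> (at x) v)"
    and dz: "\<And>x v. x \<notin> K \<Longrightarrow> frechet_derivative \<phi> (at x) v = 0"
    and pc: "continuous_on UNIV \<phi>"
    by (rule test_functionE) blast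
  have "(\<lambda>n. LINT x:\<Omega>|lebesgue. hn n x * frechet_derivative \<phi> (at x) v)
      \<longlonglongrightarrow> (LINT x:\<Omega>|lebesgue. h x * frechet_derivative \<phi> (at x) v)"
    by (rule LIMSEQ_LINT_test[OF h _ G(1) S lim(1) bd(1) K(1,2) dz dc])
      (use hn in \<open>simp_all add: has_weak_derivative_def\<close>)
  moreover have "(\<lambda>n. LINT x:\<Omega>|lebesgue. Dn n x v * \<phi> x) \<longlonglongrightarrow> (LINT x:\<Omega>|lebesgue. D x v * \<phi> x)"
    by (rule LIMSEQ_LINT_test[OF D _ G(2) S lim(2) bd(2) K(1,2,3) pc])
      (use hn in \<open>simp_all add: has_weak_derivative_def\<close>)
  moreover have "(LINT x:\<Omega>|lebesgue. hn n x * frechet_derivative \<phi> (at x) v)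
      = - (LINT x:\<Omega>|lebesgue. Dn n x v * \<phi> x)" for n
    using hn[of n] \<phi> unfolding has_weak_derivative_def by blast
  ultimately show "(LINT x:\<Omega>|lebesgue. h x * frechet_derivative \<phi> (at x) v)
      = - (LINT x:\<Omega>|lebesgue. D x v * \<phi> x)"
    by (auto dest: tendsto_minus intro: LIMSEQ_unique)
qed

section \<open>Integrals of powers of the norm\<close>

text \<open>Cut the punctured ball into the dyadic annuli \<open>A k\<close>. Scaling by 2^(-k) maps
  \<open>A 0\<close> onto \<open>A k\<close> and multiplies the integral by 2^(-k DIM) from the
  volume and 2^(k \<beta>) from the weight, so the annuli contribute a geometric series. As
  \<open>J\<close>, the share of \<open>A 0\<close>, is neither 0 nor infinite, the ratio alone
  decides convergence.\<close>

lemma nn_integral_norm_powr_ball: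
  fixes r \<beta> :: real
  assumes r: "0 < r"
  obtains J where "J \<noteq> 0" "J \<noteq> \<infinity>"
    "(\<integral>\<^sup>+x. ennreal (norm x powr - \<beta>) * indicator (ball (0::'b::euclidean_space) r) x \<partial>lborel)
      = (\<Sum>k. ennreal (((1/2) powr (DIM('b) - \<beta>)) ^ k) * J)"
proof -
  define w where "w x = ennreal (norm x powr - \<beta>)" for x :: 'b
  define A where "A k = {x::'b. r * (1/2) ^ Suc k \<le> norm x \<and> norm x < r * (1/2) ^ k}" for k
  define J where "J = (\<integral>\<^sup>+x. w x * indicator (A 0) x \<partial>lborel)"
  have [measurable]: "A k \<in> sets borel" for k unfolding A_def by measurable
  have [measurable]: "w \<in> borel_measurable borel" unfolding w_def by measurable
  have scale: "(\<integral>\<^sup>+x. w x * indicator (A k) x \<partial>lborel)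
      = ennreal (((1/2) powr (DIM('b) - \<beta>)) ^ k) * J" for k
  proof -
    define c :: real where "c = (1/2) ^ k"
    have c: "c > 0" by (simp add: c_def)
    have c_powr: "c powr a = ((1/2) powr a) ^ k" for a
      unfolding c_def by (induction k) (simp_all add: powr_mult powr_divide)
    have wc: "w (c *\<^sub>R x) = ennreal (c powr - \<beta>) * w x" for x
      using c by (simp add: w_def powr_mult ennreal_mult)
    have Ac: "indicator (A k) (c *\<^sub>R x) = (indicator (A 0) x :: ennreal)" for x
      using c by (auto simp: A_def indicator_def c_def mult.commute mult.left_commute field_simps)
    have "(\<integral>\<^sup>+x. w x * indicator (A k) x \<partial>lborel) =
        (\<integral>\<^sup>+x. w x * indicator (A k) x \<partial>density (distr lborel borel (\<lambda>x. 0 + c *\<^sub>R x)) (\<lambda>_. \<bar>c\<bar> ^ DIM('b)))"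
      using lborel_affine[of c "0::'b"] c by simp
    also have "\<dots> = (\<integral>\<^sup>+x. ennreal (c ^ DIM('b)) * (w (c *\<^sub>R x) * indicator (A k) (c *\<^sub>R x)) \<partial>lborel)"
      using c by (subst nn_integral_density; simp) (subst nn_integral_distr; simp)
    also have "\<dots> = (\<integral>\<^sup>+x. ennreal (c powr (DIM('b) - \<beta>)) * (w x * indicator (A 0) x) \<partial>lborel)"
      unfolding wc Ac using c
      by (simp add: mult.assoc[symmetric] ennreal_mult[symmetric] powr_realpow[symmetric] powr_add[symmetric])
    also have "\<dots> = ennreal (c powr (DIM('b) - \<beta>)) * J"
      unfolding J_def by (rule nn_integral_cmult) measurable
    finally show ?thesis by (simp add: c_powr)
  qed
  have disj: "disjoint_family A"
  proof -
    have "A i \<inter> A j = {}" if "i < j" for i j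
    proof -
      have "r * (1/2) ^ j \<le> r * (1/2) ^ Suc i"
        using r that by (intro mult_left_mono power_decreasing) auto
      then show ?thesis unfolding A_def by fastforce
    qed
    then show ?thesis unfolding disjoint_family_on_def by (metis Int_commute linorder_neqE_nat)
  qed
  have Un: "(\<Union>k. A k) = ball 0 r - {0}"
  proof (intro equalityI subsetI)
    fix x assume "x \<in> (\<Union>k. A k)"
    then obtain k where k: "r * (1/2) ^ Suc k \<le> norm x" "norm x < r * (1/2) ^ k"
      unfolding A_def by blast
    moreover have "r * (1/2) ^ k \<le> r * 1" using r by (intro mult_left_mono power_le_one) auto
    moreover have "0 < r * (1/2) ^ Suc k" using r by simp
    ultimately have "0 < norm x" "norm x < r" by linarith+
    then show "x \<in> ball 0 r - {0}" by simp
  next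
    fix x assume x: "x \<in> ball (0::'b) r - {0}"
    \<comment> \<open>The annulus of \<open>x\<close> is found from the least \<open>n\<close> with
      r 2^(-n) \<le> |x|. This \<open>n\<close> is not 0 because |x| < r, and its predecessor is the
      index sought.\<close>
    define P where "P n \<longleftrightarrow> r * (1/2) ^ n \<le> norm x" for n :: nat
    obtain n where "(1/2) ^ n < norm x / r"
      using real_arch_pow_inv[of "norm x / r" "1/2"] x r by auto
    then have "P n" using r by (simp add: P_def field_simps)
    then have L: "P (LEAST n. P n)" by (rule LeastI)
    have "\<not> P 0" using x by (simp add: P_def)
    then obtain k where k: "(LEAST n. P n) = Suc k" using L by (metis not0_implies_Suc)
    then have "\<not> P k" using not_less_Least[of k P] by simp
    then show "x \<in> (\<Union>k. A k)" using L k unfolding A_def P_def by auto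
  qed
  have "(\<integral>\<^sup>+x. w x * indicator (ball 0 r) x \<partial>lborel) = (\<integral>\<^sup>+x. w x * indicator (\<Union>k. A k) x \<partial>lborel)"
    \<comment> \<open>The union misses the origin, but the weight vanishes there because
      \<open>0 powr a = 0\<close>.\<close>
    unfolding Un by (rule nn_integral_cong) (auto simp: w_def indicator_def)
  also have "\<dots> = emeasure (density lborel w) (\<Union>k. A k)"
    by (subst emeasure_density) auto
  also have "\<dots> = (\<Sum>k. emeasure (density lborel w) (A k))"
    by (rule suminf_emeasure[symmetric]) (use disj in auto)
  also have "\<dots> = (\<Sum>k. ennreal (((1/2) powr (DIM('b) - \<beta>)) ^ k) * J)"
    using scale by (simp add: emeasure_density)
  finally have main: "(\<integral>\<^sup>+x. w x * indicator (ball 0 r) x \<partial>lborel)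
      = (\<Sum>k. ennreal (((1/2) powr (DIM('b) - \<beta>)) ^ k) * J)" .
  \<comment> \<open>\<open>A 0\<close> contains the open shell between the radii r/2 and r, which is
    nonempty: 3r/4 times a unit vector lies in it.\<close>
  have J0: "J \<noteq> 0"
  proof
    assume "J = 0"
    then have "emeasure lborel {x \<in> space lborel. w x * indicator (A 0) x \<noteq> 0} = 0"
      unfolding J_def by (subst (asm) nn_integral_0_iff) auto
    moreover have "{x \<in> space lborel. w x * indicator (A 0) x \<noteq> 0} = A 0"
      using r by (auto simp: w_def A_def indicator_def)
    ultimately have "A 0 \<in> null_sets lebesgue"
      by (simp add: null_setsI null_sets_completionI)
    then have "negligible (A 0)" by (simp add: negligible_iff_null_sets)
    then have "negligible (ball 0 r - cball (0::'b) (r/2))"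
      by (rule negligible_subset) (auto simp: A_def)
    moreover have "open (ball 0 r - cball (0::'b) (r/2))" by auto
    moreover have "ball 0 r - cball (0::'b) (r/2) \<noteq> {}"
    proof -
      have "(3/4 * r) *\<^sub>R (SOME b. b \<in> Basis) \<in> ball 0 r - cball (0::'b) (r/2)"
        using r by (simp add: SOME_Basis)
      then show ?thesis by blast
    qed
    ultimately show False using open_not_negligible by blast
  qed
  \<comment> \<open>The weight is monotone in the norm, in a direction that depends on the sign of
    \<beta>; the maximum of the two end values serves both cases.\<close>
  have "J \<le> (\<integral>\<^sup>+x. ennreal (max (r powr - \<beta>) ((r/2) powr - \<beta>)) * indicator (ball (0::'b) r) x \<partial>lborel)"
    unfolding J_def
  proof (rule nn_integral_mono)
    fix x :: 'b
    have "norm x powr - \<beta> \<le> max (r powr - \<beta>) ((r/2) powr - \<beta>)" if "r/2 \<le> norm x" "norm x < r"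
    proof (cases "\<beta> \<ge> 0")
      case True
      then have "norm x powr - \<beta> \<le> (r/2) powr - \<beta>" using that r by (intro powr_mono2') auto
      then show ?thesis by simp
    next
      case False
      then have "norm x powr - \<beta> \<le> r powr - \<beta>" using that r by (intro powr_mono2) auto
      then show ?thesis by simp
    qed
    then show "w x * indicator (A 0) x \<le> ennreal (max (r powr - \<beta>) ((r/2) powr - \<beta>)) * indicator (ball 0 r) x"
      unfolding w_def A_def by (auto simp: indicator_def intro!: ennreal_leI)
  qed
  also have "\<dots> < \<infinity>"
    using emeasure_lborel_ball_finite[of "0::'b" r]
    by (subst nn_integral_cmult_indicator) (auto simp: ennreal_mult_less_top)
  finally have "J \<noteq> \<infinity>" by simp
  from J0 this main show thesis unfolding w_def by (rule that)
qed

text \<open>For \<beta> equal to the dimension the ratio is 1, and every annulus contributes the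
  same positive amount.\<close>

lemma nn_integral_norm_powr_ball_eq_infinity:
  assumes "0 < r"
  shows "(\<integral>\<^sup>+x. ennreal (norm x powr - real DIM('b)) * indicator (ball (0::'b::euclidean_space) r) x \<partial>lborel) = \<infinity>"
proof -
  obtain J :: ennreal where J: "J \<noteq> 0" and eq:
    "(\<integral>\<^sup>+x. ennreal (norm x powr - real DIM('b)) * indicator (ball (0::'b) r) x \<partial>lborel)
      = (\<Sum>k::nat. ennreal (((1/2) powr (DIM('b) - real DIM('b))) ^ k) * J)"
    by (rule nn_integral_norm_powr_ball[OF assms, of "real DIM('b)"])
  have "(\<Sum>k::nat. J) = (SUP n. of_nat n * J)"
    by (simp add: suminf_eq_SUP)
  also have "\<dots> = (SUP n. of_nat n) * J" by (rule SUP_mult_right_ennreal[symmetric])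
  also have "\<dots> = \<infinity>" using J by (simp add: ennreal_SUP_of_nat_eq_top ennreal_top_mult)
  finally show ?thesis unfolding eq by simp
qed

text \<open>Below the dimension the ratio is less than 1. A compact set lies in a large ball, so the
  ball case gives local integrability, also across the origin.\<close>

lemma integrable_norm_powr:
  assumes "\<beta> < real DIM('b::euclidean_space)"
  shows "set_integrable lebesgue (ball 0 r) (\<lambda>x::'b. norm x powr - \<beta>)"
    and "locally_integrable_on \<Omega> (\<lambda>x::'b. norm x powr - \<beta>)"
proof -
  have *: "set_integrable lebesgue (ball 0 r) (\<lambda>x::'b. norm x powr - \<beta>)" if r: "0 < r" for r
  proof -
    obtain J :: ennreal where J: "J \<noteq> \<infinity>" and eq:
      "(\<integral>\<^sup>+x. ennreal (norm x powr - \<beta>) * indicator (ball (0::'b) r) x \<partial>lborel)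
        = (\<Sum>k. ennreal (((1/2) powr (DIM('b) - \<beta>)) ^ k) * J)"
      by (rule nn_integral_norm_powr_ball[OF r, of \<beta>])
    define q where "q = (1/2::real) powr (DIM('b) - \<beta>)"
    have q: "0 < q" "q < 1" using assms by (simp_all add: q_def powr01_less_one)
    have "(\<Sum>k. ennreal (q ^ k)) = ennreal (1 / (1 - q))"
      using q by (intro suminf_ennreal_eq geometric_sums) auto
    then have fin: "(\<integral>\<^sup>+x. ennreal (norm x powr - \<beta>) * indicator (ball (0::'b) r) x \<partial>lborel) < \<infinity>"
      unfolding eq q_def[symmetric] using J
      by (simp add: ennreal_suminf_multc ennreal_mult_less_top top.not_eq_extremum)
    have "integrable lborel (\<lambda>x::'b. indicator (ball 0 r) x *\<^sub>R norm x powr - \<beta>)"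
    proof (rule integrableI_bounded)
      have "(\<integral>\<^sup>+x. ennreal (norm (indicator (ball (0::'b) r) x *\<^sub>R norm x powr - \<beta>)) \<partial>lborel)
        = (\<integral>\<^sup>+x. ennreal (norm x powr - \<beta>) * indicator (ball (0::'b) r) x \<partial>lborel)"
        by (rule nn_integral_cong) (auto simp: indicator_def)
      with fin show "(\<integral>\<^sup>+x. ennreal (norm (indicator (ball (0::'b) r) x *\<^sub>R norm x powr - \<beta>)) \<partial>lborel) < \<infinity>"
        by simp
      have "(\<lambda>x::'b. norm x powr - \<beta>) \<in> borel_measurable borel" by measurable
      then show "(\<lambda>x::'b. indicator (ball 0 r) x *\<^sub>R norm x powr - \<beta>) \<in> borel_measurable lborel"
        by (intro borel_measurable_scaleR borel_measurable_indicator) auto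
    qed
    then show ?thesis unfolding set_integrable_def
      by (subst integrable_completion) auto
  qed
  show "set_integrable lebesgue (ball 0 r) (\<lambda>x::'b. norm x powr - \<beta>)"
  proof (cases "0 < r")
    case False
    then have *: "ball (0::'b) r = {}" by simp
    show ?thesis unfolding * set_integrable_def by simp
  qed (rule *)
  show "locally_integrable_on \<Omega> (\<lambda>x::'b. norm x powr - \<beta>)"
    unfolding locally_integrable_on_def
  proof (intro allI impI)
    fix K :: "'b set" assume K: "compact K \<and> K \<subseteq> \<Omega>"
    then obtain R where "R > 0" "K \<subseteq> ball 0 R"
      using bounded_subset_ballD[OF compact_imp_bounded] by metis
    then show "set_integrable lebesgue K (\<lambda>x. norm x powr - \<beta>)"
      using K by (intro set_integrable_subset[OF *]) (auto intro: lmeasurable_compact fmeasurableD)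
  qed
qed

section \<open>The radial function\<close>

text \<open>For \<open>\<epsilon> \<noteq> 0\<close> a smooth regularisation of \<open>\<bar>x\<bar>^(-\<alpha>)\<close>; for \<open>\<epsilon> = 0\<close> the function itself, with the
  junk value \<open>0\<close> at the origin.\<close>

definition radial :: "real \<Rightarrow> real \<Rightarrow> 'b::euclidean_space \<Rightarrow> real" where
  "radial \<alpha> \<epsilon> x = (x \<bullet> x + \<epsilon>\<^sup>2) powr (- \<alpha> / 2)"

definition dradial :: "real \<Rightarrow> real \<Rightarrow> 'b::euclidean_space \<Rightarrow> 'b \<Rightarrow> real" where
  "dradial \<alpha> \<epsilon> x h = - \<alpha> * (x \<bullet> x + \<epsilon>\<^sup>2) powr (- \<alpha> / 2 - 1) * (x \<bullet> h)"

text \<open>The Hessian of |x|^(-\<alpha>) off the origin. There is no smoothing parameter, since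
  only the first derivative is ever approximated.\<close>

definition ddradial :: "real \<Rightarrow> 'b::euclidean_space \<Rightarrow> 'b \<Rightarrow> 'b \<Rightarrow> real" where
  "ddradial \<alpha> x h k = \<alpha> * (\<alpha> + 2) * (x \<bullet> x) powr (- \<alpha> / 2 - 2) * (x \<bullet> h) * (x \<bullet> k)
     - \<alpha> * (x \<bullet> x) powr (- \<alpha> / 2 - 1) * (h \<bullet> k)"

lemma inner_powr_has_derivative:
  fixes x :: "'b::euclidean_space"
  assumes "x \<noteq> 0 \<or> \<epsilon> \<noteq> 0"
  shows "((\<lambda>x. (x \<bullet> x + \<epsilon>\<^sup>2) powr a) has_derivative
    (\<lambda>h. 2 * a * (x \<bullet> x + \<epsilon>\<^sup>2) powr (a - 1) * (x \<bullet> h))) (at x)"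
proof -
  have pos: "0 < x \<bullet> x + \<epsilon>\<^sup>2"
    using assms by (auto simp: add_pos_nonneg add_nonneg_pos)
  have "((\<lambda>x. x \<bullet> x + \<epsilon>\<^sup>2) has_derivative (\<lambda>h. x \<bullet> h + h \<bullet> x)) (at x)"
    by (auto intro!: derivative_eq_intros)
  from DERIV_compose_FDERIV[OF has_real_derivative_powr[OF pos] this]
  show ?thesis by (rule has_derivative_eq_rhs) (auto simp: fun_eq_iff inner_commute algebra_simps)
qed

lemma continuous_on_inner_powr:
  "\<epsilon> \<noteq> 0 \<or> 0 \<notin> S \<Longrightarrow> continuous_on (S :: 'b::euclidean_space set) (\<lambda>x. (x \<bullet> x + \<epsilon>\<^sup>2) powr a)"
  by (rule has_derivative_continuous_on, rule has_derivative_at_withinI,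
    rule inner_powr_has_derivative) auto

lemma radial_has_derivative:
  "x \<noteq> 0 \<or> \<epsilon> \<noteq> 0 \<Longrightarrow> (radial \<alpha> \<epsilon> has_derivative dradial \<alpha> \<epsilon> x) (at x)"
  unfolding radial_def[abs_def] dradial_def[abs_def]
  using inner_powr_has_derivative[of x \<epsilon> "- \<alpha> / 2"] by (simp add: algebra_simps)

lemma dradial_has_derivative:
  assumes "x \<noteq> 0"
  shows "((\<lambda>x. dradial \<alpha> 0 x k) has_derivative (\<lambda>h. ddradial \<alpha> x h k)) (at x)"
proof -
  have "((\<lambda>x. (x \<bullet> x + 0\<^sup>2) powr (- \<alpha> / 2 - 1)) has_derivative
    (\<lambda>h. 2 * (- \<alpha> / 2 - 1) * (x \<bullet> x + 0\<^sup>2) powr (- \<alpha> / 2 - 1 - 1) * (x \<bullet> h))) (at x)"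
    by (rule inner_powr_has_derivative) (use assms in auto)
  from has_derivative_mult[OF has_derivative_mult_right[OF this, of "- \<alpha>"]
      has_derivative_inner_left[OF has_derivative_ident, of k]]
  show ?thesis
    unfolding dradial_def ddradial_def
    by (rule has_derivative_eq_rhs) (simp add: fun_eq_iff algebra_simps)
qed

lemma linear_dradial: "linear (dradial \<alpha> \<epsilon> x)"
  unfolding dradial_def[abs_def] by (rule linearI) (auto simp: inner_right_distrib algebra_simps)

lemma continuous_on_radial: "\<epsilon> \<noteq> 0 \<or> 0 \<notin> S \<Longrightarrow> continuous_on S (radial \<alpha> \<epsilon>)"
  unfolding radial_def[abs_def] by (rule continuous_on_inner_powr)

lemma continuous_on_dradial: "\<epsilon> \<noteq> 0 \<or> 0 \<notin> S \<Longrightarrow> continuous_on S (\<lambda>x. dradial \<alpha> \<epsilon> x h)"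
  unfolding dradial_def by (intro continuous_intros continuous_on_inner_powr)

lemma continuous_on_ddradial: "0 \<notin> S \<Longrightarrow> continuous_on S (\<lambda>x. ddradial \<alpha> x h k)"
  unfolding ddradial_def
  using continuous_on_inner_powr[of 0 S "- \<alpha> / 2 - 2"] continuous_on_inner_powr[of 0 S "- \<alpha> / 2 - 1"]
  by (intro continuous_intros) auto

section \<open>Sizes of the first two derivatives of the radial function\<close>

lemma inner_powr_eq_norm_powr: "(x \<bullet> x) powr a = norm x powr (2 * a)"
  by (cases "x = 0") (auto simp: dot_square_norm powr_powr[symmetric] powr_numeral)

text \<open>Uniform in \<epsilon>, because a negative power decreases when \<epsilon>^2 is added to
  its base. This is the majorant for the limit \<epsilon> -> 0.\<close>

lemma dradial_bound:
  assumes "0 < \<alpha>" "x \<noteq> 0"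
  shows "\<bar>dradial \<alpha> \<epsilon> x h\<bar> \<le> \<alpha> * norm h * norm x powr - (\<alpha> + 1)"
proof -
  have "(x \<bullet> x + \<epsilon>\<^sup>2) powr (- \<alpha> / 2 - 1) \<le> (x \<bullet> x) powr (- \<alpha> / 2 - 1)"
    using assms by (intro powr_mono2') auto
  also have "\<dots> = norm x powr (- \<alpha> - 2)"
    by (simp add: inner_powr_eq_norm_powr algebra_simps)
  finally have "(x \<bullet> x + \<epsilon>\<^sup>2) powr (- \<alpha> / 2 - 1) * \<bar>x \<bullet> h\<bar> \<le> norm x powr (- \<alpha> - 2) * (norm x * norm h)"
    by (intro mult_mono Cauchy_Schwarz_ineq2) auto
  also have "\<dots> = norm h * norm x powr - (\<alpha> + 1)"
  proof -
    have "norm x * norm x powr (- \<alpha> - 2) = norm x powr - (\<alpha> + 1)"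
      by (simp add: powr_mult_base algebra_simps)
    then show ?thesis by (metis mult.assoc mult.commute)
  qed
  finally show ?thesis
    using assms by (simp add: dradial_def abs_mult mult.assoc mult_left_mono)
qed

lemma sum_Basis_inner_power2: "(\<Sum>e\<in>Basis. (x \<bullet> e)\<^sup>2) = norm (x::'b::euclidean_space) ^ 2"
  unfolding power2_norm_eq_inner by (subst euclidean_inner) (simp add: power2_eq_square)

lemma sum_dradial_power2:
  assumes "0 < \<alpha>"
  shows "(\<Sum>e\<in>Basis. (dradial \<alpha> 0 x e)\<^sup>2) = (\<alpha> * norm x powr - (\<alpha> + 1))\<^sup>2"
proof -
  have "(\<Sum>e\<in>Basis. (dradial \<alpha> 0 x e)\<^sup>2) = (\<alpha> * (x \<bullet> x) powr (- \<alpha> / 2 - 1))\<^sup>2 * (\<Sum>e\<in>Basis. (x \<bullet> e)\<^sup>2)"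
    by (simp add: dradial_def power_mult_distrib sum_distrib_left)
  also have "(\<Sum>e\<in>Basis. (x \<bullet> e)\<^sup>2) = norm x ^ 2"
    by (rule sum_Basis_inner_power2)
  also have "(\<alpha> * (x \<bullet> x) powr (- \<alpha> / 2 - 1))\<^sup>2 * norm x ^ 2 = (\<alpha> * (norm x powr (- \<alpha> - 2) * norm x))\<^sup>2"
    by (simp add: inner_powr_eq_norm_powr algebra_simps power_mult_distrib)
  \<comment> \<open>At the origin both sides are 0, since \<open>0 powr a = 0\<close>; so the
    formula holds there too.\<close>
  also have "norm x powr (- \<alpha> - 2) * norm x = norm x powr - (\<alpha> + 1)"
    by (cases "x = 0") (auto simp: powr_mult_base mult.commute[of _ "norm x"] algebra_simps)
  finally show ?thesis .
qed

text \<open>The Hessian has the eigenvalue \<alpha>(\<alpha>+1)|x|^(-\<alpha>-2) in the radial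
  direction and -\<alpha>|x|^(-\<alpha>-2) in the DIM - 1 orthogonal ones; the constant is
  \<alpha>^2 ((\<alpha>+1)^2 + DIM - 1) in another arrangement.\<close>

lemma sum_ddradial_power2:
  fixes x :: "'b::euclidean_space"
  assumes "x \<noteq> 0"
  shows "(\<Sum>e\<in>Basis. \<Sum>e'\<in>Basis. (ddradial \<alpha> x e e')\<^sup>2)
    = (\<alpha>\<^sup>2 * ((\<alpha> + 2)\<^sup>2 - 2 * (\<alpha> + 2) + DIM('b))) * (norm x powr - (\<alpha> + 2))\<^sup>2"
proof -
  \<comment> \<open>The Hessian is \<open>a\<close> times the tensor square of \<open>x\<close> plus
    \<open>b\<close> times the identity, so its squared entries add up to a^2 |x|^4 + 2ab |x|^2 +
    DIM b^2.\<close>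
  define a where "a = \<alpha> * (\<alpha> + 2) * (x \<bullet> x) powr (- \<alpha> / 2 - 2)"
  define b where "b = - \<alpha> * (x \<bullet> x) powr (- \<alpha> / 2 - 1)"
  have n: "(\<Sum>e\<in>Basis. (x \<bullet> e)\<^sup>2) = norm x ^ 2"
    by (rule sum_Basis_inner_power2)
  have "(\<Sum>e'\<in>Basis. (ddradial \<alpha> x e e')\<^sup>2) = a\<^sup>2 * (x \<bullet> e)\<^sup>2 * norm x ^ 2 + 2 * a * b * (x \<bullet> e)\<^sup>2 + b\<^sup>2"
    if e: "e \<in> Basis" for e
  proof -
    have "(ddradial \<alpha> x e e')\<^sup>2 = a\<^sup>2 * (x \<bullet> e)\<^sup>2 * (x \<bullet> e')\<^sup>2
       + (if e' = e then 2 * a * b * (x \<bullet> e)\<^sup>2 + b\<^sup>2 else 0)" if "e' \<in> Basis" for e'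
      using e that by (auto simp: ddradial_def a_def b_def inner_Basis power2_eq_square algebra_simps)
    then have "(\<Sum>e'\<in>Basis. (ddradial \<alpha> x e e')\<^sup>2) = (\<Sum>e'\<in>Basis. a\<^sup>2 * (x \<bullet> e)\<^sup>2 * (x \<bullet> e')\<^sup>2
       + (if e' = e then 2 * a * b * (x \<bullet> e)\<^sup>2 + b\<^sup>2 else 0))" by (rule sum.cong[OF refl])
    also have "\<dots> = a\<^sup>2 * (x \<bullet> e)\<^sup>2 * norm x ^ 2 + (2 * a * b * (x \<bullet> e)\<^sup>2 + b\<^sup>2)"
      using e by (simp add: sum.distrib sum_distrib_left[symmetric] n)
    finally show ?thesis by simp
  qed
  then have "(\<Sum>e\<in>Basis. \<Sum>e'\<in>Basis. (ddradial \<alpha> x e e')\<^sup>2)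
    = (\<Sum>e\<in>Basis. a\<^sup>2 * (x \<bullet> e)\<^sup>2 * norm x ^ 2 + 2 * a * b * (x \<bullet> e)\<^sup>2 + b\<^sup>2)"
    by (rule sum.cong[OF refl])
  also have "\<dots> = a\<^sup>2 * norm x ^ 4 + 2 * a * b * norm x ^ 2 + DIM('b) * b\<^sup>2"
    by (simp add: sum.distrib sum_distrib_left[symmetric] sum_distrib_right[symmetric] n mult.assoc power_add[symmetric])
  also have "a = \<alpha> * (\<alpha> + 2) * (norm x powr - (\<alpha> + 2) / norm x ^ 2)"
  proof -
    have "norm x powr (- \<alpha> - 4) * norm x ^ 2 = norm x powr (- \<alpha> - 4) * norm x powr 2"
      using assms by (simp add: powr_numeral)
    also have "\<dots> = norm x powr - (\<alpha> + 2)" unfolding powr_add[symmetric] by (simp add: algebra_simps)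
    finally have "norm x powr (- \<alpha> - 4) = norm x powr - (\<alpha> + 2) / norm x ^ 2"
      using assms by (simp add: field_simps)
    then show ?thesis by (simp add: a_def inner_powr_eq_norm_powr algebra_simps)
  qed
  also have "b = - \<alpha> * norm x powr - (\<alpha> + 2)"
    by (simp add: b_def inner_powr_eq_norm_powr algebra_simps)
  also have "(\<alpha> * (\<alpha> + 2) * (y / n ^ 2))\<^sup>2 * n ^ 4 + 2 * (\<alpha> * (\<alpha> + 2) * (y / n ^ 2)) * (- \<alpha> * y) * n ^ 2
      + DIM('b) * (- \<alpha> * y)\<^sup>2 = (\<alpha>\<^sup>2 * ((\<alpha> + 2)\<^sup>2 - 2 * (\<alpha> + 2) + DIM('b))) * y\<^sup>2"
    if "n \<noteq> 0" for y n :: real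
  proof -
    \<comment> \<open>Expressing \<open>y\<close> through \<open>q\<close> clears the denominators
      and leaves a polynomial identity.\<close>
    define q where "q = y / n ^ 2"
    have y: "y = q * n ^ 2" using that by (simp add: q_def)
    show ?thesis
      unfolding q_def[symmetric] unfolding y
      by (simp add: algebra_simps power2_eq_square power4_eq_xxxx)
  qed
  finally show ?thesis using assms by simp
qed

text \<open>The weak derivative has no extra part at the origin although the composition may
  oscillate there. For \<epsilon> \<noteq> 0 the regularised function is C^1 on all of
  \<open>\<Omega>\<close>; its derivatives are dominated, uniformly in \<epsilon>, by a multiple of
  |x|^(-\<alpha>-1), and \<alpha> + 1 < DIM makes this locally integrable.\<close>

lemma has_weak_derivative_compose_radial:
  fixes \<alpha> :: real and F F' :: "real \<Rightarrow> real" and \<Omega> :: "'b::euclidean_space set"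
  assumes \<alpha>: "0 < \<alpha>" "\<alpha> + 1 < DIM('b)" and \<Omega>: "open \<Omega>"
    and F: "\<And>t. (F has_real_derivative F' t) (at t)" and F': "continuous_on UNIV F'"
    and bd: "\<And>t. \<bar>F t\<bar> \<le> C" "\<And>t. \<bar>F' t\<bar> \<le> C"
  shows "has_weak_derivative \<Omega> (\<lambda>x. F (radial \<alpha> 0 x)) (\<lambda>x v. F' (radial \<alpha> 0 x) * dradial \<alpha> 0 x v)"
proof -
  define e :: "nat \<Rightarrow> real" where "e n = 1 / Suc n" for n
  have e: "e n \<noteq> 0" for n by (simp add: e_def)
  have e0: "e \<longlonglongrightarrow> 0" unfolding e_def by (rule LIMSEQ_Suc[OF lim_1_over_n])
  have Fc: "continuous_on UNIV F" using F by (meson DERIV_continuous_on has_field_derivative_at_within)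
  have C: "C \<ge> 0" using bd(1)[of 0] by linarith
  \<comment> \<open>Off the origin the limit of the base is positive, so the real power is
    continuous there.\<close>
  have powr_lim: "(\<lambda>n. (x \<bullet> x + (e n)\<^sup>2) powr a) \<longlonglongrightarrow> (x \<bullet> x + 0\<^sup>2) powr a" if "x \<noteq> 0" for a and x :: 'b
    by (intro tendsto_intros e0) (use that in auto)
  have der: "((\<lambda>x. F (radial \<alpha> \<epsilon> x)) has_derivative (\<lambda>v. F' (radial \<alpha> \<epsilon> x) * dradial \<alpha> \<epsilon> x v)) (at x)"
    if "x \<noteq> 0 \<or> \<epsilon> \<noteq> 0" for \<epsilon> and x :: 'b
    using DERIV_compose_FDERIV[OF F radial_has_derivative[OF that]] by (simp add: mult.commute)
  have cont: "continuous_on S (\<lambda>x. F (radial \<alpha> \<epsilon> x))"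
    "continuous_on S (\<lambda>x. F' (radial \<alpha> \<epsilon> x) * dradial \<alpha> \<epsilon> x v)"
    if "\<epsilon> \<noteq> 0 \<or> 0 \<notin> S" for \<epsilon> v and S :: "'b set"
    by (intro continuous_intros continuous_on_compose2[OF Fc] continuous_on_compose2[OF F']
      continuous_on_radial continuous_on_dradial that; simp)+
  define G where "G v x = C * (\<alpha> * norm v) * norm x powr - (\<alpha> + 1)" for v x :: 'b
  have G: "locally_integrable_on \<Omega> (G v)" for v
    using integrable_norm_powr(2)[OF \<alpha>(2), of \<Omega>]
    unfolding locally_integrable_on_def G_def by auto
  have Gbd: "\<bar>F' (radial \<alpha> \<epsilon> x) * dradial \<alpha> \<epsilon> x v\<bar> \<le> G v x" if "x \<noteq> 0" for \<epsilon> v x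
    unfolding abs_mult G_def mult.assoc
    by (rule mult_mono[OF bd(2) order_trans[OF dradial_bound[OF \<alpha>(1) that]]]) (use C in \<open>auto simp: mult.assoc\<close>)
  have const: "locally_integrable_on \<Omega> (\<lambda>x. C)"
    by (rule continuous_on_imp_locally_integrable) auto
  show ?thesis
  proof (rule has_weak_derivative_limit[where S="{0}" and G="\<lambda>x. C" and G'=G
        and hn="\<lambda>n x. F (radial \<alpha> (e n) x)" and Dn="\<lambda>n x v. F' (radial \<alpha> (e n) x) * dradial \<alpha> (e n) x v"])
    show "has_weak_derivative \<Omega> (\<lambda>x. F (radial \<alpha> (e n) x)) (\<lambda>x v. F' (radial \<alpha> (e n) x) * dradial \<alpha> (e n) x v)" for n
      by (rule C1_has_weak_derivative[OF \<Omega> der cont(2)]) (use e in auto)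
    show "locally_integrable_on \<Omega> (\<lambda>x. F (radial \<alpha> 0 x))"
      by (rule locally_integrable_on_dominated[where z=0, OF cont(1) const bd(1)]) simp
    show "locally_integrable_on \<Omega> (\<lambda>x. F' (radial \<alpha> 0 x) * dradial \<alpha> 0 x v)" for v
      by (rule locally_integrable_on_dominated[where z=0, OF cont(2) G]) (use Gbd in auto)
    show "linear (\<lambda>v. F' (radial \<alpha> 0 x) * dradial \<alpha> 0 x v)" for x :: 'b
      using linear_dradial[of \<alpha> 0 x] by (simp add: linear_iff algebra_simps)
    have Fl: "(\<lambda>n. F (radial \<alpha> (e n) x)) \<longlonglongrightarrow> F (radial \<alpha> 0 x)"
      "(\<lambda>n. F' (radial \<alpha> (e n) x)) \<longlonglongrightarrow> F' (radial \<alpha> 0 x)" if "x \<noteq> 0" for x :: 'b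
    proof -
      have *: "(\<lambda>n. radial \<alpha> (e n) x) \<longlonglongrightarrow> radial \<alpha> 0 x"
        unfolding radial_def by (rule powr_lim[OF that])
      have "isCont F (radial \<alpha> 0 x)" "isCont F' (radial \<alpha> 0 x)"
        using Fc F' by (simp_all add: continuous_on_eq_continuous_at)
      from this[THEN isCont_tendsto_compose, OF *] show "(\<lambda>n. F (radial \<alpha> (e n) x)) \<longlonglongrightarrow> F (radial \<alpha> 0 x)"
        "(\<lambda>n. F' (radial \<alpha> (e n) x)) \<longlonglongrightarrow> F' (radial \<alpha> 0 x)"
        by simp_all
    qed
    then show "(\<lambda>n. F (radial \<alpha> (e n) x)) \<longlonglongrightarrow> F (radial \<alpha> 0 x)" if "x \<in> \<Omega> - {0}" for x
      using that by simp
    show "(\<lambda>n. F' (radial \<alpha> (e n) x) * dradial \<alpha> (e n) x v) \<longlonglongrightarrow> F' (radial \<alpha> 0 x) * dradial \<alpha> 0 x v"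
      if "x \<in> \<Omega> - {0}" for x v
      unfolding dradial_def by (intro tendsto_intros Fl powr_lim) (use that in auto)
  qed (use G Gbd bd const in auto)
qed

section \<open>Fields of linear maps\<close>

text \<open>Expanding the argument in the basis reduces continuity in both variables to continuity
  of the finitely many \<open>L z b\<close>.\<close>

lemma continuous_on_linear_field:
  fixes L :: "'z::topological_space \<Rightarrow> 'e::euclidean_space \<Rightarrow> 'f::real_normed_vector"
  assumes lin: "\<And>z. z \<in> S \<Longrightarrow> linear (L z)" and cont: "\<And>b. continuous_on S (\<lambda>z. L z b)"
    and w: "continuous_on S w"
  shows "continuous_on S (\<lambda>z. L z (w z))"
proof -
  have "continuous_on S (\<lambda>z. \<Sum>b\<in>Basis. (w z \<bullet> b) *\<^sub>R L z b)"
    by (intro continuous_intros w cont)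
  then show ?thesis
  proof (rule continuous_on_eq)
    fix z assume "z \<in> S"
    have "L z (w z) = L z (\<Sum>b\<in>Basis. (w z \<bullet> b) *\<^sub>R b)" by (simp add: euclidean_representation)
    then show "(\<Sum>b\<in>Basis. (w z \<bullet> b) *\<^sub>R L z b) = L z (w z)"
      using lin[OF \<open>z \<in> S\<close>] by (simp add: linear_sum linear_scale)
  qed
qed

lemma continuous_on_bilinear_field:
  fixes B :: "'z::topological_space \<Rightarrow> 'e::euclidean_space \<Rightarrow> 'e \<Rightarrow> 'f::real_normed_vector"
  assumes bil: "\<And>z. z \<in> S \<Longrightarrow> bilinear (B z)" and cont: "\<And>v w. continuous_on S (\<lambda>z. B z v w)"
    and "continuous_on S v" "continuous_on S w"
  shows "continuous_on S (\<lambda>z. B z (v z) (w z))"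
proof (rule continuous_on_linear_field)
  show "linear (B z (v z))" if "z \<in> S" for z
    using bil[OF that] by (simp add: bilinear_def)
  show "continuous_on S (\<lambda>z. B z (v z) b)" for b
    by (rule continuous_on_linear_field[where L="\<lambda>z v. B z v b"])
      (use assms in \<open>auto simp: bilinear_def\<close>)
qed fact

text \<open>The product rule for a linear map that depends on a base point, again by expansion in
  the basis. The derivative \<open>A w\<close> in the base point is given for each \<open>w\<close>
  separately; its expansion in \<open>w\<close> follows from uniqueness of derivatives.\<close>

lemma has_derivative_linear_field:
  fixes L :: "'z::real_normed_vector \<Rightarrow> 'e::euclidean_space \<Rightarrow> 'f::real_normed_vector"
  assumes U: "open U" "f t \<in> U" and lin: "\<And>z. z \<in> U \<Longrightarrow> linear (L z)"
    and der: "\<And>w. ((\<lambda>z. L z w) has_derivative A w) (at (f t))"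
    and f: "(f has_derivative f') (at t)" and w: "(w has_derivative w') (at t)"
  shows "((\<lambda>s. L (f s) (w s)) has_derivative (\<lambda>h. A (w t) (f' h) + L (f t) (w' h))) (at t)"
proof -
  have expand: "L z v = (\<Sum>b\<in>Basis. (v \<bullet> b) *\<^sub>R L z b)" if "z \<in> U" for z v
  proof -
    have "L z v = L z (\<Sum>b\<in>Basis. (v \<bullet> b) *\<^sub>R b)" by (simp add: euclidean_representation)
    then show ?thesis using lin[OF that] by (simp add: linear_sum linear_scale)
  qed
  have A: "A v h = (\<Sum>b\<in>Basis. (v \<bullet> b) *\<^sub>R A b h)" for v h
  proof -
    have "((\<lambda>z. \<Sum>b\<in>Basis. (v \<bullet> b) *\<^sub>R L z b) has_derivative (\<lambda>h. \<Sum>b\<in>Basis. (v \<bullet> b) *\<^sub>R A b h)) (at (f t))"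
      by (intro has_derivative_sum has_derivative_scaleR_right der)
    then have "((\<lambda>z. L z v) has_derivative (\<lambda>h. \<Sum>b\<in>Basis. (v \<bullet> b) *\<^sub>R A b h)) (at (f t))"
      by (rule has_derivative_transform_within_open[OF _ U]) (simp add: expand[symmetric])
    from has_derivative_unique[OF der this] show ?thesis by (simp add: fun_eq_iff)
  qed
  have "((\<lambda>s. \<Sum>b\<in>Basis. (w s \<bullet> b) *\<^sub>R L (f s) b) has_derivative
      (\<lambda>h. \<Sum>b\<in>Basis. (w t \<bullet> b) *\<^sub>R A b (f' h) + (w' h \<bullet> b) *\<^sub>R L (f t) b)) (at t)"
    by (intro has_derivative_sum has_derivative_scaleR has_derivative_inner_left w
        has_derivative_compose[OF f der])
  moreover have "(\<lambda>h. \<Sum>b\<in>Basis. (w t \<bullet> b) *\<^sub>R A b (f' h) + (w' h \<bullet> b) *\<^sub>R L (f t) b)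
      = (\<lambda>h. A (w t) (f' h) + L (f t) (w' h))"
    by (simp add: sum.distrib A[of "w t"] expand[OF U(2), of "w' _"])
  moreover have "\<forall>\<^sub>F s in at t. f s \<in> U"
    using has_derivative_continuous[OF f] U by (metis continuous_within topological_tendstoD)
  then have "\<forall>\<^sub>F s in at t. (\<Sum>b\<in>Basis. (w s \<bullet> b) *\<^sub>R L (f s) b) = L (f s) (w s)"
    by eventually_elim (simp add: expand[symmetric])
  moreover have "(\<Sum>b\<in>Basis. (w t \<bullet> b) *\<^sub>R L (f t) b) = L (f t) (w t)"
    using U(2) by (simp add: expand[symmetric])
  ultimately show ?thesis
    by (simp add: has_derivative_transform_eventually)
qed

text \<open>The linear rule used twice: the pair of base point and first argument serves as the base
  point for the second argument.\<close>

lemma has_derivative_bilinear_field: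
  fixes B :: "'z::real_normed_vector \<Rightarrow> 'e::euclidean_space \<Rightarrow> 'e \<Rightarrow> 'f::real_normed_vector"
  assumes U: "open U" "f t \<in> U" and bil: "\<And>z. z \<in> U \<Longrightarrow> bilinear (B z)"
    and der: "\<And>v w. ((\<lambda>z. B z v w) has_derivative A v w) (at (f t))"
    and f: "(f has_derivative f') (at t)" and v: "(v has_derivative v') (at t)"
    and w: "(w has_derivative w') (at t)"
  shows "((\<lambda>s. B (f s) (v s) (w s)) has_derivative
    (\<lambda>h. A (v t) (w t) (f' h) + B (f t) (v' h) (w t) + B (f t) (v t) (w' h))) (at t)"
proof -
  have "((\<lambda>p. B (fst p) (snd p) w) has_derivative
      (\<lambda>p. A (v t) w (fst p) + B (f t) (snd p) w)) (at (f t, v t))" for w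
    by (rule has_derivative_linear_field[where f=fst and w=snd and t="(f t, v t)" and L="\<lambda>z v. B z v w"
        and A="\<lambda>v. A v w" and U=U and f'=fst and w'=snd, simplified])
      (use U bil der in \<open>auto simp: bilinear_def intro: has_derivative_fst has_derivative_snd has_derivative_ident\<close>)
  from has_derivative_linear_field[where f="\<lambda>s. (f s, v s)" and t=t and L="\<lambda>p w. B (fst p) (snd p) w"
      and U="U \<times> UNIV" and A="\<lambda>w p. A (v t) w (fst p) + B (f t) (snd p) w", OF _ _ _ this
        has_derivative_Pair[OF f v] w]
  show ?thesis using U bil by (auto simp: bilinear_def open_Times)
qed

lemma has_derivative_vec_lambda:
  fixes f :: "'i::finite \<Rightarrow> 'z::real_normed_vector \<Rightarrow> 'e::euclidean_space"
  assumes "\<And>i. (f i has_derivative f' i) (at x)"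
  shows "((\<lambda>y. \<chi> i. f i y) has_derivative (\<lambda>h. \<chi> i. f' i h)) (at x)"
proof (subst has_derivative_componentwise_within, intro ballI)
  fix b :: "'e ^ 'i" assume "b \<in> Basis"
  then obtain i u where b: "b = axis i u" unfolding Basis_vec_def by blast
  show "((\<lambda>y. (\<chi> i. f i y) \<bullet> b) has_derivative (\<lambda>h. (\<chi> i. f' i h) \<bullet> b)) (at x)"
    unfolding b by (simp add: inner_axis has_derivative_inner_left[OF assms])
qed

lemma vec_eq_sum_axis: "(h :: real ^ 'm) = (\<Sum>i\<in>UNIV. (h $ i) *\<^sub>R axis i 1)"
  using basis_expansion[of h] by (simp add: scalar_mult_eq_scaleR)

lemma linear_vec_expand: "linear L \<Longrightarrow> L (h :: real ^ 'm) = (\<Sum>i\<in>UNIV. (h $ i) *\<^sub>R L (axis i 1))"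
  by (subst vec_eq_sum_axis) (simp add: linear_sum linear_scale)

section \<open>Maps into manifolds\<close>

text \<open>The common ground of \<open>N\<close> and \<open>hom_bundle\<close>: enough to describe
  the open sets of \<open>mtopology\<close>, and so to treat maps into both by the same
  lemmas.\<close>

definition injective_charts :: "('a, 'e) atlas \<Rightarrow> bool" where
  "injective_charts A \<longleftrightarrow> (\<forall>c\<in>A. inj_on (snd c) (fst c))"

lemma injective_chartsD: "injective_charts A \<Longrightarrow> c \<in> A \<Longrightarrow> inj_on (snd c) (fst c)"
  by (simp add: injective_charts_def)

text \<open>Injectivity makes chart images commute with intersections, so the family used in
  \<open>mtopology\<close> is a topology.\<close>

lemma openin_mtopology_iff:
  fixes A :: "('a, 'e::euclidean_space) atlas"
  assumes "injective_charts A"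
  shows "openin (mtopology A) W \<longleftrightarrow> W \<subseteq> mcarrier A \<and> (\<forall>c\<in>A. open (snd c ` (fst c \<inter> W)))"
proof -
  have inter: "snd c ` (fst c \<inter> (V \<inter> W)) = snd c ` (fst c \<inter> V) \<inter> snd c ` (fst c \<inter> W)"
    if "c \<in> A" for c V W
    using injective_chartsD[OF assms that] unfolding inj_on_def by blast
  have union: "snd c ` (fst c \<inter> \<Union>\<K>) = (\<Union>V\<in>\<K>. snd c ` (fst c \<inter> V))" for c :: "('a, 'e) chart" and \<K>
    by blast
  have "istopology (\<lambda>W. W \<subseteq> mcarrier A \<and> (\<forall>c\<in>A. open (snd c ` (fst c \<inter> W))))"
    unfolding istopology_def
  proof (intro conjI allI impI, goal_cases)
    case (2 V W) then show ?case by (metis inter open_Int)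
  next
    case (4 \<K>) then show ?case by (auto simp: union intro!: open_UN)
  qed auto
  then show ?thesis by (simp add: mtopology_def topology_inverse')
qed

lemma chart_inv_cancel: "inj_on (snd c) (fst c) \<Longrightarrow> y \<in> fst c \<Longrightarrow> chart_inv c (snd c y) = y"
  by (simp add: chart_inv_def)

lemma chart_inv_image:
  "z \<in> chart_image c \<Longrightarrow> chart_inv c z \<in> fst c \<and> snd c (chart_inv c z) = z"
  unfolding chart_image_def chart_inv_def by (simp add: f_inv_into_f inv_into_into)

lemma chart_imageI: "y \<in> fst c \<Longrightarrow> snd c y \<in> chart_image c"
  by (simp add: chart_image_def)

text \<open>\<open>T\<close> is the tangent map of the \<open>C\<^sup>1\<close> map \<open>U\<close> on \<open>S\<close>, expressed in the charts of \<open>A\<close>.\<close>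

definition C1_along :: "('a, 'e::euclidean_space) atlas \<Rightarrow> 'b::euclidean_space set \<Rightarrow> ('b \<Rightarrow> 'a) \<Rightarrow>
    ('b \<Rightarrow> 'b \<Rightarrow> ('a, 'e) tangent) \<Rightarrow> bool" where
  "C1_along A S U T \<longleftrightarrow> open S \<and> (\<forall>x\<in>S. U x \<in> mcarrier A) \<and>
     (\<forall>c\<in>A. open {x\<in>S. U x \<in> fst c} \<and>
        (\<forall>x\<in>S. U x \<in> fst c \<longrightarrow> ((snd c \<circ> U) has_derivative (\<lambda>h. T x h c)) (at x)) \<and>
        (\<forall>h. continuous_on {x\<in>S. U x \<in> fst c} (\<lambda>x. T x h c)))"

lemma C1_alongD:
  assumes "C1_along A S U T"
  shows "open S" "x \<in> S \<Longrightarrow> U x \<in> mcarrier A"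
    "c \<in> A \<Longrightarrow> open {x\<in>S. U x \<in> fst c}"
    "c \<in> A \<Longrightarrow> x \<in> S \<Longrightarrow> U x \<in> fst c \<Longrightarrow> ((snd c \<circ> U) has_derivative (\<lambda>h. T x h c)) (at x)"
    "c \<in> A \<Longrightarrow> continuous_on {x\<in>S. U x \<in> fst c} (\<lambda>x. T x h c)"
  using assms unfolding C1_along_def by blast+

lemma C1_along_has_derivative:
  fixes f :: "'a \<Rightarrow> real"
  assumes A: "injective_charts A" and U: "C1_along A S U T"
    and f: "c \<in> A" "Ck_on 1 (f \<circ> chart_inv c) (chart_image c)" and x: "x \<in> S" "U x \<in> fst c"
  shows "((f \<circ> U) has_derivative
    (\<lambda>h. frechet_derivative (f \<circ> chart_inv c) (at (snd c (U x))) (T x h c))) (at x)"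
proof -
  have "(f \<circ> chart_inv c) differentiable (at (snd c (U x)))"
    using f(2) chart_imageI[OF x(2)] by simp
  then have "((f \<circ> chart_inv c) has_derivative frechet_derivative (f \<circ> chart_inv c) (at (snd c (U x))))
      (at ((snd c \<circ> U) x))"
    by (simp add: frechet_derivative_works[symmetric])
  from has_derivative_compose[OF C1_alongD(4)[OF U f(1) x] this]
  show ?thesis
  proof (rule has_derivative_transform_within_open[where s="{x\<in>S. U x \<in> fst c}"])
    show "open {x\<in>S. U x \<in> fst c}" by (rule C1_alongD(3)[OF U f(1)])
  qed (use x A f(1) in \<open>auto simp: chart_inv_cancel injective_charts_def\<close>)
qed

lemma C1_along_mdifferential:
  fixes f :: "'a \<Rightarrow> real"
  assumes A: "injective_charts A" and U: "C1_along A S U T"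
    and f: "\<forall>c\<in>A. Ck_on 1 (f \<circ> chart_inv c) (chart_image c)"
  shows "x \<in> S \<Longrightarrow> ((f \<circ> U) has_derivative (\<lambda>h. mdifferential A f (U x) (T x h))) (at x)"
    and "continuous_on S (\<lambda>x. mdifferential A f (U x) (T x h))"
proof -
  have der: "((f \<circ> U) has_derivative (\<lambda>h. mdifferential A f (U x) (T x h))) (at x)" if x: "x \<in> S" for x
  proof -
    have "\<exists>c. c \<in> charts_at A (U x)"
      using C1_alongD(2)[OF U x] by (auto simp: mcarrier_def charts_at_def)
    then have "(SOME c. c \<in> charts_at A (U x)) \<in> charts_at A (U x)" by (rule someI_ex)
    then show ?thesis
      unfolding mdifferential_def Let_def
      by (intro C1_along_has_derivative[OF A U _ _ x]) (use f in \<open>auto simp: charts_at_def\<close>)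
  qed
  then show "x \<in> S \<Longrightarrow> ((f \<circ> U) has_derivative (\<lambda>h. mdifferential A f (U x) (T x h))) (at x)" .
  \<comment> \<open>The chart chosen by \<open>SOME\<close> may jump from point to point. Near
    \<open>x\<close> a fixed chart \<open>c\<close> is used instead; the two expressions agree,
    being derivatives of the same function.\<close>
  have "continuous (at x) (\<lambda>x. mdifferential A f (U x) (T x h))" if x: "x \<in> S" for x
  proof -
    obtain c where c: "c \<in> A" "U x \<in> fst c" using C1_alongD(2)[OF U x] by (auto simp: mcarrier_def)
    define V where "V = {x\<in>S. U x \<in> fst c}"
    have V: "open V" "x \<in> V" "V \<subseteq> S" using C1_alongD(3)[OF U c(1)] x c(2) by (auto simp: V_def)
    let ?D = "\<lambda>y. frechet_derivative (f \<circ> chart_inv c) (at (snd c (U y)))"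
    have fc: "Ck_on 1 (f \<circ> chart_inv c) (chart_image c)" using f c(1) by blast
    have "continuous_on V (snd c \<circ> U)"
      by (rule has_derivative_continuous_on[OF has_derivative_at_withinI[OF C1_alongD(4)[OF U c(1)]]])
        (auto simp: V_def)
    then have cU: "continuous_on V (\<lambda>y. snd c (U y))" by (simp add: comp_def)
    have "continuous_on V (\<lambda>y. ?D y (T y h c))"
    proof (rule continuous_on_linear_field[where L="?D"])
      show "linear (?D y)" if "y \<in> V" for y
        using fc that by (intro linear_frechet_derivative) (auto simp: V_def chart_imageI)
      show "continuous_on V (\<lambda>y. ?D y b)" for b
        by (rule continuous_on_compose2[of "chart_image c" "\<lambda>z. frechet_derivative (f \<circ> chart_inv c) (at z) b", OF _ cU])
          (use fc in \<open>auto simp: V_def chart_imageI\<close>)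
      show "continuous_on V (\<lambda>y. T y h c)" unfolding V_def by (rule C1_alongD(5)[OF U c(1)])
    qed
    moreover have "?D y (T y h c) = mdifferential A f (U y) (T y h)" if "y \<in> V" for y
      using has_derivative_unique[OF C1_along_has_derivative[OF A U c(1) fc] der] that
      by (simp add: V_def fun_eq_iff)
    ultimately have "continuous_on V (\<lambda>y. mdifferential A f (U y) (T y h))"
      by (rule continuous_on_eq)
    then show ?thesis using V by (simp add: continuous_on_eq_continuous_at)
  qed
  then show "continuous_on S (\<lambda>x. mdifferential A f (U x) (T x h))"
    by (rule continuous_at_imp_continuous_on[rule_format])
qed

lemma linear_mdifferential:
  assumes y: "y \<in> mcarrier A" and f: "\<forall>c\<in>A. Ck_on 1 (f \<circ> chart_inv c) (chart_image c)"
    and T: "\<And>c. c \<in> charts_at A y \<Longrightarrow> linear (\<lambda>h. T h c)"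
  shows "linear (\<lambda>h. mdifferential A f y (T h))"
proof -
  define c where "c = (SOME c. c \<in> charts_at A y)"
  have "\<exists>c. c \<in> charts_at A y" using y by (auto simp: mcarrier_def charts_at_def)
  then have c: "c \<in> charts_at A y" unfolding c_def by (rule someI_ex)
  have "linear (frechet_derivative (f \<circ> chart_inv c) (at (snd c y)))"
    using f c by (intro linear_frechet_derivative) (auto simp: charts_at_def chart_imageI)
  from linear_compose[OF T[OF c] this] show ?thesis
    unfolding mdifferential_def Let_def c_def[symmetric] by (simp add: comp_def)
qed

text \<open>Openness is checked near each point, inside one chart where the map is continuous in
  coordinates.\<close>

lemma open_vimage_mtopology:
  fixes A :: "('a, 'e::euclidean_space) atlas" and U :: "'b::topological_space \<Rightarrow> 'a"
  assumes A: "injective_charts A" and W: "openin (mtopology A) W"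
    and loc: "\<And>x. x \<in> S \<Longrightarrow> \<exists>c\<in>A. \<exists>V. open V \<and> x \<in> V \<and> V \<subseteq> S \<and> (\<forall>y\<in>V. U y \<in> fst c) \<and>
      continuous_on V (snd c \<circ> U)"
  shows "open {x\<in>S. U x \<in> W}"
proof (subst open_subopen, intro ballI)
  fix x assume x: "x \<in> {x\<in>S. U x \<in> W}"
  then obtain c V where c: "c \<in> A" and V: "open V" "x \<in> V" "V \<subseteq> S" "\<forall>y\<in>V. U y \<in> fst c"
    "continuous_on V (snd c \<circ> U)" using loc by blast
  have "open (snd c ` (fst c \<inter> W))" using W c by (simp add: openin_mtopology_iff[OF A])
  then have "open (V \<inter> (snd c \<circ> U) -` (snd c ` (fst c \<inter> W)))"
    by (rule continuous_open_preimage[OF V(5) V(1)])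
  moreover have "x \<in> V \<inter> (snd c \<circ> U) -` (snd c ` (fst c \<inter> W))" using x V by auto
  moreover have "V \<inter> (snd c \<circ> U) -` (snd c ` (fst c \<inter> W)) \<subseteq> {x\<in>S. U x \<in> W}"
    using V(3,4) injective_chartsD[OF A c] by (auto simp: inj_on_def) metis
  ultimately show "\<exists>T. open T \<and> x \<in> T \<and> T \<subseteq> {x\<in>S. U x \<in> W}" by blast
qed

text \<open>The point \<open>z\<close> may carry any value in the carrier: its contribution to a
  preimage is a subset of a singleton, which is Lebesgue measurable.\<close>

lemma measurable_intoI:
  fixes A :: "('a, 'e::euclidean_space) atlas" and U :: "'b::euclidean_space \<Rightarrow> 'a"
  assumes A: "injective_charts A" and U: "\<And>x. x \<in> \<Omega> \<Longrightarrow> U x \<in> mcarrier A"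
    and loc: "\<And>x. x \<in> \<Omega> - {z} \<Longrightarrow> \<exists>c\<in>A. \<exists>V. open V \<and> x \<in> V \<and> V \<subseteq> \<Omega> - {z} \<and> (\<forall>y\<in>V. U y \<in> fst c) \<and>
      continuous_on V (snd c \<circ> U)"
  shows "measurable_into \<Omega> A U"
  unfolding measurable_into_def
proof (intro conjI allI impI ballI U)
  fix W assume "openin (mtopology A) W"
  then have "open {x\<in>\<Omega> - {z}. U x \<in> W}" by (rule open_vimage_mtopology[OF A _ loc])
  then have "{x\<in>\<Omega> - {z}. U x \<in> W} \<union> ({z} \<inter> {x\<in>\<Omega>. U x \<in> W}) \<in> sets lebesgue"
    by (intro sets.Un) (auto simp: Int_insert_left)
  moreover have "{x\<in>\<Omega> - {z}. U x \<in> W} \<union> ({z} \<inter> {x\<in>\<Omega>. U x \<in> W}) = {x \<in> \<Omega>. U x \<in> W}" by auto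
  ultimately show "{x \<in> \<Omega>. U x \<in> W} \<in> sets lebesgue" by simp
qed

lemma C1_along_continuous_on:
  "C1_along A S U T \<Longrightarrow> c \<in> A \<Longrightarrow> continuous_on {x\<in>S. U x \<in> fst c} (snd c \<circ> U)"
  by (rule has_derivative_continuous_on, rule has_derivative_at_withinI, rule C1_alongD(4)) auto

lemma C1_along_measurable_into:
  assumes A: "injective_charts A" and U: "\<And>x. x \<in> \<Omega> \<Longrightarrow> U x \<in> mcarrier A"
    and C: "C1_along A (\<Omega> - {z}) U T"
  shows "measurable_into \<Omega> A U"
proof (rule measurable_intoI[OF A U])
  fix x assume x: "x \<in> \<Omega> - {z}"
  then obtain c where c: "c \<in> A" "U x \<in> fst c" using U[of x] unfolding mcarrier_def by blast
  show "\<exists>c\<in>A. \<exists>V. open V \<and> x \<in> V \<and> V \<subseteq> \<Omega> - {z} \<and> (\<forall>y\<in>V. U y \<in> fst c) \<and>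
      continuous_on V (snd c \<circ> U)"
    by (rule bexI[OF _ c(1)], rule exI[of _ "{x\<in>\<Omega> - {z}. U x \<in> fst c}"])
      (use C1_alongD(3)[OF C c(1)] C1_along_continuous_on[OF C c(1)] x c in auto)
qed

text \<open>The coordinates transform correctly because \<open>snd c' o U\<close> is
  \<open>transition c c'\<close> after \<open>snd c o U\<close> near \<open>x\<close> and
  derivatives are unique.\<close>

lemma C1_along_tangent_space:
  assumes A: "injective_charts A" and C: "C1_along A S U T" and x: "x \<in> S"
    and zero: "\<And>c. c \<notin> charts_at A (U x) \<Longrightarrow> T x h c = 0"
    and diff: "\<And>c c'. c \<in> charts_at A (U x) \<Longrightarrow> c' \<in> charts_at A (U x) \<Longrightarrow>
      transition c c' differentiable (at (snd c (U x)))"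
  shows "T x h \<in> tangent_space A (U x)"
  unfolding tangent_space_def
proof (intro CollectI conjI ballI allI impI zero)
  fix c c' assume c: "c \<in> charts_at A (U x)" "c' \<in> charts_at A (U x)"
  then have cc: "c \<in> A" "U x \<in> fst c" "c' \<in> A" "U x \<in> fst c'" by (auto simp: charts_at_def)
  have "(transition c c' has_derivative frechet_derivative (transition c c') (at (snd c (U x))))
      (at ((snd c \<circ> U) x))"
    using diff[OF c] by (simp add: frechet_derivative_works[symmetric])
  from has_derivative_compose[OF C1_alongD(4)[OF C cc(1) x cc(2)] this]
  have "((snd c' \<circ> U) has_derivative
      (\<lambda>h. frechet_derivative (transition c c') (at (snd c (U x))) (T x h c))) (at x)"
  proof (rule has_derivative_transform_within_open[where s="{x\<in>S. U x \<in> fst c}"])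
    show "open {x\<in>S. U x \<in> fst c}" by (rule C1_alongD(3)[OF C cc(1)])
  qed (use x cc A in \<open>auto simp: chart_inv_cancel injective_charts_def transition_def\<close>)
  from has_derivative_unique[OF C1_alongD(4)[OF C cc(3) x cc(4)] this]
  show "T x h c' = frechet_derivative (transition c c') (at (snd c (U x))) (T x h c)"
    by (rule fun_cong)
qed

lemma C1_along_tangent_hom:
  fixes U :: "real ^ 'm \<Rightarrow> 'a"
  assumes A: "injective_charts A" and C: "C1_along A S U T" and x: "x \<in> S"
    and zero: "\<And>h c. c \<notin> charts_at A (U x) \<Longrightarrow> T x h c = 0"
    and diff: "\<And>c c'. c \<in> charts_at A (U x) \<Longrightarrow> c' \<in> charts_at A (U x) \<Longrightarrow>
      transition c c' differentiable (at (snd c (U x)))"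
  shows "T x \<in> tangent_hom A (U x)"
  unfolding tangent_hom_def
proof (intro CollectI conjI allI ballI)
  show "T x h \<in> tangent_space A (U x)" for h
    by (rule C1_along_tangent_space[OF A C x zero diff])
  show "linear (\<lambda>h. T x h c)" if "c \<in> charts_at A (U x)" for c
    using that by (intro has_derivative_linear[OF C1_alongD(4)[OF C _ x]]) (auto simp: charts_at_def)
qed

subsection \<open>The bundle charts\<close>

lemma fst_hom_chart: "fst (hom_chart \<Omega> A c) = {(x, y, \<xi>). x \<in> \<Omega> \<and> y \<in> fst c \<and> \<xi> \<in> tangent_hom A y}"
  and snd_hom_chart: "snd (hom_chart \<Omega> A c) (x, y, \<xi>) = (x, snd c y, \<chi> i. \<xi> (axis i 1) c)"
  by (simp_all add: hom_chart_def)

text \<open>Linearity passes from the axes to all vectors, and the transition derivatives pass from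
  the chart \<open>c\<close> to all others.\<close>

lemma tangent_hom_eqI:
  assumes c: "c \<in> charts_at A y" and \<xi>: "\<xi> \<in> tangent_hom A y" "\<xi>' \<in> tangent_hom A y"
    and eq: "\<And>i. \<xi> (axis i 1) c = \<xi>' (axis i 1) c"
  shows "\<xi> = \<xi>'"
proof (intro ext)
  fix h c'
  have h: "\<xi> h c = \<xi>' h c"
    using \<xi> c linear_vec_expand[of "\<lambda>h. \<xi> h c" h] linear_vec_expand[of "\<lambda>h. \<xi>' h c" h]
    by (simp add: tangent_hom_def eq)
  show "\<xi> h c' = \<xi>' h c'"
  proof (cases "c' \<in> charts_at A y")
    case True
    have "v c' = frechet_derivative (transition c c') (at (snd c y)) (v c)" if "v \<in> tangent_space A y" for v
      using that c True unfolding tangent_space_def by blast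
    from this[of "\<xi> h"] this[of "\<xi>' h"] show ?thesis
      using \<xi> h by (simp add: tangent_hom_def)
  next
    case False
    then have "v c' = 0" if "v \<in> tangent_space A y" for v
      using that unfolding tangent_space_def by blast
    from this[of "\<xi> h"] this[of "\<xi>' h"] show ?thesis
      using \<xi> by (simp add: tangent_hom_def)
  qed
qed

lemma injective_charts_hom_bundle:
  assumes "injective_charts A"
  shows "injective_charts (hom_bundle \<Omega> A)"
  unfolding injective_charts_def hom_bundle_def
proof (intro ballI)
  fix C assume "C \<in> hom_chart \<Omega> A ` A"
  then obtain c where c: "c \<in> A" and C: "C = hom_chart \<Omega> A c" by blast
  show "inj_on (snd C) (fst C)" unfolding C
  proof (rule inj_onI)
    fix P Q assume PQ: "P \<in> fst (hom_chart \<Omega> A c)" "Q \<in> fst (hom_chart \<Omega> A c)"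
      "snd (hom_chart \<Omega> A c) P = snd (hom_chart \<Omega> A c) Q"
    obtain x y \<xi> x' y' \<xi>' where P: "P = (x, y, \<xi>)" and Q: "Q = (x', y', \<xi>')" by (metis prod_cases3)
    have a: "y \<in> fst c" "\<xi> \<in> tangent_hom A y" "y' \<in> fst c" "\<xi>' \<in> tangent_hom A y'" "x = x'"
      "snd c y = snd c y'" "\<xi> (axis i 1) c = \<xi>' (axis i 1) c" for i
      using PQ by (auto simp: P Q fst_hom_chart snd_hom_chart vec_eq_iff)
    have y: "y = y'" using injective_chartsD[OF assms c] a by (meson inj_onD)
    moreover have "\<xi> = \<xi>'"
      by (rule tangent_hom_eqI[of c A y]) (use a y c in \<open>auto simp: charts_at_def\<close>)
    ultimately show "P = Q" using a P Q by simp
  qed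
qed

lemma mem_mcarrier_hom_bundle:
  "(x, y, \<xi>) \<in> mcarrier (hom_bundle \<Omega> A) \<longleftrightarrow> x \<in> \<Omega> \<and> y \<in> mcarrier A \<and> \<xi> \<in> tangent_hom A y"
  by (auto simp: mcarrier_def hom_bundle_def fst_hom_chart)

text \<open>Continuity of the coordinates of \<open>T\<close> off \<open>z\<close> suffices, so the
  lemma serves \<open>u\<close> with \<open>Tu\<close> and, one level up, the lift with its own
  tangent map.\<close>

lemma measurable_into_hom_lift:
  fixes U :: "real ^ 'm \<Rightarrow> 'a"
  assumes A: "injective_charts A" and C: "C1_along A (\<Omega> - {z}) U T"
    and U: "\<And>x. x \<in> \<Omega> \<Longrightarrow> U x \<in> mcarrier A" and T: "\<And>x. x \<in> \<Omega> \<Longrightarrow> T x \<in> tangent_hom A (U x)"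
  shows "measurable_into \<Omega> (hom_bundle \<Omega> A) (hom_lift U T)"
proof (rule measurable_intoI[OF injective_charts_hom_bundle[OF A]])
  show "hom_lift U T x \<in> mcarrier (hom_bundle \<Omega> A)" if "x \<in> \<Omega>" for x
    using that U T by (simp add: hom_lift_def mem_mcarrier_hom_bundle)
  fix x assume x: "x \<in> \<Omega> - {z}"
  then obtain c where c: "c \<in> A" "U x \<in> fst c" using U[of x] unfolding mcarrier_def by blast
  let ?V = "{x\<in>\<Omega> - {z}. U x \<in> fst c}"
  have "(snd (hom_chart \<Omega> A c) \<circ> hom_lift U T) = (\<lambda>x. (x, (snd c \<circ> U) x, \<chi> i. T x (axis i 1) c))"
    by (simp add: fun_eq_iff hom_lift_def snd_hom_chart)
  moreover have "continuous_on ?V (\<lambda>x. (x, (snd c \<circ> U) x, \<chi> i. T x (axis i 1) c))"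
    by (intro continuous_intros C1_along_continuous_on[OF C c(1)] C1_alongD(5)[OF C c(1)])
  ultimately have "continuous_on ?V (snd (hom_chart \<Omega> A c) \<circ> hom_lift U T)" by simp
  then show "\<exists>C\<in>hom_bundle \<Omega> A. \<exists>V. open V \<and> x \<in> V \<and> V \<subseteq> \<Omega> - {z} \<and> (\<forall>y\<in>V. hom_lift U T y \<in> fst C) \<and>
      continuous_on V (snd C \<circ> hom_lift U T)"
    unfolding hom_bundle_def
    by (intro bexI[of _ "hom_chart \<Omega> A c"] exI[of _ ?V])
      (use C1_alongD(3)[OF C c(1)] x c T in \<open>auto simp: fst_hom_chart hom_lift_def\<close>)
qed

section \<open>Tangent vectors and transition maps, on the manifold and on the bundle\<close>

context smooth_manifold
begin

lemma injective_charts: "injective_charts N"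
  using chart_inj by (auto simp: injective_charts_def)

lemma topspace_mtopology: "topspace (mtopology N) = mcarrier N"
proof -
  have "snd c ` (fst c \<inter> mcarrier N) = chart_image c" if "c \<in> N" for c
    using that by (auto simp: mcarrier_def chart_image_def)
  then have "openin (mtopology N) (mcarrier N)" by (simp add: openin_mtopology chart_open)
  moreover have "topspace (mtopology N) \<subseteq> mcarrier N"
    using openin_topspace[of "mtopology N"] unfolding openin_mtopology by blast
  ultimately show ?thesis using openin_subset by blast
qed

lemma transition_snd: "c \<in> N \<Longrightarrow> y \<in> fst c \<Longrightarrow> transition c c' (snd c y) = snd c' y"
  by (simp add: transition_def chart_inv_cancel chart_inj)

lemma transition_Ck_on: "c \<in> N \<Longrightarrow> c' \<in> N \<Longrightarrow> Ck_on k (transition c c') (snd c ` (fst c \<inter> fst c'))"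
  using transition_smooth by (simp add: smooth_on_def)

lemma transition_has_derivative:
  assumes "c \<in> N" "c' \<in> N" "z \<in> snd c ` (fst c \<inter> fst c')"
  shows "(transition c c' has_derivative frechet_derivative (transition c c') (at z)) (at z)"
  using transition_Ck_on[OF assms(1,2), of "Suc 0"] assms(3)
  by (auto simp: frechet_derivative_works[symmetric])

lemma openin_chart_vimage:
  assumes c: "c \<in> N" and U: "open U"
  shows "openin (mtopology N) {y \<in> fst c. snd c y \<in> U}"
  unfolding openin_mtopology
proof (intro conjI ballI)
  show "{y \<in> fst c. snd c y \<in> U} \<subseteq> mcarrier N" using c by (auto simp: mcarrier_def)
  fix c' assume c': "c' \<in> N"
  have "continuous_on (snd c' ` (fst c' \<inter> fst c)) (transition c' c)"
    using transition_Ck_on[OF c' c, of 0] by simp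
  then have "open (snd c' ` (fst c' \<inter> fst c) \<inter> transition c' c -` U)"
    by (rule continuous_open_preimage) (use U overlap_open[OF c' c] in auto)
  moreover have "snd c' ` (fst c' \<inter> {y \<in> fst c. snd c y \<in> U}) = snd c' ` (fst c' \<inter> fst c) \<inter> transition c' c -` U"
    using c' by (auto simp: transition_snd)
  ultimately show "open (snd c' ` (fst c' \<inter> {y \<in> fst c. snd c y \<in> U}))" by simp
qed

lemma openin_chart_domain: "c \<in> N \<Longrightarrow> openin (mtopology N) (fst c)"
  using openin_chart_vimage[of c UNIV] by simp

text \<open>The chain rule for the composition of two transition maps. It gives
  \<open>tangent_vector\<close> the compatibility that defines \<open>tangent_space\<close>.\<close>

lemma transition_cocycle:
  assumes "c \<in> charts_at N y" "c' \<in> charts_at N y" "c'' \<in> charts_at N y"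
  shows "frechet_derivative (transition c' c'') (at (snd c' y)) (frechet_derivative (transition c c') (at (snd c y)) w)
    = frechet_derivative (transition c c'') (at (snd c y)) w"
proof -
  have c: "c \<in> N" "c' \<in> N" "c'' \<in> N" and y: "y \<in> fst c" "y \<in> fst c'" "y \<in> fst c''"
    using assms by (auto simp: charts_at_def)
  have eq: "transition c c' (snd c y) = snd c' y" using c y by (simp add: transition_snd)
  have "(transition c' c'' has_derivative frechet_derivative (transition c' c'') (at (snd c' y)))
      (at (transition c c' (snd c y)))"
    unfolding eq using transition_has_derivative[OF c(2,3)] y by blast
  moreover have "(transition c c' has_derivative frechet_derivative (transition c c') (at (snd c y))) (at (snd c y))"
    using transition_has_derivative[OF c(1,2)] y by blast
  ultimately have "((\<lambda>z. transition c' c'' (transition c c' z)) has_derivative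
      (\<lambda>w. frechet_derivative (transition c' c'') (at (snd c' y)) (frechet_derivative (transition c c') (at (snd c y)) w)))
      (at (snd c y))" by (rule has_derivative_compose[rotated])
  then have 1: "(transition c c'' has_derivative
      (\<lambda>w. frechet_derivative (transition c' c'') (at (snd c' y)) (frechet_derivative (transition c c') (at (snd c y)) w)))
      (at (snd c y))"
    by (rule has_derivative_transform_within_open[OF _ overlap_open[OF c(1,2)]])
      (use c y in \<open>auto simp: transition_snd\<close>)
  have 2: "(transition c c'' has_derivative frechet_derivative (transition c c'') (at (snd c y))) (at (snd c y))"
    using transition_has_derivative[OF c(1,3)] y by blast
  from fun_cong[OF has_derivative_unique[OF 1 2]] show ?thesis .
qed

lemma tangent_vector_mem: "c \<in> charts_at N y \<Longrightarrow> tangent_vector N c y w \<in> tangent_space N y"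
  by (auto simp: tangent_space_def tangent_vector_def transition_cocycle)

lemma tangent_space_coords:
  "v \<in> tangent_space N y \<Longrightarrow> c \<in> charts_at N y \<Longrightarrow> c' \<in> charts_at N y \<Longrightarrow>
    v c' = frechet_derivative (transition c c') (at (snd c y)) (v c)"
  "v \<in> tangent_space N y \<Longrightarrow> c \<notin> charts_at N y \<Longrightarrow> v c = 0"
  unfolding tangent_space_def by blast+

lemma tangent_vector_eq:
  assumes "c \<in> charts_at N y" "v \<in> tangent_space N y"
  shows "tangent_vector N c y (v c) = v"
  using tangent_space_coords(1)[OF assms(2,1)] tangent_space_coords(2)[OF assms(2)]
  by (auto simp: tangent_vector_def fun_eq_iff)

lemma tangent_vector_chart:
  assumes "c \<in> charts_at N y"
  shows "tangent_vector N c y w c = w"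
proof -
  have c: "c \<in> N" and y: "y \<in> fst c" using assms by (auto simp: charts_at_def)
  have "((\<lambda>z. z) has_derivative (\<lambda>w. w)) (at (snd c y))" by (rule has_derivative_ident)
  then have "(transition c c has_derivative (\<lambda>w. w)) (at (snd c y))"
    by (rule has_derivative_transform_within_open[OF _ chart_open[OF c]])
      (use y c in \<open>auto simp: chart_image_def transition_snd\<close>)
  then have "frechet_derivative (transition c c) (at (snd c y)) = (\<lambda>w. w)"
    by (rule frechet_derivative_at[symmetric])
  then show ?thesis using assms by (simp add: tangent_vector_def)
qed

text \<open>Inverts the fibre coordinates of \<open>hom_chart\<close>, so that the bundle charts
  acquire an explicit inverse.\<close>

definition hom_of_coords :: "('a, 'e) chart \<Rightarrow> 'a \<Rightarrow> 'e ^ 'm \<Rightarrow> real ^ 'm \<Rightarrow> ('a, 'e) tangent" where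
  "hom_of_coords c y w h = tangent_vector N c y (\<Sum>i\<in>UNIV. (h $ i) *\<^sub>R (w $ i))"

lemma hom_of_coords_mem:
  assumes c: "c \<in> charts_at N y"
  shows "hom_of_coords c y w \<in> tangent_hom N y"
  unfolding tangent_hom_def
proof (intro CollectI conjI allI ballI)
  show "hom_of_coords c y w h \<in> tangent_space N y" for h
    unfolding hom_of_coords_def by (rule tangent_vector_mem[OF c])
  fix c' assume c': "c' \<in> charts_at N y"
  have "linear (frechet_derivative (transition c c') (at (snd c y)))"
    using transition_has_derivative[of c c' "snd c y"] c c'
    by (intro has_derivative_linear) (auto simp: charts_at_def)
  moreover have "linear (\<lambda>h. \<Sum>i\<in>UNIV. (h $ i) *\<^sub>R (w $ i))"
    by (rule linearI) (simp_all add: scaleR_left_distrib sum.distrib scaleR_sum_right)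
  ultimately have "linear (\<lambda>h. frechet_derivative (transition c c') (at (snd c y)) (\<Sum>i\<in>UNIV. (h $ i) *\<^sub>R (w $ i)))"
    using linear_compose unfolding comp_def by blast
  then show "linear (\<lambda>h. hom_of_coords c y w h c')"
    using c' by (simp add: hom_of_coords_def tangent_vector_def)
qed

lemma hom_of_coords_axis: "hom_of_coords c y w (axis i 1) = tangent_vector N c y (w $ i)"
proof -
  have "(\<Sum>j\<in>UNIV. (axis i 1 $ j) *\<^sub>R (w $ j)) = (\<Sum>j\<in>UNIV. if j = i then w $ j else 0)"
    by (rule sum.cong) (auto simp: axis_def)
  then show ?thesis by (simp add: hom_of_coords_def)
qed

text \<open>Every triple in the product of \<open>\<Omega>\<close>, the chart image and the model
  fibre is attained by the bundle chart, with a known preimage.\<close>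

lemma hom_chart_coords:
  assumes c: "c \<in> N" and x: "x \<in> \<Omega>" and z: "z \<in> chart_image c"
  defines "y \<equiv> chart_inv c z"
  shows "(x, y, hom_of_coords c y w) \<in> fst (hom_chart \<Omega> N c)"
    and "snd (hom_chart \<Omega> N c) (x, y, hom_of_coords c y w) = (x, z, w)"
    and "chart_inv (hom_chart \<Omega> N c) (x, z, w) = (x, y, hom_of_coords c y w)"
proof -
  have y: "y \<in> fst c" "snd c y = z" using chart_inv_image[OF z] by (auto simp: y_def)
  then have cy: "c \<in> charts_at N y" using c by (simp add: charts_at_def)
  show 1: "(x, y, hom_of_coords c y w) \<in> fst (hom_chart \<Omega> N c)"
    using x y hom_of_coords_mem[OF cy] by (simp add: fst_hom_chart)
  show 2: "snd (hom_chart \<Omega> N c) (x, y, hom_of_coords c y w) = (x, z, w)"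
    using y by (simp add: snd_hom_chart hom_of_coords_axis tangent_vector_chart[OF cy])
  have "inj_on (snd (hom_chart \<Omega> N c)) (fst (hom_chart \<Omega> N c))"
    using injective_charts_hom_bundle[OF injective_charts, of \<Omega>] c
    by (auto simp: injective_charts_def hom_bundle_def)
  from chart_inv_cancel[OF this 1]
  show "chart_inv (hom_chart \<Omega> N c) (x, z, w) = (x, y, hom_of_coords c y w)" unfolding 2 .
qed

text \<open>The fibre transforms by the derivative of the base transition. One derivative is spent
  here, so differentiating a bundle transition takes the second derivative of the base
  transition.\<close>

lemma transition_hom_chart:
  assumes c: "c \<in> N" "c' \<in> N" and x: "x \<in> \<Omega>" and z: "z \<in> snd c ` (fst c \<inter> fst c')"
  shows "transition (hom_chart \<Omega> N c) (hom_chart \<Omega> N c') (x, z, w) =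
    (x, transition c c' z, \<chi> i. frechet_derivative (transition c c') (at z) (w $ i))"
proof -
  obtain y where y: "y \<in> fst c" "y \<in> fst c'" "z = snd c y" using z by blast
  have z': "z \<in> chart_image c" using y by (simp add: chart_imageI)
  have inv: "chart_inv c z = y" using y c by (simp add: chart_inv_cancel chart_inj)
  have "c' \<in> charts_at N y" using c y by (simp add: charts_at_def)
  then show ?thesis
    unfolding transition_def[of "hom_chart \<Omega> N c"] comp_def hom_chart_coords(3)[OF c(1) x z'] inv
      snd_hom_chart hom_of_coords_axis
    using y c by (simp add: tangent_vector_def transition_snd)
qed

text \<open>Serves to show that \<open>T2u\<close> takes values in the tangent spaces of the bundle,
  where coordinates transform by the derivatives of these transitions.\<close>

lemma transition_hom_chart_differentiable:
  fixes P :: "('m::finite, 'a, 'e) hom_point"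
  assumes \<Omega>: "open \<Omega>" and c: "c \<in> N" "c' \<in> N"
    and P: "P \<in> fst (hom_chart \<Omega> N c)" "P \<in> fst (hom_chart \<Omega> N c')"
  shows "transition (hom_chart \<Omega> N c) (hom_chart \<Omega> N c') differentiable (at (snd (hom_chart \<Omega> N c) P))"
proof -
  obtain x y \<xi> where P': "P = (x, y, \<xi>)" by (cases P)
  then have x: "x \<in> \<Omega>" and y: "y \<in> fst c" "y \<in> fst c'" using P by (auto simp: fst_hom_chart)
  define z where "z = snd c y"
  define w where "w = (\<chi> i. \<xi> (axis i 1) c)"
  define V where "V = snd c ` (fst c \<inter> fst c')"
  define \<tau> where "\<tau> = transition c c'"
  have V: "open V" "z \<in> V" using overlap_open[OF c] y by (auto simp: V_def z_def)
  have d\<tau>: "(\<tau> has_derivative frechet_derivative \<tau> (at z)) (at z)" if "z \<in> V" for z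
    using transition_has_derivative[OF c] that by (simp add: \<tau>_def V_def)
  have "Ck_on (Suc (Suc 0)) \<tau> V" using transition_Ck_on[OF c] by (simp only: \<tau>_def V_def)
  then have "(\<lambda>z. frechet_derivative \<tau> (at z) b) differentiable (at z)" for b
    using V(2) by simp
  then obtain A where A: "((\<lambda>z. frechet_derivative \<tau> (at z) b) has_derivative A b) (at z)" for b
    unfolding differentiable_def by metis
  define G where "G p = (fst p, \<tau> (fst (snd p)), \<chi> i. frechet_derivative \<tau> (at (fst (snd p))) (snd (snd p) $ i))"
    for p :: "('m, 'e) hom_model"
  have f2: "((\<lambda>p. fst (snd p)) has_derivative (\<lambda>p. fst (snd p))) (at (x, z, w))"
    by (intro has_derivative_fst has_derivative_snd has_derivative_ident)
  have f3: "((\<lambda>p. snd (snd p) $ i) has_derivative (\<lambda>p. snd (snd p) $ i)) (at (x, z, w))" for i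
    by (rule bounded_linear.has_derivative[OF bounded_linear_vec_nth])
      (intro has_derivative_snd has_derivative_ident)
  have "((\<lambda>p. \<tau> (fst (snd p))) has_derivative (\<lambda>p. frechet_derivative \<tau> (at z) (fst (snd p)))) (at (x, z, w))"
    by (rule has_derivative_compose[OF f2]) (use d\<tau>[OF V(2)] in simp)
  moreover have "((\<lambda>p. \<chi> i. frechet_derivative \<tau> (at (fst (snd p))) (snd (snd p) $ i)) has_derivative
     (\<lambda>p. \<chi> i. A (w $ i) (fst (snd p)) + frechet_derivative \<tau> (at z) (snd (snd p) $ i))) (at (x, z, w))"
  proof (rule has_derivative_vec_lambda)
    fix i
    show "((\<lambda>p. frechet_derivative \<tau> (at (fst (snd p))) (snd (snd p) $ i)) has_derivative
     (\<lambda>p. A (w $ i) (fst (snd p)) + frechet_derivative \<tau> (at z) (snd (snd p) $ i))) (at (x, z, w))"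
      using has_derivative_linear_field[where L="\<lambda>z. frechet_derivative \<tau> (at z)", OF V(1) _ _ _ f2 f3, of A i]
        V(2) has_derivative_linear[OF d\<tau>] A by simp
  qed
  moreover have "(fst has_derivative fst) (at (x, z, w))"
    by (intro has_derivative_fst has_derivative_ident)
  ultimately have "G differentiable (at (x, z, w))"
    unfolding G_def[abs_def] by (intro differentiable_Pair) (auto intro: differentiableI)
  then obtain G' where "(G has_derivative G') (at (x, z, w))" unfolding differentiable_def by blast
  then have "(transition (hom_chart \<Omega> N c) (hom_chart \<Omega> N c') has_derivative G') (at (x, z, w))"
  proof (rule has_derivative_transform_within_open)
    show "open (\<Omega> \<times> V \<times> (UNIV :: ('e ^ 'm) set))" using \<Omega> V by (intro open_Times) auto
    show "(x, z, w) \<in> \<Omega> \<times> V \<times> UNIV" using x V by simp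
    show "G p = transition (hom_chart \<Omega> N c) (hom_chart \<Omega> N c') p" if "p \<in> \<Omega> \<times> V \<times> UNIV" for p
    proof -
      have "p = (fst p, fst (snd p), snd (snd p))" by simp
      with that transition_hom_chart[OF c, of "fst p" \<Omega> "fst (snd p)" "snd (snd p)"]
      show ?thesis by (auto simp: G_def V_def \<tau>_def)
    qed
  qed
  moreover have "snd (hom_chart \<Omega> N c) P = (x, z, w)" by (simp add: P' snd_hom_chart z_def w_def)
  ultimately show ?thesis unfolding differentiable_def by auto
qed

text \<open>Independence of the chart picked by \<open>SOME\<close>: two local expressions of
  \<open>f\<close> differ by a transition map, whose derivative also relates the coordinates of
  \<open>v\<close>.\<close>

lemma mdifferential_chart:
  fixes f :: "'a \<Rightarrow> real"
  assumes f: "\<forall>c\<in>N. Ck_on 1 (f \<circ> chart_inv c) (chart_image c)"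
    and c: "c \<in> charts_at N y" and v: "v \<in> tangent_space N y"
  shows "mdifferential N f y v = frechet_derivative (f \<circ> chart_inv c) (at (snd c y)) (v c)"
proof -
  define c' where "c' = (SOME c. c \<in> charts_at N y)"
  have c': "c' \<in> charts_at N y" unfolding c'_def using c by (rule someI)
  have cN: "c \<in> N" "c' \<in> N" and y: "y \<in> fst c" "y \<in> fst c'" using c c' by (auto simp: charts_at_def)
  have der: "((f \<circ> chart_inv c) has_derivative frechet_derivative (f \<circ> chart_inv c) (at (snd c y))) (at (snd c y))"
    if "c \<in> charts_at N y" for c
    using f that by (auto simp: charts_at_def frechet_derivative_works[symmetric] chart_imageI)
  have \<tau>: "transition c c' (snd c y) = snd c' y" using y cN by (simp add: transition_snd)
  have "((\<lambda>z. (f \<circ> chart_inv c') (transition c c' z)) has_derivative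
     (\<lambda>w. frechet_derivative (f \<circ> chart_inv c') (at (snd c' y)) (frechet_derivative (transition c c') (at (snd c y)) w)))
     (at (snd c y))"
    using y unfolding \<tau>[symmetric]
    by (intro has_derivative_compose[OF transition_has_derivative[OF cN] der[OF c', folded \<tau>]]) blast
  then have "((f \<circ> chart_inv c) has_derivative
     (\<lambda>w. frechet_derivative (f \<circ> chart_inv c') (at (snd c' y)) (frechet_derivative (transition c c') (at (snd c y)) w)))
     (at (snd c y))"
    by (rule has_derivative_transform_within_open[OF _ overlap_open[OF cN]])
      (use cN y in \<open>auto simp: transition_snd chart_inv_cancel chart_inj\<close>)
  from fun_cong[OF has_derivative_unique[OF der[OF c] this], of "v c"]
  show ?thesis
    using tangent_space_coords(1)[OF v c c'] unfolding mdifferential_def Let_def c'_def[symmetric] by simp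
qed

end

text \<open>The default 0 off \<open>S\<close> yields the zero homomorphism, which keeps the map a
  section over the excluded point as well.\<close>

definition second_tangent :: "(real ^ 'm) set \<Rightarrow> (real ^ 'm) set \<Rightarrow> ('a, 'e::euclidean_space) atlas \<Rightarrow>
    (real ^ 'm \<Rightarrow> 'a) \<Rightarrow> (real ^ 'm \<Rightarrow> real ^ 'm \<Rightarrow> ('a, 'e) tangent) \<Rightarrow>
    real ^ 'm \<Rightarrow> real ^ 'm \<Rightarrow> (('m, 'a, 'e) hom_point, ('m, 'e) hom_model) tangent" where
  "second_tangent S \<Omega> A U T x h C =
    (if x \<in> S \<and> C \<in> charts_at (hom_bundle \<Omega> A) (hom_lift U T x)
     then frechet_derivative (snd C \<circ> hom_lift U T) (at x) h else 0)"

text \<open>In the bundle chart of \<open>c\<close> the lift is the triple of \<open>x\<close>, the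
  coordinates of \<open>U x\<close> and those of \<open>T x\<close> on the axes. Componentwise
  differentiation gives both claims, \<open>D2\<close> being the derivative of the last
  component.\<close>

lemma second_tangent:
  fixes U :: "real ^ 'm \<Rightarrow> 'a"
  assumes C: "C1_along A S U T" and S: "S \<subseteq> \<Omega>" and T: "\<And>x. x \<in> S \<Longrightarrow> T x \<in> tangent_hom A (U x)"
    and D2: "\<And>c x k. c \<in> A \<Longrightarrow> x \<in> S \<Longrightarrow> U x \<in> fst c \<Longrightarrow>
      ((\<lambda>x. T x k c) has_derivative (\<lambda>h. D2 c x h k)) (at x)"
    and cont: "\<And>c h k. c \<in> A \<Longrightarrow> continuous_on {x\<in>S. U x \<in> fst c} (\<lambda>x. D2 c x h k)"
  shows "C1_along (hom_bundle \<Omega> A) S (hom_lift U T) (second_tangent S \<Omega> A U T)"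
    and "c \<in> A \<Longrightarrow> x \<in> S \<Longrightarrow> U x \<in> fst c \<Longrightarrow>
      second_tangent S \<Omega> A U T x h (hom_chart \<Omega> A c) = (h, T x h c, \<chi> i. D2 c x h (axis i 1))"
proof -
  have snd: "snd (hom_chart \<Omega> A c) \<circ> hom_lift U T = (\<lambda>x. (x, (snd c \<circ> U) x, \<chi> i. T x (axis i 1) c))" for c
    by (simp add: fun_eq_iff hom_lift_def snd_hom_chart)
  have dom: "hom_lift U T x \<in> fst (hom_chart \<Omega> A c) \<longleftrightarrow> U x \<in> fst c" if "x \<in> S" for x c
    using that S T by (auto simp: hom_lift_def fst_hom_chart)
  have der: "((snd (hom_chart \<Omega> A c) \<circ> hom_lift U T) has_derivative
      (\<lambda>h. (h, T x h c, \<chi> i. D2 c x h (axis i 1)))) (at x)"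
    if "c \<in> A" "x \<in> S" "U x \<in> fst c" for c x
    unfolding snd
    by (intro has_derivative_Pair has_derivative_ident has_derivative_vec_lambda D2 that C1_alongD(4)[OF C])
  show eq: "second_tangent S \<Omega> A U T x h (hom_chart \<Omega> A c) = (h, T x h c, \<chi> i. D2 c x h (axis i 1))"
    if "c \<in> A" "x \<in> S" "U x \<in> fst c" for c x h
    unfolding second_tangent_def frechet_derivative_at[OF der[OF that], symmetric]
    using that dom[of x c] by (simp add: charts_at_def hom_bundle_def)
  show "C1_along (hom_bundle \<Omega> A) S (hom_lift U T) (second_tangent S \<Omega> A U T)"
    unfolding C1_along_def
  proof (intro conjI ballI impI allI)
    show "open S" by (rule C1_alongD(1)[OF C])
    show "hom_lift U T x \<in> mcarrier (hom_bundle \<Omega> A)" if "x \<in> S" for x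
      using that S T C1_alongD(2)[OF C] by (auto simp: hom_lift_def mem_mcarrier_hom_bundle)
    fix K assume "K \<in> hom_bundle \<Omega> A"
    then obtain c where c: "c \<in> A" and K: "K = hom_chart \<Omega> A c" unfolding hom_bundle_def by blast
    have set: "{x \<in> S. hom_lift U T x \<in> fst K} = {x \<in> S. U x \<in> fst c}" unfolding K using dom[of _ c] by blast
    show "open {x \<in> S. hom_lift U T x \<in> fst K}" unfolding set by (rule C1_alongD(3)[OF C c])
    show "((snd K \<circ> hom_lift U T) has_derivative (\<lambda>h. second_tangent S \<Omega> A U T x h K)) (at x)"
      if "x \<in> S" "hom_lift U T x \<in> fst K" for x
      using der[OF c that(1)] that dom[of x c] eq[OF c that(1)] by (simp add: K)
    show "continuous_on {x \<in> S. hom_lift U T x \<in> fst K} (\<lambda>x. second_tangent S \<Omega> A U T x h K)" for h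
      unfolding set
    proof (rule continuous_on_eq)
      show "continuous_on {x \<in> S. U x \<in> fst c} (\<lambda>x. (h, T x h c, \<chi> i. D2 c x h (axis i 1)))"
        by (intro continuous_intros cont c C1_alongD(5)[OF C])
    qed (simp add: eq[OF c] K)
  qed
qed

lemma (in smooth_manifold) tangent_space_scaleR:
  assumes "v \<in> tangent_space N y"
  shows "(\<lambda>c. a *\<^sub>R v c) \<in> tangent_space N y"
  unfolding tangent_space_def
proof (intro CollectI conjI ballI allI impI)
  fix c c' assume c: "c \<in> charts_at N y" "c' \<in> charts_at N y"
  then have "linear (frechet_derivative (transition c c') (at (snd c y)))"
    using transition_has_derivative[of c c' "snd c y"]
    by (intro has_derivative_linear) (auto simp: charts_at_def)
  then show "a *\<^sub>R v c' = frechet_derivative (transition c c') (at (snd c y)) (a *\<^sub>R v c)"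
    using tangent_space_coords(1)[OF assms c] by (simp add: linear_scale)
next
  fix c assume "c \<notin> charts_at N y"
  then show "a *\<^sub>R v c = 0" using tangent_space_coords(2)[OF assms] by simp
qed

section \<open>The metric in charts and bounds over compact sets\<close>

context riemannian_manifold
begin

text \<open>The passage from the abstract metric to its chart expression, for which bilinearity,
  positivity and smoothness are available.\<close>

lemma metric_eq_local_metric:
  assumes c: "c \<in> charts_at N y" and vw: "v \<in> tangent_space N y" "w \<in> tangent_space N y"
  shows "g y v w = local_metric N g c (snd c y) (v c) (w c)"
proof -
  have "chart_inv c (snd c y) = y"
    using c by (simp add: charts_at_def chart_inv_cancel chart_inj)
  then show ?thesis using tangent_vector_eq[OF c] vw by (simp add: local_metric_def)
qed

lemma continuous_on_local_metric:
  assumes c: "c \<in> N" and f: "continuous_on S f" "f ` S \<subseteq> chart_image c"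
    and v: "continuous_on S v" and w: "continuous_on S w"
  shows "continuous_on S (\<lambda>x. local_metric N g c (f x) (v x) (w x))"
proof (rule continuous_on_bilinear_field[where B="\<lambda>x. local_metric N g c (f x)"])
  show "bilinear (local_metric N g c (f x))" if "x \<in> S" for x
    using metric_bilinear[OF c] f that by blast
  have "Ck_on 0 (\<lambda>z. local_metric N g c z v w) (chart_image c)" for v w
    using metric_smooth[OF c] unfolding smooth_on_def by blast
  then show "continuous_on S (\<lambda>x. local_metric N g c (f x) v w)" for v w
    by (intro continuous_on_compose2[OF _ f]) simp
qed fact+

lemma local_metric_has_derivative:
  assumes "c \<in> N" "z \<in> chart_image c"
  shows "((\<lambda>z. local_metric N g c z v w) has_derivative
    frechet_derivative (\<lambda>z. local_metric N g c z v w) (at z)) (at z)"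
proof -
  have "Ck_on (Suc 0) (\<lambda>z. local_metric N g c z v w) (chart_image c)"
    using metric_smooth[OF assms(1)] unfolding smooth_on_def by blast
  then show ?thesis using assms by (auto simp: frechet_derivative_works[symmetric])
qed

lemma local_metric_scaleR:
  "c \<in> N \<Longrightarrow> z \<in> chart_image c \<Longrightarrow>
    local_metric N g c z (a *\<^sub>R v) (a *\<^sub>R v) = a\<^sup>2 * local_metric N g c z v v"
  using metric_bilinear[of c z] by (simp add: bilinear_lmul bilinear_rmul power2_eq_square)

lemma charts_at_nonempty: "y \<in> mcarrier N \<Longrightarrow> \<exists>c. c \<in> charts_at N y"
  by (auto simp: mcarrier_def charts_at_def)

lemma metric_scaleR:
  assumes y: "y \<in> mcarrier N" and v: "v \<in> tangent_space N y"
  shows "g y (\<lambda>c. a *\<^sub>R v c) (\<lambda>c. a *\<^sub>R v c) = a\<^sup>2 * g y v v"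
proof -
  obtain c where c: "c \<in> charts_at N y" using charts_at_nonempty[OF y] by blast
  then have "c \<in> N" "snd c y \<in> chart_image c" by (auto simp: charts_at_def chart_imageI)
  then show ?thesis
    using metric_eq_local_metric[OF c tangent_space_scaleR[OF v] tangent_space_scaleR[OF v]]
      metric_eq_local_metric[OF c v v] by (simp add: local_metric_scaleR)
qed

lemma metric_nonneg:
  assumes y: "y \<in> mcarrier N" and v: "v \<in> tangent_space N y"
  shows "0 \<le> g y v v" and "g y v v = 0 \<Longrightarrow> v c = 0"
proof -
  have pos: "0 \<le> g y v v \<and> (g y v v = 0 \<longrightarrow> v c = 0)" if c: "c \<in> charts_at N y" for c
  proof -
    have cz: "c \<in> N" "snd c y \<in> chart_image c" using c by (auto simp: charts_at_def chart_imageI)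
    show ?thesis
      unfolding metric_eq_local_metric[OF c v v]
      using metric_positive[OF cz, of "v c"] metric_bilinear[OF cz]
      by (cases "v c = 0") (auto simp: bilinear_lzero)
  qed
  show "0 \<le> g y v v" using pos charts_at_nonempty[OF y] by blast
  show "v c = 0" if "g y v v = 0"
    using pos[of c] that tangent_space_coords(2)[OF v] by (cases "c \<in> charts_at N y") auto
qed

lemma hom_norm_eq_local_metric:
  fixes \<xi> :: "real ^ 'm \<Rightarrow> ('a, 'e) tangent"
  assumes c: "c \<in> charts_at N y" and \<xi>: "\<xi> \<in> tangent_hom N y"
  defines "w e \<equiv> \<Sum>i\<in>UNIV. (e $ i) *\<^sub>R \<xi> (axis i 1) c"
  shows "hom_norm g y \<xi> = sqrt (\<Sum>e\<in>Basis. local_metric N g c (snd c y) (w e) (w e))"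
proof -
  have "\<xi> h c = w h" for h
    using linear_vec_expand[of "\<lambda>h. \<xi> h c" h] \<xi> c by (simp add: tangent_hom_def w_def)
  moreover have "g y (\<xi> h) (\<xi> h) = local_metric N g c (snd c y) (\<xi> h c) (\<xi> h c)" for h
    using \<xi> by (intro metric_eq_local_metric[OF c]) (auto simp: tangent_hom_def)
  ultimately show ?thesis by (simp add: hom_norm_def)
qed

text \<open>In a bundle chart the squared norm is a sum of local metrics at linear expressions in
  the fibre coordinates, hence continuous. These sublevel sets are the open exhaustion applied to
  compact subsets of the bundle.\<close>

lemma openin_hom_norm_less:
  fixes \<Omega> :: "(real ^ 'm) set"
  assumes \<Omega>: "open \<Omega>"
  shows "openin (mtopology (hom_bundle \<Omega> N))
    {P \<in> mcarrier (hom_bundle \<Omega> N). hom_norm g (fst (snd P)) (snd (snd P)) < k}" (is "openin _ ?W")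
  unfolding openin_mtopology_iff[OF injective_charts_hom_bundle[OF injective_charts]]
proof (intro conjI ballI)
  show "?W \<subseteq> mcarrier (hom_bundle \<Omega> N)" by blast
  fix C assume "C \<in> hom_bundle \<Omega> N"
  then obtain c where c: "c \<in> N" and C: "C = hom_chart \<Omega> N c" unfolding hom_bundle_def by blast
  define w where "w e p = (\<Sum>i\<in>UNIV. (e $ i) *\<^sub>R (snd (snd p) $ i))" for e :: "real ^ 'm" and p :: "('m, 'e) hom_model"
  define F where "F p = sqrt (\<Sum>e\<in>Basis. local_metric N g c (fst (snd p)) (w e p) (w e p))" for p :: "('m, 'e) hom_model"
  define D where "D = \<Omega> \<times> chart_image c \<times> (UNIV :: ('e ^ 'm) set)"
  have D: "open D" unfolding D_def using \<Omega> chart_open[OF c] by (intro open_Times) auto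
  have "continuous_on D F" unfolding F_def
    by (intro continuous_intros continuous_on_local_metric[OF c])
      (auto simp: D_def w_def intro!: continuous_intros)
  then have op: "open (D \<inter> F -` {..<k})" by (rule continuous_open_preimage) (use D in auto)
  have hn: "hom_norm g (fst (snd P)) (snd (snd P)) = F (snd C P)" if "P \<in> fst C" for P
  proof -
    obtain x y \<xi> where P: "P = (x, y, \<xi>)" by (cases P)
    then have "c \<in> charts_at N y" "\<xi> \<in> tangent_hom N y"
      using that c by (auto simp: C fst_hom_chart charts_at_def)
    then show ?thesis
      by (simp add: P C snd_hom_chart F_def w_def hom_norm_eq_local_metric)
  qed
  have "snd C ` (fst C \<inter> ?W) = D \<inter> F -` {..<k}"
  proof (intro equalityI subsetI)
    fix p assume "p \<in> snd C ` (fst C \<inter> ?W)"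
    then obtain P where P: "P \<in> fst C" "P \<in> ?W" "p = snd C P" by blast
    moreover obtain x y \<xi> where "P = (x, y, \<xi>)" by (cases P)
    ultimately have "p \<in> D" by (auto simp: C fst_hom_chart snd_hom_chart D_def chart_imageI)
    then show "p \<in> D \<inter> F -` {..<k}" using P hn[OF P(1)] by simp
  next
    fix p assume p: "p \<in> D \<inter> F -` {..<k}"
    obtain x z u where p': "p = (x, z, u)" by (cases p)
    then have x: "x \<in> \<Omega>" and z: "z \<in> chart_image c" using p by (auto simp: D_def)
    define P where "P = (x, chart_inv c z, hom_of_coords c (chart_inv c z) u)"
    have 1: "P \<in> fst C" and 2: "snd C P = p"
      using hom_chart_coords(1,2)[OF c x z, of u] by (simp_all add: P_def C p')
    moreover have "P \<in> mcarrier (hom_bundle \<Omega> N)"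
      using 1 c unfolding C mcarrier_def hom_bundle_def by blast
    ultimately have "P \<in> fst C \<inter> ?W" using p hn[OF 1] by simp
    then show "p \<in> snd C ` (fst C \<inter> ?W)" using 2 by blast
  qed
  then show "open (snd C ` (fst C \<inter> ?W))" using op by simp
qed

text \<open>The sublevel sets with integer bounds cover the bundle, and finitely many of them cover
  \<open>K\<close>.\<close>

lemma compactin_hom_norm_bounded:
  fixes \<Omega> :: "(real ^ 'm) set"
  assumes \<Omega>: "open \<Omega>" and K: "compactin (mtopology (hom_bundle \<Omega> N)) K"
  obtains k where "\<And>x y \<xi>. (x, y, \<xi>) \<in> K \<Longrightarrow> hom_norm g y \<xi> < k"
proof -
  define W where "W k = {P \<in> mcarrier (hom_bundle \<Omega> N). hom_norm g (fst (snd P)) (snd (snd P)) < real k}" for k :: nat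
  have "K \<subseteq> mcarrier (hom_bundle \<Omega> N)"
    using compactin_subset_topspace[OF K] openin_topspace[of "mtopology (hom_bundle \<Omega> N)"]
    unfolding openin_mtopology_iff[OF injective_charts_hom_bundle[OF injective_charts]] by blast
  moreover have "\<exists>k::nat. r < real k" for r by (rule reals_Archimedean2)
  ultimately have "K \<subseteq> \<Union>(range W)" by (auto simp: W_def)
  moreover have "openin (mtopology (hom_bundle \<Omega> N)) U" if "U \<in> range W" for U
    using that openin_hom_norm_less[OF \<Omega>] by (auto simp: W_def)
  ultimately obtain \<F> where F: "finite \<F>" "\<F> \<subseteq> range W" "K \<subseteq> \<Union>\<F>"
    using compactinD[OF K, of "range W"] by blast
  then obtain I where I: "finite I" "\<F> = W ` I" by (meson finite_subset_image)
  show thesis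
  proof (rule that)
    fix x y \<xi> assume "(x, y, \<xi>) \<in> K"
    then obtain i where i: "i \<in> I" "(x, y, \<xi>) \<in> W i" using F I by blast
    then have "hom_norm g y \<xi> < real i" by (simp add: W_def)
    also have "real i \<le> real (Max (insert 0 I))" using i I by simp
    finally show "hom_norm g y \<xi> < real (Max (insert 0 I))" .
  qed
qed

text \<open>The quotient of (Df v)^2 by g(v, v) is continuous on the product of a small closed ball
  and the unit sphere, hence bounded there; homogeneity of degree 2 on both sides extends the bound
  from unit vectors to all vectors.\<close>

lemma C1_local_bound:
  fixes f :: "'a \<Rightarrow> real"
  assumes f: "\<forall>c\<in>N. Ck_on 1 (f \<circ> chart_inv c) (chart_image c)" and y0: "y0 \<in> mcarrier N"
  obtains W C where "openin (mtopology N) W" "y0 \<in> W"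
    "\<And>y. y \<in> W \<Longrightarrow> \<bar>f y\<bar> \<le> C"
    "\<And>y v. y \<in> W \<Longrightarrow> v \<in> tangent_space N y \<Longrightarrow> (mdifferential N f y v)\<^sup>2 \<le> C * g y v v"
proof -
  obtain c where c: "c \<in> N" "y0 \<in> fst c" using y0 by (auto simp: mcarrier_def)
  have fc: "Ck_on 1 (f \<circ> chart_inv c) (chart_image c)" using f c(1) by blast
  obtain e where e: "0 < e" "cball (snd c y0) e \<subseteq> chart_image c"
    using chart_open[OF c(1)] chart_imageI[OF c(2)] open_contains_cball by blast
  let ?B = "cball (snd c y0) e" and ?D = "\<lambda>z. frechet_derivative (f \<circ> chart_inv c) (at z)"
  have lin: "linear (?D z)" if "z \<in> chart_image c" for z
    using fc that by (intro linear_frechet_derivative) auto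
  have "f \<circ> chart_inv c differentiable (at z)" if "z \<in> ?B" for z using fc e that by auto
  then have "continuous_on ?B (f \<circ> chart_inv c)"
    by (meson continuous_at_imp_continuous_on differentiable_imp_continuous_within)
  then have "compact ((f \<circ> chart_inv c) ` ?B)" by (intro compact_continuous_image) auto
  then obtain C1 where C1: "\<And>z. z \<in> ?B \<Longrightarrow> \<bar>(f \<circ> chart_inv c) z\<bar> \<le> C1"
    by (force dest!: compact_imp_bounded simp: bounded_pos)
  define S where "S = ?B \<times> sphere (0::'e) 1"
  define R where "R p = (?D (fst p) (snd p))\<^sup>2 / local_metric N g c (fst p) (snd p) (snd p)" for p
  have S: "compact S" unfolding S_def by (intro compact_Times) auto
  have pos: "0 < local_metric N g c (fst p) (snd p) (snd p)" if "p \<in> S" for p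
    using that e by (intro metric_positive[OF c(1)]) (auto simp: S_def)
  have fstS: "fst ` S \<subseteq> chart_image c" using e by (auto simp: S_def)
  have "continuous_on S (\<lambda>p. ?D (fst p) (snd p))"
  proof (rule continuous_on_linear_field[where L="\<lambda>p. ?D (fst p)"])
    show "linear (?D (fst p))" if "p \<in> S" for p using lin fstS that by blast
    have "continuous_on (chart_image c) (\<lambda>z. ?D z b)" for b using fc by simp
    then show "continuous_on S (\<lambda>p. ?D (fst p) b)" for b
      by (rule continuous_on_compose2[OF _ _ fstS]) (intro continuous_intros)
  qed (auto intro: continuous_intros)
  moreover have "continuous_on S (\<lambda>p. local_metric N g c (fst p) (snd p) (snd p))"
    by (rule continuous_on_local_metric[OF c(1) _ fstS]) (auto intro: continuous_intros)
  ultimately have "continuous_on S R"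
    unfolding R_def[abs_def] using pos by (intro continuous_intros) (auto simp: less_imp_neq[symmetric])
  then have "compact (R ` S)" using S by (rule compact_continuous_image)
  then obtain C2 where C2: "\<And>p. p \<in> S \<Longrightarrow> \<bar>R p\<bar> \<le> C2"
    by (force dest!: compact_imp_bounded simp: bounded_pos)
  have bound: "(?D z v)\<^sup>2 \<le> C2 * local_metric N g c z v v" if z: "z \<in> ?B" for z v
  proof (cases "v = 0")
    case True
    have z': "z \<in> chart_image c" using z e by blast
    show ?thesis
      using True linear_0[OF lin[OF z']] bilinear_lzero[OF metric_bilinear[OF c(1) z']] by simp
  next
    case False
    have z': "z \<in> chart_image c" using z e by blast
    define u where "u = v /\<^sub>R norm v"
    have zu: "(z, u) \<in> S" and v: "v = norm v *\<^sub>R u" using z False by (simp_all add: S_def u_def)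
    have "R (z, u) \<le> C2" using C2[OF zu] by linarith
    then have "(?D z u)\<^sup>2 / local_metric N g c z u u \<le> C2" by (simp add: R_def)
    then have "(?D z u)\<^sup>2 \<le> C2 * local_metric N g c z u u" using pos[OF zu] by (simp add: divide_le_eq)
    then have "(norm v)\<^sup>2 * (?D z u)\<^sup>2 \<le> (norm v)\<^sup>2 * (C2 * local_metric N g c z u u)"
      by (rule mult_left_mono) simp
    moreover have "(?D z v)\<^sup>2 = (norm v)\<^sup>2 * (?D z u)\<^sup>2"
      by (subst v) (simp add: linear_scale[OF lin[OF z']] power_mult_distrib)
    moreover have "local_metric N g c z v v = (norm v)\<^sup>2 * local_metric N g c z u u"
      by (subst (1 2) v) (rule local_metric_scaleR[OF c(1) z'])
    ultimately show ?thesis by (simp add: mult.left_commute)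
  qed
  define C where "C = max C1 C2"
  show thesis
  proof (rule that[of "{y \<in> fst c. snd c y \<in> ball (snd c y0) e}" C])
    show "openin (mtopology N) {y \<in> fst c. snd c y \<in> ball (snd c y0) e}"
      by (rule openin_chart_vimage[OF c(1)]) simp
    show "y0 \<in> {y \<in> fst c. snd c y \<in> ball (snd c y0) e}" using c e by simp
    fix y assume y: "y \<in> {y \<in> fst c. snd c y \<in> ball (snd c y0) e}"
    then have yc: "y \<in> fst c" and yB: "snd c y \<in> ?B" by auto
    have cy: "c \<in> charts_at N y" using yc c by (simp add: charts_at_def)
    have yN: "y \<in> mcarrier N" using yc c by (auto simp: mcarrier_def)
    have "(f \<circ> chart_inv c) (snd c y) = f y" using yc c by (simp add: chart_inv_cancel chart_inj)
    then show "\<bar>f y\<bar> \<le> C" using C1[OF yB] by (simp add: C_def)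
    fix v assume v: "v \<in> tangent_space N y"
    have "(mdifferential N f y v)\<^sup>2 \<le> C2 * g y v v"
      unfolding mdifferential_chart[OF f cy v] metric_eq_local_metric[OF cy v v] by (rule bound[OF yB])
    also have "\<dots> \<le> C * g y v v"
      using metric_nonneg(1)[OF yN v] by (intro mult_right_mono) (auto simp: C_def)
    finally show "(mdifferential N f y v)\<^sup>2 \<le> C * g y v v" .
  qed
qed

text \<open>Finitely many of the sets from \<open>C1_local_bound\<close> cover \<open>K\<close> and
  give a common constant. Off \<open>K\<close>, which is closed since the manifold is Hausdorff,
  \<open>f\<close> vanishes on an open set, so its differential is zero.\<close>

lemma C1_compact_support_bound:
  fixes f :: "'a \<Rightarrow> real"
  assumes "C1_compact_support N f"
  obtains C where "0 \<le> C" "\<And>y. y \<in> mcarrier N \<Longrightarrow> \<bar>f y\<bar> \<le> C"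
    "\<And>y v. y \<in> mcarrier N \<Longrightarrow> v \<in> tangent_space N y \<Longrightarrow> (mdifferential N f y v)\<^sup>2 \<le> C * g y v v"
proof -
  have f: "\<forall>c\<in>N. Ck_on 1 (f \<circ> chart_inv c) (chart_image c)"
    using assms by (simp add: C1_compact_support_def)
  obtain K where K: "compactin (mtopology N) K" and f0: "\<And>y. y \<in> mcarrier N - K \<Longrightarrow> f y = 0"
    using assms unfolding C1_compact_support_def by blast
  define P where "P C y \<longleftrightarrow> \<bar>f y\<bar> \<le> C \<and> (\<forall>v\<in>tangent_space N y. (mdifferential N f y v)\<^sup>2 \<le> C * g y v v)" for C y
  have mono: "P C' y" if "P C y" "C \<le> C'" "y \<in> mcarrier N" for C C' y
    using that metric_nonneg(1)[OF that(3)] mult_right_mono[OF that(2)]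
    unfolding P_def by (meson order_trans)
  define \<U> where "\<U> = {W. openin (mtopology N) W \<and> (\<exists>C. \<forall>y\<in>W. P C y)}"
  have KN: "K \<subseteq> mcarrier N" using compactin_subset_topspace[OF K] by (simp add: topspace_mtopology)
  have "\<exists>W\<in>\<U>. y \<in> W" if y: "y \<in> mcarrier N" for y
  proof -
    obtain W C where W: "openin (mtopology N) W" "y \<in> W" "\<And>y. y \<in> W \<Longrightarrow> \<bar>f y\<bar> \<le> C"
      "\<And>y v. y \<in> W \<Longrightarrow> v \<in> tangent_space N y \<Longrightarrow> (mdifferential N f y v)\<^sup>2 \<le> C * g y v v"
      by (rule C1_local_bound[OF f y]) blast
    then have "\<forall>y\<in>W. P C y" by (simp add: P_def)
    with W(1,2) show ?thesis unfolding \<U>_def by blast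
  qed
  then have "K \<subseteq> \<Union>\<U>" using KN by blast
  then obtain \<F> where F: "finite \<F>" "\<F> \<subseteq> \<U>" "K \<subseteq> \<Union>\<F>"
    using compactinD[OF K, of \<U>] unfolding \<U>_def by blast
  have "\<forall>W\<in>\<F>. \<exists>C. \<forall>y\<in>W. P C y" using F(2) by (auto simp: \<U>_def)
  then obtain CW where CW: "\<And>W y. W \<in> \<F> \<Longrightarrow> y \<in> W \<Longrightarrow> P (CW W) y" by metis
  \<comment> \<open>The inserted 0 makes \<open>C\<close> nonnegative, as the points off
    \<open>K\<close> require.\<close>
  define C where "C = Max (insert 0 (CW ` \<F>))"
  have C: "0 \<le> C" "\<And>W. W \<in> \<F> \<Longrightarrow> CW W \<le> C" using F(1) by (auto simp: C_def)
  have closed: "openin (mtopology N) (mcarrier N - K)"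
    using compactin_imp_closedin[OF hausdorff K] by (simp add: closedin_def topspace_mtopology)
  have "P C y" if y: "y \<in> mcarrier N" for y
  proof (cases "y \<in> K")
    case True
    then obtain W where "W \<in> \<F>" "y \<in> W" using F by blast
    then show ?thesis using CW C(2) mono y by blast
  next
    case False
    obtain c where c: "c \<in> charts_at N y" using charts_at_nonempty[OF y] by blast
    then have cN: "c \<in> N" "y \<in> fst c" by (auto simp: charts_at_def)
    have "((\<lambda>_. 0) has_derivative (\<lambda>_. 0)) (at (snd c y))" by simp
    then have "((f \<circ> chart_inv c) has_derivative (\<lambda>_. 0)) (at (snd c y))"
    proof (rule has_derivative_transform_within_open)
      show "open (snd c ` (fst c \<inter> (mcarrier N - K)))" using closed cN by (simp add: openin_mtopology)
      show "snd c y \<in> snd c ` (fst c \<inter> (mcarrier N - K))" using cN y False by blast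
      show "0 = (f \<circ> chart_inv c) z" if "z \<in> snd c ` (fst c \<inter> (mcarrier N - K))" for z
        using that cN f0 by (auto simp: chart_inv_cancel chart_inj)
    qed
    then have "frechet_derivative (f \<circ> chart_inv c) (at (snd c y)) = (\<lambda>_. 0)"
      by (rule frechet_derivative_at[symmetric])
    then have "mdifferential N f y v = 0" if "v \<in> tangent_space N y" for v
      using mdifferential_chart[OF f c that] by simp
    then show ?thesis
      using f0[of y] y False C(1) metric_nonneg(1)[OF y] by (simp add: P_def)
  qed
  then show thesis using C(1) by (intro that[of C]) (auto simp: P_def)
qed

end

lemma tangent_hom_zero:
  assumes "\<And>c c'. c \<in> charts_at A y \<Longrightarrow> c' \<in> charts_at A y \<Longrightarrow>
      transition c c' differentiable (at (snd c y))"
  shows "(\<lambda>h c. 0) \<in> tangent_hom A y"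
proof -
  have "frechet_derivative (transition c c') (at (snd c y)) 0 = 0"
    if "c \<in> charts_at A y" "c' \<in> charts_at A y" for c c'
    by (rule linear_0[OF linear_frechet_derivative[OF assms[OF that]]])
  then show ?thesis by (simp add: tangent_hom_def tangent_space_def linear_iff)
qed

lemma (in smooth_manifold) mdifferential_scaleR:
  fixes f :: "'a \<Rightarrow> real"
  assumes f: "\<forall>c\<in>N. Ck_on 1 (f \<circ> chart_inv c) (chart_image c)" and y: "y \<in> mcarrier N"
    and v: "v \<in> tangent_space N y"
  shows "mdifferential N f y (\<lambda>c. a *\<^sub>R v c) = a * mdifferential N f y v"
proof -
  obtain c where c: "c \<in> charts_at N y" using y by (auto simp: mcarrier_def charts_at_def)
  have "linear (frechet_derivative (f \<circ> chart_inv c) (at (snd c y)))"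
    using f c by (intro linear_frechet_derivative) (auto simp: charts_at_def chart_imageI)
  then show ?thesis
    by (simp add: mdifferential_chart[OF f c] v tangent_space_scaleR linear_scale)
qed

section \<open>Geodesics\<close>

context riemannian_manifold
begin

context
  fixes \<gamma> :: "real \<Rightarrow> 'a"
  assumes geodesic: "geodesic N g \<gamma>"
begin

lemma geodesic_mem: "\<gamma> t \<in> mcarrier N"
  using geodesic unfolding geodesic_def continuous_map_def by (auto simp: topspace_mtopology)

lemma open_geodesic_vimage:
  assumes "c \<in> N"
  shows "open {t. \<gamma> t \<in> fst c}"
proof -
  have "continuous_map euclideanreal (mtopology N) \<gamma>" using geodesic by (simp add: geodesic_def)
  from openin_continuous_map_preimage[OF this openin_chart_domain[OF assms]]
  show ?thesis by simp
qed

text \<open>The Christoffel term along the curve is continuous because the geodesic equation equates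
  it with minus the second derivative of the smooth curve. This avoids studying the regularity of
  \<open>levi_civita_form\<close>, which is given by a definite description.\<close>

lemma geodesic_derivatives:
  assumes c: "c \<in> N"
  shows "\<gamma> t \<in> fst c \<Longrightarrow> ((snd c \<circ> \<gamma>) has_vector_derivative velocity N \<gamma> t c) (at t)"
    and "\<gamma> t \<in> fst c \<Longrightarrow> ((\<lambda>s. velocity N \<gamma> s c) has_vector_derivative
      - levi_civita_form N g c (snd c (\<gamma> t)) (velocity N \<gamma> t c) (velocity N \<gamma> t c)) (at t)"
    and "continuous_on {t. \<gamma> t \<in> fst c} (\<lambda>t. velocity N \<gamma> t c)"
    and "continuous_on {t. \<gamma> t \<in> fst c}
      (\<lambda>t. levi_civita_form N g c (snd c (\<gamma> t)) (velocity N \<gamma> t c) (velocity N \<gamma> t c))"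
proof -
  define S where "S = {t. \<gamma> t \<in> fst c}"
  define q where "q = snd c \<circ> \<gamma>"
  define q' where "q' t = frechet_derivative q (at t) 1" for t
  define q'' where "q'' t = frechet_derivative q' (at t) 1" for t
  have S: "open S" unfolding S_def by (rule open_geodesic_vimage[OF c])
  have Ck: "Ck_on k q S" for k
    using geodesic c unfolding geodesic_def smooth_on_def q_def S_def by blast
  have q: "q differentiable (at t)" if "t \<in> S" for t using Ck[of "Suc 0"] that by simp
  have q'd: "q' differentiable (at t)" if "t \<in> S" for t
    using Ck[of "Suc (Suc 0)"] that by (simp add: q'_def[abs_def])
  have vd: "(f has_vector_derivative frechet_derivative f (at t) 1) (at t)"
    if "f differentiable (at t)" for f :: "real \<Rightarrow> 'e" and t
  proof -
    have "(f has_derivative frechet_derivative f (at t)) (at t)"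
      using that by (simp add: frechet_derivative_works[symmetric])
    moreover have "frechet_derivative f (at t) = (\<lambda>h. h *\<^sub>R frechet_derivative f (at t) 1)"
    proof
      fix h show "frechet_derivative f (at t) h = h *\<^sub>R frechet_derivative f (at t) 1"
        using linear_scale[OF linear_frechet_derivative[OF that], of h 1] by simp
    qed
    ultimately show ?thesis unfolding has_vector_derivative_def by metis
  qed
  have q'': "q'' t = vector_derivative q' (at t)" if "t \<in> S" for t
    using vector_derivative_at[OF vd[OF q'd[OF that]]] by (simp add: q''_def)
  have vel: "velocity N \<gamma> t c = q' t" and vq: "vector_derivative q (at t) = q' t" if "t \<in> S" for t
    using vector_derivative_at[OF vd[OF q[OF that]]] that c
    by (simp_all add: velocity_def charts_at_def S_def q'_def q_def)
  show 1: "((snd c \<circ> \<gamma>) has_vector_derivative velocity N \<gamma> t c) (at t)" if "\<gamma> t \<in> fst c"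
    using vd[OF q, of t] vel[of t] that by (simp add: S_def q_def q'_def)
  have acc: "q'' t = - levi_civita_form N g c (snd c (\<gamma> t)) (velocity N \<gamma> t c) (velocity N \<gamma> t c)"
    if t: "t \<in> S" for t
  proof -
    have "((\<lambda>s. vector_derivative q (at s)) has_vector_derivative q'' t) (at t)"
      using vd[OF q'd[OF t]] unfolding q''_def
      by (rule has_vector_derivative_transform_within_open[OF _ S t]) (simp add: vq)
    then have "vector_derivative (\<lambda>s. vector_derivative q (at s)) (at t) = q'' t"
      by (rule vector_derivative_at)
    moreover have "vector_derivative (\<lambda>s. vector_derivative q (at s)) (at t)
      + levi_civita_form N g c (snd c (\<gamma> t)) (vector_derivative q (at t)) (vector_derivative q (at t)) = 0"
      using geodesic c t unfolding geodesic_def q_def S_def by blast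
    ultimately show ?thesis using vel[OF t] vq[OF t] by (simp add: eq_neg_iff_add_eq_0)
  qed
  show "((\<lambda>s. velocity N \<gamma> s c) has_vector_derivative
      - levi_civita_form N g c (snd c (\<gamma> t)) (velocity N \<gamma> t c) (velocity N \<gamma> t c)) (at t)"
    if "\<gamma> t \<in> fst c"
  proof -
    have t: "t \<in> S" using that by (simp add: S_def)
    show ?thesis
      using vd[OF q'd[OF t]] unfolding acc[OF t, symmetric] q''_def
      by (rule has_vector_derivative_transform_within_open[OF _ S t]) (simp add: vel)
  qed
  have "continuous_on S q'" using Ck[of "Suc 0"] by (simp add: q'_def[abs_def])
  then show "continuous_on {t. \<gamma> t \<in> fst c} (\<lambda>t. velocity N \<gamma> t c)"
    unfolding S_def[symmetric] by (rule continuous_on_eq) (simp add: vel)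
  have "continuous_on S q''"
    using Ck[of "Suc (Suc 0)"] by (simp add: q''_def[abs_def] q'_def[abs_def])
  then have "continuous_on S (\<lambda>t. - q'' t)" by (rule continuous_on_minus)
  then show "continuous_on {t. \<gamma> t \<in> fst c}
      (\<lambda>t. levi_civita_form N g c (snd c (\<gamma> t)) (velocity N \<gamma> t c) (velocity N \<gamma> t c))"
    unfolding S_def[symmetric] by (rule continuous_on_eq) (simp add: acc)
qed

text \<open>Puts the curve into the same framework as \<open>u\<close> and the lift, so that the
  facts on differentials along maps apply to it.\<close>

lemma geodesic_C1_along: "C1_along N UNIV \<gamma> (\<lambda>t h c. h *\<^sub>R velocity N \<gamma> t c)"
  unfolding C1_along_def
  using geodesic_mem open_geodesic_vimage geodesic_derivatives(1,3)
  by (auto simp: has_vector_derivative_def intro!: continuous_intros)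

text \<open>The velocity is the tangent map of the curve applied to 1, so it inherits the
  transformation rule.\<close>

lemma velocity_mem: "velocity N \<gamma> t \<in> tangent_space N (\<gamma> t)"
proof -
  have "(\<lambda>c. 1 *\<^sub>R velocity N \<gamma> t c) \<in> tangent_space N (\<gamma> t)"
  proof (rule C1_along_tangent_space[OF injective_charts geodesic_C1_along])
    fix c c' assume "c \<in> charts_at N (\<gamma> t)" "c' \<in> charts_at N (\<gamma> t)"
    then show "transition c c' differentiable (at (snd c (\<gamma> t)))"
      using transition_has_derivative[of c c' "snd c (\<gamma> t)"]
      by (intro differentiableI) (auto simp: charts_at_def)
  qed (auto simp: velocity_def)
  then show ?thesis by simp
qed

text \<open>The derivative of the squared speed is \<open>2 g(\<nabla>\<gamma>', \<gamma>') = 0\<close>.\<close>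

lemma geodesic_speed_constant:
  "g (\<gamma> s) (velocity N \<gamma> s) (velocity N \<gamma> s) = g (\<gamma> t) (velocity N \<gamma> t) (velocity N \<gamma> t)"
proof -
  define E where "E t = g (\<gamma> t) (velocity N \<gamma> t) (velocity N \<gamma> t)" for t
  have "(E has_real_derivative 0) (at t)" for t
  proof -
    obtain c where c: "c \<in> N" "\<gamma> t \<in> fst c" using geodesic_mem[of t] by (auto simp: mcarrier_def)
    define z where "z = snd c (\<gamma> t)"
    define v where "v s = velocity N \<gamma> s c" for s
    define \<Gamma> where "\<Gamma> = levi_civita_form N g c z"
    have z: "z \<in> chart_image c" using c by (simp add: z_def chart_imageI)
    have lc: "is_levi_civita_form N g c z \<Gamma>"
      unfolding \<Gamma>_def levi_civita_form_def by (rule theI'[OF ex1_levi_civita_form[OF c(1) z]])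
    have bil: "bilinear (local_metric N g c z)" by (rule metric_bilinear[OF c(1) z])
    have "((\<lambda>s. local_metric N g c ((snd c \<circ> \<gamma>) s) (v s) (v s)) has_derivative
      (\<lambda>h. frechet_derivative (\<lambda>z. local_metric N g c z (v t) (v t)) (at z) (h *\<^sub>R v t)
         + local_metric N g c ((snd c \<circ> \<gamma>) t) (h *\<^sub>R - \<Gamma> (v t) (v t)) (v t)
         + local_metric N g c ((snd c \<circ> \<gamma>) t) (v t) (h *\<^sub>R - \<Gamma> (v t) (v t)))) (at t)"
    proof (rule has_derivative_bilinear_field[where B="local_metric N g c" and U="chart_image c"
          and f="snd c \<circ> \<gamma>" and A="\<lambda>v w. frechet_derivative (\<lambda>z. local_metric N g c z v w) (at z)"])
      show "open (chart_image c)" by (rule chart_open[OF c(1)])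
      show "(snd c \<circ> \<gamma>) t \<in> chart_image c" using z by (simp add: z_def)
      show "bilinear (local_metric N g c z)" if "z \<in> chart_image c" for z
        by (rule metric_bilinear[OF c(1) that])
      show "((\<lambda>z. local_metric N g c z v w) has_derivative
          frechet_derivative (\<lambda>z. local_metric N g c z v w) (at z)) (at ((snd c \<circ> \<gamma>) t))" for v w
        using local_metric_has_derivative[OF c(1) z] by (simp add: z_def)
      show "((snd c \<circ> \<gamma>) has_derivative (\<lambda>h. h *\<^sub>R v t)) (at t)"
        using geodesic_derivatives(1)[OF c] by (simp add: has_vector_derivative_def v_def)
      show "(v has_derivative (\<lambda>h. h *\<^sub>R - \<Gamma> (v t) (v t))) (at t)"
        using geodesic_derivatives(2)[OF c] by (simp add: has_vector_derivative_def v_def[abs_def] \<Gamma>_def z_def)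
      then show "(v has_derivative (\<lambda>h. h *\<^sub>R - \<Gamma> (v t) (v t))) (at t)" .
    qed
    moreover have "frechet_derivative (\<lambda>z. local_metric N g c z (v t) (v t)) (at z) (h *\<^sub>R v t)
         + local_metric N g c ((snd c \<circ> \<gamma>) t) (h *\<^sub>R - \<Gamma> (v t) (v t)) (v t)
         + local_metric N g c ((snd c \<circ> \<gamma>) t) (v t) (h *\<^sub>R - \<Gamma> (v t) (v t)) = 0" for h
    proof -
      \<comment> \<open>Compatibility of the connection with the metric in the direction
        \<open>h *\<^sub>R v t\<close>: the change of the metric along the curve is cancelled by the
        two acceleration terms.\<close>
      have "frechet_derivative (\<lambda>z. local_metric N g c z (v t) (v t)) (at z) (h *\<^sub>R v t)
        = local_metric N g c z (\<Gamma> (h *\<^sub>R v t) (v t)) (v t) + local_metric N g c z (v t) (\<Gamma> (h *\<^sub>R v t) (v t))"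
        using lc unfolding is_levi_civita_form_def by blast
      moreover have "\<Gamma> (h *\<^sub>R v t) (v t) = h *\<^sub>R \<Gamma> (v t) (v t)"
        using lc unfolding is_levi_civita_form_def by (blast intro: bilinear_lmul)
      ultimately show ?thesis
        using bil by (simp add: z_def bilinear_lneg bilinear_rneg)
    qed
    ultimately have "((\<lambda>s. local_metric N g c ((snd c \<circ> \<gamma>) s) (v s) (v s)) has_derivative (\<lambda>h. 0)) (at t)"
      by simp
    then have "(E has_derivative (\<lambda>h. 0)) (at t)"
    proof (rule has_derivative_transform_within_open[OF _ open_geodesic_vimage[OF c(1)]])
      fix s assume s: "s \<in> {t. \<gamma> t \<in> fst c}"
      then have "c \<in> charts_at N (\<gamma> s)" using c by (simp add: charts_at_def)
      then show "local_metric N g c ((snd c \<circ> \<gamma>) s) (v s) (v s) = E s"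
        by (simp add: E_def v_def metric_eq_local_metric velocity_mem)
    qed (use c in simp)
    then show ?thesis by (rule has_derivative_imp_has_field_derivative) simp
  qed
  then have "E s = E t" by (rule DERIV_isconst_all[rule_format])
  then show ?thesis by (simp add: E_def)
qed

text \<open>Constancy of the speed turns one zero into zero velocity everywhere; then \<gamma> is
  locally constant in charts and, as the line is connected, constant.\<close>

lemma geodesic_speed_positive:
  assumes "\<gamma> a \<noteq> \<gamma> b"
  shows "0 < g (\<gamma> t) (velocity N \<gamma> t) (velocity N \<gamma> t)"
proof (rule ccontr)
  assume "\<not> 0 < g (\<gamma> t) (velocity N \<gamma> t) (velocity N \<gamma> t)"
  then have "g (\<gamma> s) (velocity N \<gamma> s) (velocity N \<gamma> s) = 0" for s
    using metric_nonneg(1)[OF geodesic_mem velocity_mem, of s] geodesic_speed_constant[of s t] by linarith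
  then have vel: "velocity N \<gamma> s c = 0" for s c
    by (rule metric_nonneg(2)[OF geodesic_mem velocity_mem])
  have "\<forall>\<^sub>F s' in at s. \<gamma> s = \<gamma> s'" for s
  proof -
    obtain c where c: "c \<in> N" "\<gamma> s \<in> fst c" using geodesic_mem[of s] by (auto simp: mcarrier_def)
    obtain e where e: "e > 0" "ball s e \<subseteq> {t. \<gamma> t \<in> fst c}"
      using open_geodesic_vimage[OF c(1)] c(2) unfolding open_contains_ball by blast
    have const: "(snd c \<circ> \<gamma>) s' = (snd c \<circ> \<gamma>) s" if s': "s' \<in> ball s e" for s'
    proof (rule has_derivative_zero_unique[OF convex_ball _ s'])
      show "((snd c \<circ> \<gamma>) has_derivative (\<lambda>h. 0)) (at x within ball s e)" if "x \<in> ball s e" for x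
      proof -
        have "\<gamma> x \<in> fst c" using that e(2) by blast
        then show ?thesis
          using geodesic_derivatives(1)[OF c(1), of x]
          by (simp add: has_vector_derivative_def vel has_derivative_at_withinI)
      qed
      show "s \<in> ball s e" using e by simp
    qed
    have "\<gamma> s' = \<gamma> s" if "s' \<in> ball s e" for s'
    proof (rule inj_onD[OF chart_inj[OF c(1)]])
      show "\<gamma> s' \<in> fst c" using that e(2) by blast
    qed (use const[OF that] c(2) in simp_all)
    then have "\<And>s'. s' \<in> ball s e \<and> s' \<in> UNIV \<Longrightarrow> \<gamma> s = \<gamma> s'" by (metis (no_types))
    with eventually_at_ball[OF e(1)] show ?thesis by (rule eventually_mono)
  qed
  then have "\<gamma> a = \<gamma> b"
    by (intro connected_local_const[of UNIV]) auto
  with assms show False by contradiction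
qed

end
end

section \<open>Composition of a geodesic with a radial function\<close>

text \<open>The two bounds on \<alpha> make the radial function singular at the origin and its
  gradient locally integrable there.\<close>

locale radial_geodesic = riemannian_manifold N g
  for N :: "('a, 'e::euclidean_space) atlas" and g +
  fixes \<gamma> :: "real \<Rightarrow> 'a" and \<alpha> :: real and \<Omega> :: "(real ^ 'm) set"
  assumes geodesic: "geodesic N g \<gamma>" and nonconstant: "\<exists>s t. \<gamma> s \<noteq> \<gamma> t"
    and \<alpha>: "0 < \<alpha>" "\<alpha> + 1 < real CARD('m)" and \<Omega>: "open \<Omega>"
begin

definition u :: "real ^ 'm \<Rightarrow> 'a" where
  "u x = \<gamma> (radial \<alpha> 0 x)"

definition Tu :: "real ^ 'm \<Rightarrow> real ^ 'm \<Rightarrow> ('a, 'e) tangent" where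
  "Tu x h c = dradial \<alpha> 0 x h *\<^sub>R velocity N \<gamma> (radial \<alpha> 0 x) c"

definition T2u :: "real ^ 'm \<Rightarrow> real ^ 'm \<Rightarrow> (('m, 'a, 'e) hom_point, ('m, 'e) hom_model) tangent" where
  "T2u = second_tangent (\<Omega> - {0}) \<Omega> N u Tu"

definition speed :: real where
  "speed = sqrt (g (\<gamma> 0) (velocity N \<gamma> 0) (velocity N \<gamma> 0))"

lemma speed_pos: "0 < speed"
  using nonconstant geodesic_speed_positive[OF geodesic] by (auto simp: speed_def)

lemma speed_power2: "g (\<gamma> t) (velocity N \<gamma> t) (velocity N \<gamma> t) = speed\<^sup>2"
  using speed_pos geodesic_speed_constant[OF geodesic, of t 0] by (simp add: speed_def)

lemma u_mem: "u x \<in> mcarrier N"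
  by (simp add: u_def geodesic_mem[OF geodesic])

text \<open>Every value is a multiple of a velocity vector of \<gamma>, at the origin as well, where
  \<open>dradial\<close> vanishes.\<close>

lemma Tu_mem: "Tu x \<in> tangent_hom N (u x)"
  unfolding tangent_hom_def
proof (intro CollectI conjI allI ballI)
  show "Tu x h \<in> tangent_space N (u x)" for h
    using tangent_space_scaleR[OF velocity_mem[OF geodesic]] by (simp add: Tu_def[abs_def] u_def)
  show "linear (\<lambda>h. Tu x h c)" for c
    using linear_dradial[of \<alpha> 0 x] by (simp add: Tu_def linear_iff scaleR_left_distrib)
qed

lemma C1_along_u: "C1_along N (\<Omega> - {0}) u Tu"
  unfolding C1_along_def
proof (intro conjI ballI impI allI)
  show "open (\<Omega> - {0})" using \<Omega> by (rule open_delete)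
  fix c assume c: "c \<in> N"
  have cont: "continuous_on (\<Omega> - {0}) (radial \<alpha> 0)" by (rule continuous_on_radial) simp
  have "open ((\<Omega> - {0}) \<inter> radial \<alpha> 0 -` {t. \<gamma> t \<in> fst c})"
    by (rule continuous_open_preimage[OF cont]) (use \<Omega> open_geodesic_vimage[OF geodesic c] in auto)
  then show "open {x \<in> \<Omega> - {0}. u x \<in> fst c}" by (simp add: u_def vimage_def Int_def)
  show "((snd c \<circ> u) has_derivative (\<lambda>h. Tu x h c)) (at x)" if "x \<in> \<Omega> - {0}" "u x \<in> fst c" for x
  proof -
    have "(radial \<alpha> 0 has_derivative dradial \<alpha> 0 x) (at x)" using that by (intro radial_has_derivative) simp
    from has_derivative_compose[OF this, of "snd c \<circ> \<gamma>" "\<lambda>h. h *\<^sub>R velocity N \<gamma> (radial \<alpha> 0 x) c"]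
    show ?thesis
      using geodesic_derivatives(1)[OF geodesic c, of "radial \<alpha> 0 x"] that
      by (simp add: has_vector_derivative_def u_def[abs_def] Tu_def comp_def)
  qed
  show "continuous_on {x \<in> \<Omega> - {0}. u x \<in> fst c} (\<lambda>x. Tu x h c)" for h
    unfolding Tu_def
    by (intro continuous_intros continuous_on_dradial
        continuous_on_compose2[OF geodesic_derivatives(3)[OF geodesic c]] continuous_on_radial)
      (auto simp: u_def)
qed (rule u_mem)

text \<open>The derivative of the chart coordinates of \<open>Tu\<close>. The second term comes from
  \<gamma>'', which the geodesic equation has turned into minus the Christoffel term.\<close>

definition D2u :: "('a, 'e) chart \<Rightarrow> real ^ 'm \<Rightarrow> real ^ 'm \<Rightarrow> real ^ 'm \<Rightarrow> 'e" where
  "D2u c x h k = ddradial \<alpha> x h k *\<^sub>R velocity N \<gamma> (radial \<alpha> 0 x) c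
    - (dradial \<alpha> 0 x h * dradial \<alpha> 0 x k) *\<^sub>R levi_civita_form N g c (snd c (u x))
        (velocity N \<gamma> (radial \<alpha> 0 x) c) (velocity N \<gamma> (radial \<alpha> 0 x) c)"

lemma Tu_has_derivative:
  assumes c: "c \<in> N" "u x \<in> fst c" and x: "x \<noteq> 0"
  shows "((\<lambda>x. Tu x k c) has_derivative (\<lambda>h. D2u c x h k)) (at x)"
proof -
  define a where "a = - levi_civita_form N g c (snd c (u x))
        (velocity N \<gamma> (radial \<alpha> 0 x) c) (velocity N \<gamma> (radial \<alpha> 0 x) c)"
  have "(radial \<alpha> 0 has_derivative dradial \<alpha> 0 x) (at x)" using x by (intro radial_has_derivative) simp
  then have "((\<lambda>x. velocity N \<gamma> (radial \<alpha> 0 x) c) has_derivative (\<lambda>h. dradial \<alpha> 0 x h *\<^sub>R a)) (at x)"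
    by (rule has_derivative_compose)
      (use geodesic_derivatives(2)[OF geodesic c(1), of "radial \<alpha> 0 x"] c(2) in
        \<open>simp add: has_vector_derivative_def u_def a_def\<close>)
  from has_derivative_scaleR[OF dradial_has_derivative[OF x, of \<alpha> k] this]
  show ?thesis
    unfolding Tu_def D2u_def
    by (rule has_derivative_eq_rhs) (simp add: fun_eq_iff a_def mult.commute)
qed

lemma continuous_on_D2u:
  assumes c: "c \<in> N"
  shows "continuous_on {x \<in> \<Omega> - {0}. u x \<in> fst c} (\<lambda>x. D2u c x h k)"
  unfolding D2u_def u_def
  by (intro continuous_intros continuous_on_dradial continuous_on_ddradial
      continuous_on_compose2[OF geodesic_derivatives(3)[OF geodesic c]]
      continuous_on_compose2[OF geodesic_derivatives(4)[OF geodesic c]] continuous_on_radial)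
    auto

lemma C1_along_lift: "C1_along (hom_bundle \<Omega> N) (\<Omega> - {0}) (hom_lift u Tu) T2u"
  and T2u_eq: "c \<in> N \<Longrightarrow> x \<in> \<Omega> - {0} \<Longrightarrow> u x \<in> fst c \<Longrightarrow>
    T2u x h (hom_chart \<Omega> N c) = (h, Tu x h c, \<chi> i. D2u c x h (axis i 1))"
  unfolding T2u_def
  by (rule second_tangent[OF C1_along_u _ Tu_mem Tu_has_derivative continuous_on_D2u]; auto)+

lemma lift_mem: "x \<in> \<Omega> \<Longrightarrow> hom_lift u Tu x \<in> mcarrier (hom_bundle \<Omega> N)"
  by (simp add: hom_lift_def mem_mcarrier_hom_bundle u_mem Tu_mem)

text \<open>Off the origin from the differentiability of the lift, at the origin because
  \<open>second_tangent\<close> is the zero map there.\<close>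

lemma T2u_mem:
  assumes "x \<in> \<Omega>"
  shows "T2u x \<in> tangent_hom (hom_bundle \<Omega> N) (hom_lift u Tu x)"
proof -
  have diff: "transition C C' differentiable (at (snd C (hom_lift u Tu x)))"
    if "C \<in> charts_at (hom_bundle \<Omega> N) (hom_lift u Tu x)" "C' \<in> charts_at (hom_bundle \<Omega> N) (hom_lift u Tu x)"
    for C C'
    using that by (auto simp: charts_at_def hom_bundle_def intro: transition_hom_chart_differentiable[OF \<Omega>])
  show ?thesis
  proof (cases "x = 0")
    case True
    then have "T2u x = (\<lambda>h c. 0)" by (simp add: T2u_def second_tangent_def fun_eq_iff)
    then show ?thesis using tangent_hom_zero[OF diff] by simp
  next
    case False
    show ?thesis
      by (rule C1_along_tangent_hom[OF injective_charts_hom_bundle[OF injective_charts] C1_along_lift _ _ diff])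
        (use False assms in \<open>auto simp: T2u_def second_tangent_def\<close>)
  qed
qed

section \<open>Norms of the first and second covariant derivatives\<close>

lemma metric_velocity_scaleR:
  "g (u x) (\<lambda>c. a *\<^sub>R velocity N \<gamma> (radial \<alpha> 0 x) c) (\<lambda>c. a *\<^sub>R velocity N \<gamma> (radial \<alpha> 0 x) c) = a\<^sup>2 * speed\<^sup>2"
  using metric_scaleR[OF geodesic_mem[OF geodesic] velocity_mem[OF geodesic]]
  by (simp add: u_def speed_power2)

lemma hom_norm_Tu: "hom_norm g (u x) (Tu x) = speed * \<alpha> * norm x powr - (\<alpha> + 1)"
proof -
  have "(\<Sum>e\<in>Basis. g (u x) (Tu x e) (Tu x e)) = (\<Sum>e\<in>Basis. (dradial \<alpha> 0 x e)\<^sup>2) * speed\<^sup>2"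
    unfolding Tu_def[abs_def] metric_velocity_scaleR sum_distrib_right ..
  also have "\<dots> = (speed * \<alpha> * norm x powr - (\<alpha> + 1))\<^sup>2"
    by (simp add: sum_dradial_power2[OF \<alpha>(1)] power_mult_distrib)
  finally show ?thesis
    using speed_pos \<alpha> by (simp add: hom_norm_def)
qed

text \<open>As \<open>\<gamma>\<close> is a geodesic, only the term with the second derivative of the radial function
  survives.\<close>

lemma D_K_u:
  assumes x: "x \<in> \<Omega> - {0}"
  shows "D_K \<Omega> N g u Tu T2u x h k = (\<lambda>c. ddradial \<alpha> x h k *\<^sub>R velocity N \<gamma> (radial \<alpha> 0 x) c)"
proof
  fix c
  let ?v = "velocity N \<gamma> (radial \<alpha> 0 x)"
  show "D_K \<Omega> N g u Tu T2u x h k c = ddradial \<alpha> x h k *\<^sub>R ?v c"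
  proof (cases "c \<in> charts_at N (u x)")
    case True
    then have c: "c \<in> N" "u x \<in> fst c" by (auto simp: charts_at_def)
    let ?\<Gamma> = "levi_civita_form N g c (snd c (u x))"
    have "is_levi_civita_form N g c (snd c (u x)) ?\<Gamma>"
      unfolding levi_civita_form_def
      by (rule theI'[OF ex1_levi_civita_form[OF c(1) chart_imageI[OF c(2)]]])
    then have bil: "bilinear ?\<Gamma>" by (simp add: is_levi_civita_form_def)
    \<comment> \<open>Linearity recovers \<open>D2u\<close> at an arbitrary \<open>k\<close> from
      its values on the axes, which are all that the bundle coordinates record.\<close>
    have "linear (D2u c x h)"
      using linear_dradial[of \<alpha> 0 x]
      unfolding D2u_def[abs_def] linear_iff
      by (simp add: ddradial_def inner_right_distrib algebra_simps)
    from linear_vec_expand[OF this, of k]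
    have "(\<Sum>i\<in>UNIV. (k $ i) *\<^sub>R D2u c x h (axis i 1)) = D2u c x h k" by simp
    then have "D_K \<Omega> N g u Tu T2u x h k c = D2u c x h k + ?\<Gamma> (Tu x h c) (Tu x k c)"
      using True by (simp add: D_K_def hom_lift_def connection_map_def T2u_eq[OF c(1) x c(2)])
    \<comment> \<open>By bilinearity the added Christoffel term is the product of the two
      \<open>dradial\<close> factors with \<open>?\<Gamma> (?v c) (?v c)\<close>, which is just what
      \<open>D2u\<close> subtracts.\<close>
    also have "\<dots> = ddradial \<alpha> x h k *\<^sub>R ?v c"
      by (simp add: D2u_def Tu_def bilinear_lmul[OF bil] bilinear_rmul[OF bil])
    finally show ?thesis .
  next
    case False
    then show ?thesis by (simp add: D_K_def hom_lift_def connection_map_def velocity_def u_def)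
  qed
qed

lemma bihom_norm_D_K:
  obtains C where "0 \<le> C" "\<And>x. x \<in> \<Omega> - {0} \<Longrightarrow>
    bihom_norm g (u x) (D_K \<Omega> N g u Tu T2u x) = C * norm x powr - (\<alpha> + 2)"
proof -
  define C where "C = \<alpha>\<^sup>2 * ((\<alpha> + 2)\<^sup>2 - 2 * (\<alpha> + 2) + DIM(real ^ 'm))"
  have "0 \<le> C"
    using \<alpha>(1) unfolding C_def by (intro mult_nonneg_nonneg) (auto simp: power2_eq_square algebra_simps)
  show thesis
  proof (rule that[of "sqrt C * speed"])
    show "0 \<le> sqrt C * speed" using \<open>0 \<le> C\<close> speed_pos by simp
    fix x assume x: "x \<in> \<Omega> - {0}"
    have "(\<Sum>e\<in>Basis. \<Sum>e'\<in>Basis. g (u x) (D_K \<Omega> N g u Tu T2u x e e') (D_K \<Omega> N g u Tu T2u x e e'))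
      = (\<Sum>e\<in>Basis. \<Sum>e'\<in>Basis. (ddradial \<alpha> x e e')\<^sup>2) * speed\<^sup>2"
      unfolding D_K_u[OF x] metric_velocity_scaleR sum_distrib_right ..
    also have "\<dots> = C * (speed * norm x powr - (\<alpha> + 2))\<^sup>2"
      using x by (simp add: sum_ddradial_power2 C_def power_mult_distrib)
    finally show "bihom_norm g (u x) (D_K \<Omega> N g u Tu T2u x) = sqrt C * speed * norm x powr - (\<alpha> + 2)"
      using speed_pos by (simp add: bihom_norm_def real_sqrt_mult)
  qed
qed

text \<open>The derivative F' of \<open>f o \<gamma>\<close> is df(\<gamma>'), so its square is at
  most C g(\<gamma>', \<gamma>'), a constant. This gives the bound for all times that the
  composition with the radial function requires.\<close>

lemma has_weak_derivative_u:
  fixes f :: "'a \<Rightarrow> real"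
  assumes fcs: "C1_compact_support N f"
  shows "has_weak_derivative \<Omega> (f \<circ> u) (\<lambda>x v. mdifferential N f (u x) (Tu x v))"
proof -
  have f: "\<forall>c\<in>N. Ck_on 1 (f \<circ> chart_inv c) (chart_image c)"
    using fcs by (simp add: C1_compact_support_def)
  define F' where "F' t = mdifferential N f (\<gamma> t) (velocity N \<gamma> t)" for t
  have scale: "mdifferential N f (\<gamma> t) (\<lambda>c. h *\<^sub>R velocity N \<gamma> t c) = h * F' t" for t h
    unfolding F'_def by (rule mdifferential_scaleR[OF f geodesic_mem[OF geodesic] velocity_mem[OF geodesic]])
  note C = C1_along_mdifferential[OF injective_charts geodesic_C1_along[OF geodesic] f]
  have F: "((f \<circ> \<gamma>) has_real_derivative F' t) (at t)" for t
    by (rule has_derivative_imp_has_field_derivative[OF C(1)[of t, unfolded scale]]) simp_all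
  have F'c: "continuous_on UNIV F'" using C(2)[of 1] unfolding scale by simp
  obtain C where C: "0 \<le> C" "\<And>y. y \<in> mcarrier N \<Longrightarrow> \<bar>f y\<bar> \<le> C"
    "\<And>y v. y \<in> mcarrier N \<Longrightarrow> v \<in> tangent_space N y \<Longrightarrow> (mdifferential N f y v)\<^sup>2 \<le> C * g y v v"
    using C1_compact_support_bound[OF fcs] by metis
  have "(F' t)\<^sup>2 \<le> C * speed\<^sup>2" for t
    using C(3)[OF geodesic_mem[OF geodesic] velocity_mem[OF geodesic], of t]
    unfolding speed_power2 F'_def[symmetric] .
  from real_sqrt_le_mono[OF this] have "\<bar>F' t\<bar> \<le> sqrt (C * speed\<^sup>2)" for t by simp
  then have b1: "\<bar>F' t\<bar> \<le> max C (sqrt (C * speed\<^sup>2))" for t by (simp add: le_max_iff_disj)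
  have b2: "\<bar>(f \<circ> \<gamma>) t\<bar> \<le> max C (sqrt (C * speed\<^sup>2))" for t
    using C(2)[OF geodesic_mem[OF geodesic]] by (simp add: le_max_iff_disj)
  have "has_weak_derivative \<Omega> (\<lambda>x. (f \<circ> \<gamma>) (radial \<alpha> 0 x)) (\<lambda>x v. F' (radial \<alpha> 0 x) * dradial \<alpha> 0 x v)"
    by (rule has_weak_derivative_compose_radial[OF \<alpha>(1) _ \<Omega> F F'c b2 b1]) (use \<alpha>(2) in simp)
  moreover have "mdifferential N f (u x) (Tu x v) = F' (radial \<alpha> 0 x) * dradial \<alpha> 0 x v" for x v
    unfolding u_def Tu_def[abs_def] scale by simp
  ultimately show ?thesis by (simp add: comp_def u_def)
qed

text \<open>Since \<open>\<bar>Tu\<bar>\<close> tends to infinity at the origin, a compactly supported function of \<open>Tu\<close> vanishes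
  near the origin.\<close>

lemma has_weak_derivative_lift:
  fixes f :: "('m, 'a, 'e) hom_point \<Rightarrow> real"
  assumes fcs: "C1_compact_support (hom_bundle \<Omega> N) f"
  shows "has_weak_derivative \<Omega> (f \<circ> hom_lift u Tu)
    (\<lambda>x v. mdifferential (hom_bundle \<Omega> N) f (hom_lift u Tu x) (T2u x v))"
proof -
  let ?B = "hom_bundle \<Omega> N" and ?L = "hom_lift u Tu"
  have f: "\<forall>c\<in>?B. Ck_on 1 (f \<circ> chart_inv c) (chart_image c)"
    using fcs by (simp add: C1_compact_support_def)
  obtain K where K: "compactin (mtopology ?B) K" and f0: "\<And>P. P \<in> mcarrier ?B - K \<Longrightarrow> f P = 0"
    using fcs unfolding C1_compact_support_def by blast
  obtain k where k: "\<And>x y \<xi>. (x, y, \<xi>) \<in> K \<Longrightarrow> hom_norm g y \<xi> < k"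
    using compactin_hom_norm_bounded[OF \<Omega> K] by metis
  \<comment> \<open>The maximum with 1 keeps \<open>M\<close> positive whatever the sign of
    \<open>k\<close>; \<delta> is the radius at which |x|^(-\<alpha>-1) equals
    \<open>M\<close>.\<close>
  define M where "M = max 1 (k / (speed * \<alpha>))"
  define \<delta> where "\<delta> = M powr (- 1 / (\<alpha> + 1))"
  have sa: "0 < speed * \<alpha>" using speed_pos \<alpha>(1) by simp
  have \<delta>: "k \<le> speed * \<alpha> * t powr - (\<alpha> + 1)" if "0 < t" "t < \<delta>" for t
  proof -
    have "M = \<delta> powr - (\<alpha> + 1)"
    proof -
      have "- 1 / (\<alpha> + 1) * - (\<alpha> + 1) = 1" using \<alpha>(1) by (simp add: field_simps)
      then show ?thesis by (simp only: \<delta>_def powr_powr) (simp add: M_def)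
    qed
    also have "\<dots> \<le> t powr - (\<alpha> + 1)" using that \<alpha>(1) by (intro powr_mono2') auto
    finally have "k / (speed * \<alpha>) \<le> t powr - (\<alpha> + 1)" by (simp add: M_def)
    then show "k \<le> speed * \<alpha> * t powr - (\<alpha> + 1)"
      using sa by (simp add: pos_divide_le_eq mult.commute)
  qed
  have \<delta>_pos: "0 < \<delta>" by (simp add: \<delta>_def M_def)
  have zero: "f (?L x) = 0" if "x \<in> \<Omega>" "x \<noteq> 0" "norm x < \<delta>" for x
  proof (rule f0)
    have "k \<le> hom_norm g (u x) (Tu x)" using \<delta>[of "norm x"] that by (simp add: hom_norm_Tu)
    then show "?L x \<in> mcarrier ?B - K"
      using k[of x "u x" "Tu x"] lift_mem[OF that(1)] by (auto simp: hom_lift_def)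
  qed
  define E where "E x v = mdifferential ?B f (?L x) (T2u x v)" for x v
  \<comment> \<open>\<open>f\<close> need not vanish at the lift of the origin, where
    \<open>Tu\<close> is zero; the reset to 0 makes the function C^1 there.\<close>
  define h where "h x = (if x = 0 then 0 else f (?L x))" for x
  define D where "D x v = (if x = 0 then 0 else E x v)" for x v
  note C = C1_along_mdifferential[OF injective_charts_hom_bundle[OF injective_charts] C1_along_lift f]
  have hder: "(h has_derivative D x) (at x)" if "x \<in> \<Omega> - {0}" for x
  proof -
    have "((f \<circ> ?L) has_derivative D x) (at x)"
      using C(1)[OF that] that by (simp add: D_def[abs_def] E_def[abs_def])
    then show ?thesis
      by (rule has_derivative_transform_within_open[where s="- {0}"]) (use that in \<open>auto simp: h_def\<close>)
  qed
  have hder0: "(h has_derivative (\<lambda>_. 0)) (at x)" if "x \<in> \<Omega>" "norm x < \<delta>" for x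
  proof -
    have "((\<lambda>_. 0) has_derivative (\<lambda>_. 0)) (at x)" by simp
    then show ?thesis
      by (rule has_derivative_transform_within_open[where s="\<Omega> \<inter> ball 0 \<delta>"])
        (use that \<Omega> zero in \<open>auto simp: h_def\<close>)
  qed
  have D0: "D x v = 0" if "x \<in> \<Omega>" "norm x < \<delta>" for x v
  proof (cases "x = 0")
    case False
    then show ?thesis
      using has_derivative_unique[OF hder hder0[OF that]] that by (simp add: fun_eq_iff)
  qed (simp add: D_def)
  have "has_weak_derivative \<Omega> h D"
  proof (rule C1_has_weak_derivative[OF \<Omega>])
    show "(h has_derivative D x) (at x)" if x: "x \<in> \<Omega>" for x
    proof (cases "x = 0")
      case True
      then show ?thesis using hder0[of x] x \<delta>_pos by (simp add: D_def[abs_def])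
    qed (use hder x in simp)
    fix v
    \<comment> \<open>\<open>D\<close> vanishes on the second open set, and the two sets cover
      \<open>\<Omega>\<close> because \<delta> > 0.\<close>
    have "continuous_on ((\<Omega> - {0}) \<union> (\<Omega> \<inter> ball 0 \<delta>)) (\<lambda>x. D x v)"
    proof (rule continuous_on_open_Un)
      show "open (\<Omega> - {0})" "open (\<Omega> \<inter> ball 0 \<delta>)" using \<Omega> by auto
      show "continuous_on (\<Omega> - {0}) (\<lambda>x. D x v)"
        using C(2)[of v] by (rule continuous_on_eq) (simp add: D_def E_def)
      show "continuous_on (\<Omega> \<inter> ball 0 \<delta>) (\<lambda>x. D x v)"
        by (rule continuous_on_eq[of _ "\<lambda>_. 0"]) (use D0 in auto)
    qed
    then show "continuous_on \<Omega> (\<lambda>x. D x v)"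
      by (rule continuous_on_subset) (use \<delta>_pos in auto)
  qed
  then have "has_weak_derivative \<Omega> (f \<circ> ?L) E"
  proof (rule has_weak_derivative_spike[where S="{0}"])
    show "linear (E x)" if "x \<in> \<Omega>" for x
      unfolding E_def[abs_def]
      by (rule linear_mdifferential[OF lift_mem[OF that] f])
        (use T2u_mem[OF that] in \<open>simp add: tangent_hom_def\<close>)
  qed (auto simp: h_def D_def)
  then show ?thesis by (simp add: E_def[abs_def])
qed

section \<open>Sobolev membership and divergence of the integral\<close>

lemma is_colocal_weak_derivative_u: "is_colocal_weak_derivative \<Omega> N u Tu"
  unfolding is_colocal_weak_derivative_def
  using measurable_into_hom_lift[OF injective_charts C1_along_u u_mem Tu_mem] has_weak_derivative_u by blast

lemma is_colocal_weak_derivative_lift: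
  "is_colocal_weak_derivative \<Omega> (hom_bundle \<Omega> N) (hom_lift u Tu) T2u"
  unfolding is_colocal_weak_derivative_def
  using measurable_into_hom_lift[OF injective_charts_hom_bundle[OF injective_charts] C1_along_lift lift_mem T2u_mem]
    has_weak_derivative_lift by blast

lemma measurable_into_u: "measurable_into \<Omega> N u"
  by (rule C1_along_measurable_into[OF injective_charts u_mem C1_along_u])

lemma colocally_weakly_differentiable_u: "colocally_weakly_differentiable \<Omega> N u"
  unfolding colocally_weakly_differentiable_def weakly_differentiable_def
  using measurable_into_u has_weak_derivative_u by blast

lemma colocally_weakly_differentiable_lift:
  "colocally_weakly_differentiable \<Omega> (hom_bundle \<Omega> N) (hom_lift u Tu)"
  unfolding colocally_weakly_differentiable_def weakly_differentiable_def
  using C1_along_measurable_into[OF injective_charts_hom_bundle[OF injective_charts] lift_mem C1_along_lift]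
    has_weak_derivative_lift by blast

text \<open>Off the origin the integrand is a multiple of |x|^(-p(\<alpha>+2)), and the exponent
  condition is integrability of this power near 0.\<close>

lemma mem_W2_dot:
  assumes p: "1 \<le> p" "p * (\<alpha> + 2) < real CARD('m)" and \<Omega>_ball: "\<Omega> = ball 0 r"
  shows "u \<in> W2_dot p \<Omega> N g"
proof -
  obtain C where C: "0 \<le> C" "\<And>x. x \<in> \<Omega> - {0} \<Longrightarrow>
      bihom_norm g (u x) (D_K \<Omega> N g u Tu T2u x) = C * norm x powr - (\<alpha> + 2)"
    using bihom_norm_D_K by metis
  have "set_integrable lebesgue (ball 0 r) (\<lambda>x::real^'m. norm x powr - (p * (\<alpha> + 2)))"
    by (rule integrable_norm_powr(1)) (use p in simp)
  then have "set_integrable lebesgue \<Omega> (\<lambda>x. C powr p * norm x powr - (p * (\<alpha> + 2)))"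
    unfolding \<Omega>_ball by simp
  then have "set_integrable lebesgue \<Omega> (\<lambda>x. bihom_norm g (u x) (D_K \<Omega> N g u Tu T2u x) powr p)"
  proof (rule absolutely_integrable_spike)
    show "bihom_norm g (u x) (D_K \<Omega> N g u Tu T2u x) powr p = C powr p * norm x powr - (p * (\<alpha> + 2))"
      if "x \<in> \<Omega> - {0}" for x
      using C that by (simp add: powr_mult powr_powr algebra_simps)
  qed simp
  then have "integrable (lebesgue_on \<Omega>) (\<lambda>x. bihom_norm g (u x) (D_K \<Omega> N g u Tu T2u x) powr p)"
    unfolding set_integrable_def by (subst integrable_restrict_space) (auto simp: \<Omega>_ball)
  then show ?thesis
    unfolding W2_dot_def
    using colocally_weakly_differentiable_u is_colocal_weak_derivative_u
      colocally_weakly_differentiable_lift is_colocal_weak_derivative_lift by blast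
qed

text \<open>With 2p(\<alpha>+1) equal to the dimension, the integrand is a positive multiple of the
  critical power of |x|.\<close>

lemma nn_integral_hom_norm_Tu:
  assumes p: "0 < p" "2 * p * (\<alpha> + 1) = real CARD('m)" and r: "0 < r"
  shows "(\<integral>\<^sup>+x\<in>ball 0 r. ennreal (hom_norm g (u x) (Tu x) powr (2 * p)) \<partial>lebesgue) = \<infinity>"
proof -
  let ?C = "(speed * \<alpha>) powr (2 * p)"
  have C: "0 < speed * \<alpha>" using speed_pos \<alpha> by simp
  have "hom_norm g (u x) (Tu x) powr (2 * p) = ?C * norm x powr - real DIM(real ^ 'm)" for x
    using C p(2)[symmetric] by (simp add: hom_norm_Tu powr_mult powr_powr algebra_simps)
  then have "(\<integral>\<^sup>+x\<in>ball 0 r. ennreal (hom_norm g (u x) (Tu x) powr (2 * p)) \<partial>lebesgue)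
      = (\<integral>\<^sup>+x. ennreal ?C * (ennreal (norm x powr - real DIM(real ^ 'm)) * indicator (ball (0 :: real ^ 'm) r) x) \<partial>lborel)"
    by (simp add: nn_integral_completion ennreal_mult mult.assoc)
  also have "\<dots> = ennreal ?C * (\<integral>\<^sup>+x. ennreal (norm x powr - real DIM(real ^ 'm)) * indicator (ball (0 :: real ^ 'm) r) x \<partial>lborel)"
    by (rule nn_integral_cmult) (auto intro!: borel_measurable_times_ennreal borel_measurable_indicator)
  also have "\<dots> = \<infinity>"
    unfolding nn_integral_norm_powr_ball_eq_infinity[OF r] using speed_pos \<alpha>(1) by (simp add: ennreal_mult_top)
  finally show ?thesis .
qed

end

theorem proposition5p6:
  fixes N :: "('a, 'e::euclidean_space) atlas"
    and g :: "('a, 'e) metric"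
    and p r :: real
  assumes "riemannian_manifold N g"
    and "1 \<le> p"
    and "1 \<le> 2 * p" and "2 * p < real CARD('m)"
    and "0 < r"
    and "\<exists>\<gamma>. nontrivial_bounded_geodesic N g \<gamma>"
  shows "\<exists>u :: real^'m \<Rightarrow> 'a.
    u \<in> W2_dot p (ball 0 r) N g \<inter> L_infinity (ball 0 r) N g \<and>
    (\<exists>T. is_colocal_weak_derivative (ball 0 r) N u T \<and>
      (\<integral>\<^sup>+x\<in>ball 0 r. ennreal (hom_norm g (u x) (T x) powr (2 * p)) \<partial>lebesgue) = \<infinity>)"
proof -
  obtain \<gamma> where \<gamma>: "nontrivial_bounded_geodesic N g \<gamma>" using assms(6) by blast
  define m where "m = real CARD('m)"
  define \<alpha> where "\<alpha> = m / (2 * p) - 1"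
  have \<alpha>1: "\<alpha> + 1 = m / (2 * p)" by (simp add: \<alpha>_def)
  have m: "2 * p < m" using assms(4) by (simp add: m_def)
  have \<alpha>_pos: "0 < \<alpha>" using m assms(2) by (simp add: \<alpha>_def field_simps)
  \<comment> \<open>Since 2p > 1, the quotient \<alpha> + 1 = m/(2p) is smaller than m, as local
    integrability of the gradient demands.\<close>
  have "m * 1 < m * (2 * p)" using m assms(2) by (intro mult_strict_left_mono) auto
  then have \<alpha>_less: "\<alpha> + 1 < m" unfolding \<alpha>1 using assms(2) by (simp add: field_simps)
  interpret radial_geodesic N g \<gamma> \<alpha> "ball 0 r :: (real ^ 'm) set"
    using assms(1) \<gamma> \<alpha>_pos \<alpha>_less
    by (simp add: radial_geodesic_def radial_geodesic_axioms_def nontrivial_bounded_geodesic_def m_def)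
  \<comment> \<open>The requirement m/2 + p < m is exactly 2p < m.\<close>
  have "p * (\<alpha> + 2) = m / 2 + p" using assms(2) by (simp add: \<alpha>_def field_simps)
  then have "u \<in> W2_dot p (ball 0 r) N g"
    by (intro mem_W2_dot) (use assms(2) m in \<open>auto simp: m_def\<close>)
  \<comment> \<open>All values of \<open>u\<close> lie on \<gamma>, so the distance bound for
    \<gamma> holds at every pair of points.\<close>
  moreover have "u \<in> L_infinity (ball 0 r) N g"
    using measurable_into_u \<gamma>
    by (auto simp: L_infinity_def nontrivial_bounded_geodesic_def u_def)
  moreover have "(\<integral>\<^sup>+x\<in>ball 0 r. ennreal (hom_norm g (u x) (Tu x) powr (2 * p)) \<partial>lebesgue) = \<infinity>"
    by (rule nn_integral_hom_norm_Tu) (use assms(2,5) \<alpha>1 in \<open>simp_all add: m_def\<close>)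
  ultimately show ?thesis using is_colocal_weak_derivative_u by blast
qed

end
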